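(* Let $\Omega\subset\mathbb{R}^3$ be a Lipschitz domain, and suppose $\overline{\Omega}=\bigcup_{i=1}^\infty\overline{\Omega_i}$, where the domains $\Omega_i$ are pairwise disjoint and each $\Omega_i$ is a set of finite perimeter satisfying $\mathcal{H}^2(\partial\Omega_i\setminus\mathcal{F}\Omega_i)=0$ ($\mathcal{F}\Omega_i$ being the reduced boundary). Let $u\in H^1(\Omega;\mathbb{R}^3)$ satisfy a Dirichlet condition on a Lipschitz subset $\Gamma_D$ of $\partial\Omega$, and let $\beta=s\otimes m$ satisfy the relaxed-slip condition (RSC), with $m$ equal to a constant element $m^{(i)}\in\mathcal{M}$ on each $\Omega_i$. Suppose that $E_{\mathrm{rel}}(u,\beta)<\infty$. Then for each $\varepsilon>0$ there exists a pair $(u_\varepsilon,\beta_\varepsilon)$ with $u_\varepsilon\in H^1(\Omega;\mathbb{R}^3)$ satisfying the same Dirichlet condition on $\Gamma_D$ (i.e. $u_\varepsilon=u$ on $\Gamma_D$ in the sense of traces) and $\beta_\varepsilon\in L^\infty(\Omega;\mathbb{R}^{3\times3})$ satisfying the single-slip condition (SSC), such that $$E(u_\varepsilon,\beta_\varepsilon)\le E_{\mathrm{rel}}(u,\beta)+\varepsilon .$$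
   Context: Slip systems. $\mathcal{M}=\{m_1,\dots,m_M\}$ is a finite set of pairwise non-parallel unit vectors in $\mathbb{R}^3$ (slip normals). For each $i$ two linearly independent unit vectors (Burgers vectors) $b_{1,i},b_{2,i}\in m_i^\perp$ are given. Plastic distortions are matrix fields $\beta=s\otimes m:\Omega\to\mathbb{R}^{3\times3}$. (SSC): for a.e. $x\in\Omega$, $m(x)=m_{i(x)}\in\mathcal{M}$ and $s(x)$ is a real multiple of $b_{1,i(x)}$ or a real multiple of $b_{2,i(x)}$. (RSC): for a.e. $x\in\Omega$, $m(x)=m_{i(x)}\in\mathcal{M}$ and $s(x)\in m_{i(x)}^\perp$. Planar curl. Given $\beta=s\otimes m$ satisfying (RSC), let $A_j=\{x\in\Omega: m(x)=m_j\}$. For each $j$ use Cartesian coordinates $(x^1,y,z)$ with the $x^1$-axis in direction $m_j$, and put $\Omega_t=\Omega\cap\{x^1=t\}$. For a scalar or vector function $f$ on $\Omega_t$, $|D_{y,z}f|(\Omega_t)$ is its total variation on the planar open set $\Omega_t$ (supremum of $\sum_i\iint_{\Omega_t} f_i(\mathrm{div}\,\phi)_i\,dy\,dz$ over $\phi\in C^1_c$ with $|\phi|\le1$, the divergence being taken row-wise and $|\cdot|$ being the Euclidean/Frobenius norm; $+\infty$ if $f\notin BV$). Set $$\|\mathrm{curl}_{m_j}\beta\|_\Omega=\int_{\mathbb{R}}|D_{y,z}(\chi_{A_j}s)|(\Omega_t)\,dt,\qquad \|\mathrm{curl}_{\mathcal{M}}\beta\|_\Omega=\sum_{j=1}^M\|\mathrm{curl}_{m_j}\beta\|_\Omega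 .$$ Laminated quantities. On $A_j$ write $s=c_1b_{1,j}+c_2b_{2,j}$ (this defines scalar functions $c_1,c_2$ on $\Omega$). Set $$\|\mathrm{curl}_{m_j}\beta\|_{\mathrm{lam}}=\sum_{i=1}^2\int_{\mathbb{R}}|D_{y,z}(\chi_{A_j}c_i)|(\Omega_t)\,dt,\quad \|\mathrm{curl}_{\mathcal{M}}\beta\|_{\mathrm{lam}}=\sum_{j=1}^M\|\mathrm{curl}_{m_j}\beta\|_{\mathrm{lam}},\quad \|\beta\|_{1-\mathrm{lam}}=\sum_{i=1}^2\int_\Omega|c_i|\,dx .$$ Energies. Fix $\sigma,\tau\ge0$. With $A_{\mathrm{sym}}=\tfrac12(A+A^T)$, $$E(u,\beta)=\int_\Omega|(\nabla u-\beta)_{\mathrm{sym}}|^2dx+\sigma\|\mathrm{curl}_{\mathcal{M}}\beta\|_\Omega+\tau\int_\Omega|\beta|\,dx$$ if (SSC) holds, and $E(u,\beta)=+\infty$ otherwise; $$E_{\mathrm{rel}}(u,\beta)=\int_\Omega|(\nabla u-\beta)_{\mathrm{sym}}|^2dx+\sigma\|\mathrm{curl}_{\mathcal{M}}\beta\|_{\mathrm{lam}}+\tau\|\beta\|_{1-\mathrm{lam}}$$ if (RSC) holds, and $E_{\mathrm{rel}}(u,\beta)=+\infty$ otherwise. *)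

theory Defs
  imports "HOL-Analysis.Analysis"
begin

section \<open>Test fields and total variation\<close>

text \<open>Compactly supported \<open>C\<^sup>1\<close> maps on an open set, extended by zero to the whole space.\<close>

definition C1c :: "'a::euclidean_space set \<Rightarrow> ('a \<Rightarrow> 'b::real_normed_vector) set" where
  "C1c U = {\<phi>. (\<exists>D :: 'a \<Rightarrow> 'a \<Rightarrow>\<^sub>L 'b. continuous_on UNIV D \<and>
                   (\<forall>x. (\<phi> has_derivative blinfun_apply (D x)) (at x))) \<and>
               compact (closure {x. \<phi> x \<noteq> 0}) \<and> closure {x. \<phi> x \<noteq> 0} \<subseteq> U}"

definition divergence :: "('a::euclidean_space \<Rightarrow> 'a) \<Rightarrow> 'a \<Rightarrow> real" where
  "divergence \<phi> x = (\<Sum>e\<in>Basis. frechet_derivative \<phi> (at x) e \<bullet> e)"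

text \<open>The bare supremum; it is meaningful when \<open>f\<close> is locally integrable on \<open>U\<close>.\<close>

definition variation :: "'a::euclidean_space set \<Rightarrow> ('a \<Rightarrow> real) \<Rightarrow> ennreal" where
  "variation U f =
     (SUP \<phi>\<in>{\<phi> :: 'a \<Rightarrow> 'a. \<phi> \<in> C1c U \<and> (\<forall>x. norm (\<phi> x) \<le> 1)}.
        ennreal (LINT x:U|lebesgue. f x * divergence \<phi> x))"

text \<open>The value is \<open>\<infinity>\<close> when \<open>f\<close> is not in \<open>L\<^sup>1(U)\<close>, in particular not in \<open>BV(U)\<close>: the Bochner
  integral of a non-integrable function is 0, so this case has to be singled out.\<close>

definition tv_scalar :: "'a::euclidean_space set \<Rightarrow> ('a \<Rightarrow> real) \<Rightarrow> ennreal" where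
  "tv_scalar U f = (if set_integrable lebesgue U f then variation U f else \<infinity>)"

text \<open>For vector-valued \<open>f\<close> the test field is a matrix field with rows \<open>\<phi> x $ i\<close>; the norm of
  \<open>'a^'n\<close> is the Frobenius norm.\<close>

definition tv_vector :: "'a::euclidean_space set \<Rightarrow> ('a \<Rightarrow> real^'n) \<Rightarrow> ennreal" where
  "tv_vector U f =
     (if set_integrable lebesgue U f
      then (SUP \<phi>\<in>{\<phi> :: 'a \<Rightarrow> 'a^'n. \<phi> \<in> C1c U \<and> (\<forall>x. norm (\<phi> x) \<le> 1)}.
              ennreal (LINT x:U|lebesgue. \<Sum>i\<in>UNIV. f x $ i * divergence (\<lambda>y. \<phi> y $ i) x))
      else \<infinity>)"


section \<open>Hausdorff measure\<close>

text \<open>Covering sets are required to be bounded because \<open>diameter\<close> is unspecified otherwise.\<close>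

definition hausdorff_pre :: "real \<Rightarrow> nat \<Rightarrow> 'a::metric_space set \<Rightarrow> ennreal" where
  "hausdorff_pre \<delta> d A =
     (INF C\<in>{C :: nat \<Rightarrow> 'a set. A \<subseteq> (\<Union>n. C n) \<and> (\<forall>n. bounded (C n) \<and> diameter (C n) \<le> \<delta>)}.
        \<Sum>n. if C n = {} then 0 else ennreal (unit_ball_vol (real d) * (diameter (C n) / 2) ^ d))"

definition hausdorff_outer :: "nat \<Rightarrow> 'a::metric_space set \<Rightarrow> ennreal" where
  "hausdorff_outer d A = (SUP \<delta>\<in>{0<..}. hausdorff_pre \<delta> d A)"

text \<open>By Caratheodory's criterion \<open>hausdorff_outer d\<close> is a measure on the Borel sets, so this is
  the \<open>d\<close>-dimensional Hausdorff measure.\<close>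

definition hausdorff_measure :: "nat \<Rightarrow> 'a::metric_space measure" where
  "hausdorff_measure d = measure_of UNIV (sets borel) (hausdorff_outer d)"


section \<open>Finite perimeter and reduced boundary\<close>

definition finite_perimeter :: "'a::euclidean_space set \<Rightarrow> bool" where
  "finite_perimeter E \<longleftrightarrow> E \<in> sets lebesgue \<and> variation UNIV (indicator E) < \<infinity>"

text \<open>Polar form \<open>D\<chi>\<^sub>E = \<nu>\<mu>\<close> of the distributional derivative of \<open>\<chi>\<^sub>E\<close>, i.e. \<open>\<mu> = |D\<chi>\<^sub>E|\<close> and
  \<open>\<nu>\<close> is the generalised inner normal. For a set of finite perimeter \<open>\<mu>\<close> exists and is unique and
  \<open>\<nu>\<close> is unique up to \<open>\<mu>\<close>-null sets.\<close>

definition perimeter_polar ::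
    "'a::euclidean_space set \<Rightarrow> 'a measure \<Rightarrow> ('a \<Rightarrow> 'a) \<Rightarrow> bool" where
  "perimeter_polar E \<mu> \<nu> \<longleftrightarrow>
     sets \<mu> = sets borel \<and> finite_measure \<mu> \<and> \<nu> \<in> borel_measurable borel \<and>
     (AE x in \<mu>. norm (\<nu> x) = 1) \<and>
     (\<forall>\<phi> :: 'a \<Rightarrow> 'a. \<phi> \<in> C1c UNIV \<longrightarrow>
        (LINT x:E|lebesgue. divergence \<phi> x) = - (LINT x|\<mu>. \<phi> x \<bullet> \<nu> x))"

text \<open>De Giorgi's reduced boundary.\<close>

definition reduced_boundary :: "'a::euclidean_space set \<Rightarrow> 'a set" where
  "reduced_boundary E =
     {x. \<exists>\<mu> \<nu>. perimeter_polar E \<mu> \<nu> \<and> (\<forall>r>0. measure \<mu> (ball x r) > 0) \<and>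
           (\<exists>n. norm n = 1 \<and>
              ((\<lambda>r. (LINT y:ball x r|\<mu>. \<nu> y) /\<^sub>R measure \<mu> (ball x r)) \<longlongrightarrow> n) (at_right 0))}"


section \<open>Lipschitz domains and Lipschitz parts of the boundary\<close>

text \<open>The empty set is allowed, so that a sequence of domains may represent a finite family.\<close>

definition is_domain :: "(real^3) set \<Rightarrow> bool" where
  "is_domain S \<longleftrightarrow> open S \<and> connected S"

definition horizontal :: "real^3 \<Rightarrow> real^2" where
  "horizontal z = vector [z$1, z$2]"

text \<open>In the Cartesian coordinates \<open>z = Q *v x\<close> the set \<open>\<Omega>\<close> is, within the ball, the part lying
  strictly above the graph of \<open>\<gamma>\<close>.\<close>

definition lipschitz_chart ::
    "(real^3) set \<Rightarrow> real^3 \<Rightarrow> real \<Rightarrow> real^3^3 \<Rightarrow> (real^2 \<Rightarrow> real) \<Rightarrow> bool" where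
  "lipschitz_chart \<Omega> p r Q \<gamma> \<longleftrightarrow>
     r > 0 \<and> orthogonal_matrix Q \<and> (\<exists>L. L-lipschitz_on UNIV \<gamma>) \<and>
     (\<forall>x\<in>ball p r. x \<in> \<Omega> \<longleftrightarrow> \<gamma> (horizontal (Q *v x)) < (Q *v x) $ 3)"

definition lipschitz_domain :: "(real^3) set \<Rightarrow> bool" where
  "lipschitz_domain \<Omega> \<longleftrightarrow> is_domain \<Omega> \<and> (\<forall>p\<in>frontier \<Omega>. \<exists>r Q \<gamma>. lipschitz_chart \<Omega> p r Q \<gamma>)"

text \<open>A relatively open subset of \<open>\<partial>\<Omega>\<close> which, near each point of its relative boundary,
  corresponds in a graph chart of \<open>\<partial>\<Omega>\<close> to the region above a Lipschitz graph in the plane.\<close>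

definition lipschitz_boundary_part :: "(real^3) set \<Rightarrow> (real^3) set \<Rightarrow> bool" where
  "lipschitz_boundary_part \<Omega> \<Gamma> \<longleftrightarrow>
     openin (top_of_set (frontier \<Omega>)) \<Gamma> \<and>
     (\<forall>p \<in> closure \<Gamma> - \<Gamma>. \<exists>r Q \<gamma> (R :: real^2^2) (\<eta> :: real \<Rightarrow> real).
        lipschitz_chart \<Omega> p r Q \<gamma> \<and> orthogonal_matrix R \<and> (\<exists>L. L-lipschitz_on UNIV \<eta>) \<and>
        (\<forall>x \<in> frontier \<Omega> \<inter> ball p r.
           let y = R *v horizontal (Q *v x) in x \<in> \<Gamma> \<longleftrightarrow> \<eta> (y$1) < y$2))"


section \<open>Sobolev functions and traces\<close>

definition L2_on :: "(real^3) set \<Rightarrow> (real^3 \<Rightarrow> 'b::euclidean_space) \<Rightarrow> bool" where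
  "L2_on \<Omega> f \<longleftrightarrow> f \<in> borel_measurable (lebesgue_on \<Omega>) \<and>
     integrable (lebesgue_on \<Omega>) (\<lambda>x. (norm (f x))\<^sup>2)"

definition Linf_on :: "(real^3) set \<Rightarrow> (real^3 \<Rightarrow> 'b::euclidean_space) \<Rightarrow> bool" where
  "Linf_on \<Omega> f \<longleftrightarrow> f \<in> borel_measurable (lebesgue_on \<Omega>) \<and>
     (\<exists>K. AE x in lebesgue_on \<Omega>. norm (f x) \<le> K)"

definition has_weak_gradient ::
    "(real^3) set \<Rightarrow> (real^3 \<Rightarrow> real^3) \<Rightarrow> (real^3 \<Rightarrow> real^3^3) \<Rightarrow> bool" where
  "has_weak_gradient \<Omega> u G \<longleftrightarrow> L2_on \<Omega> u \<and> L2_on \<Omega> G \<and>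
     (\<forall>\<phi> :: real^3 \<Rightarrow> real. \<phi> \<in> C1c \<Omega> \<longrightarrow>
       (\<forall>i j. (LINT x:\<Omega>|lebesgue. u x $ i * frechet_derivative \<phi> (at x) (axis j 1))
              = - (LINT x:\<Omega>|lebesgue. G x $ i $ j * \<phi> x)))"

definition H1 :: "(real^3) set \<Rightarrow> (real^3 \<Rightarrow> real^3) set" where
  "H1 \<Omega> = {u. \<exists>G. has_weak_gradient \<Omega> u G}"

text \<open>Unique up to Lebesgue null sets for \<open>u \<in> H1 \<Omega>\<close>.\<close>

definition weak_grad :: "(real^3) set \<Rightarrow> (real^3 \<Rightarrow> real^3) \<Rightarrow> real^3 \<Rightarrow> real^3^3" where
  "weak_grad \<Omega> u = (SOME G. has_weak_gradient \<Omega> u G)"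

text \<open>The trace operator is the continuous extension to \<open>H1 \<Omega>\<close> of the restriction to \<open>\<partial>\<Omega>\<close> of
  functions in \<open>H1 \<Omega>\<close> that are continuous up to the boundary. Convergence of the boundary values is
  in \<open>L\<^sup>2\<close> on bounded parts of \<open>\<partial>\<Omega>\<close>, since \<open>\<Omega>\<close> need not be bounded.\<close>

definition has_trace :: "(real^3) set \<Rightarrow> (real^3 \<Rightarrow> real^3) \<Rightarrow> (real^3 \<Rightarrow> real^3) \<Rightarrow> bool" where
  "has_trace \<Omega> u h \<longleftrightarrow> u \<in> H1 \<Omega> \<and> h \<in> borel_measurable (hausdorff_measure 2) \<and>
     (\<exists>v :: nat \<Rightarrow> real^3 \<Rightarrow> real^3.
        (\<forall>k. v k \<in> H1 \<Omega> \<and> continuous_on (closure \<Omega>) (v k)) \<and>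
        (\<lambda>k. \<integral>\<^sup>+x\<in>\<Omega>. ennreal ((norm (v k x - u x))\<^sup>2 +
                  (norm (weak_grad \<Omega> (v k) x - weak_grad \<Omega> u x))\<^sup>2) \<partial>lebesgue) \<longlonglongrightarrow> 0 \<and>
        (\<forall>R>0. (\<lambda>k. \<integral>\<^sup>+x\<in>frontier \<Omega> \<inter> cball 0 R. ennreal ((norm (v k x - h x))\<^sup>2)
                  \<partial>hausdorff_measure 2) \<longlonglongrightarrow> 0))"

text \<open>The Dirichlet condition \<open>u = g\<close> on \<open>\<Gamma>\<close> in the sense of traces.\<close>

definition dirichlet_on ::
    "(real^3) set \<Rightarrow> (real^3) set \<Rightarrow> (real^3 \<Rightarrow> real^3) \<Rightarrow> (real^3 \<Rightarrow> real^3) \<Rightarrow> bool" where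
  "dirichlet_on \<Omega> \<Gamma> g u \<longleftrightarrow>
     (\<exists>h. has_trace \<Omega> u h \<and> (AE x in hausdorff_measure 2. x \<in> \<Gamma> \<longrightarrow> h x = g x))"


section \<open>Slip systems and slip conditions\<close>

definition tensor :: "real^3 \<Rightarrow> real^3 \<Rightarrow> real^3^3"  (infixl "\<otimes>" 70) where
  "a \<otimes> b = (\<chi> i j. a $ i * b $ j)"

definition sym_part :: "real^3^3 \<Rightarrow> real^3^3" where
  "sym_part A = (1/2) *\<^sub>R (A + transpose A)"

text \<open>Slip normals \<open>nv j\<close> and Burgers vectors \<open>b 1 j\<close>, \<open>b 2 j\<close>, for \<open>j\<close> in \<open>{1..M}\<close>.\<close>

definition slip_systems ::
    "nat \<Rightarrow> (nat \<Rightarrow> real^3) \<Rightarrow> (nat \<Rightarrow> nat \<Rightarrow> real^3) \<Rightarrow> bool" where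
  "slip_systems M nv b \<longleftrightarrow>
     (\<forall>j\<in>{1..M}. norm (nv j) = 1) \<and>
     (\<forall>i\<in>{1..M}. \<forall>j\<in>{1..M}. i \<noteq> j \<longrightarrow> (\<forall>c. nv i \<noteq> c *\<^sub>R nv j)) \<and>
     (\<forall>j\<in>{1..M}. (\<forall>k\<in>{1,2}. norm (b k j) = 1 \<and> b k j \<bullet> nv j = 0) \<and>
        b 1 j \<noteq> b 2 j \<and> independent {b 1 j, b 2 j})"

text \<open>A plastic distortion \<open>\<beta> = s \<otimes> m\<close> is given by the pair \<open>(s, m)\<close>. All quantities below depend
  on \<open>\<beta>\<close> only: if \<open>m\<close> takes values in the set of slip normals, then it is determined by \<open>\<beta>\<close> where
  \<open>\<beta> \<noteq> 0\<close>, and where \<open>\<beta> = 0\<close> one has \<open>s = 0\<close>.\<close>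

definition slip_field :: "(real^3) set \<Rightarrow> (real^3 \<Rightarrow> real^3) \<Rightarrow> (real^3 \<Rightarrow> real^3) \<Rightarrow> bool" where
  "slip_field \<Omega> s m \<longleftrightarrow>
     s \<in> borel_measurable (lebesgue_on \<Omega>) \<and> m \<in> borel_measurable (lebesgue_on \<Omega>)"

definition SSC :: "(real^3) set \<Rightarrow> nat \<Rightarrow> (nat \<Rightarrow> real^3) \<Rightarrow> (nat \<Rightarrow> nat \<Rightarrow> real^3) \<Rightarrow>
    (real^3 \<Rightarrow> real^3) \<Rightarrow> (real^3 \<Rightarrow> real^3) \<Rightarrow> bool" where
  "SSC \<Omega> M nv b s m \<longleftrightarrow>
     (AE x in lebesgue_on \<Omega>. \<exists>j\<in>{1..M}. m x = nv j \<and>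
        ((\<exists>c. s x = c *\<^sub>R b 1 j) \<or> (\<exists>c. s x = c *\<^sub>R b 2 j)))"

definition RSC :: "(real^3) set \<Rightarrow> nat \<Rightarrow> (nat \<Rightarrow> real^3) \<Rightarrow>
    (real^3 \<Rightarrow> real^3) \<Rightarrow> (real^3 \<Rightarrow> real^3) \<Rightarrow> bool" where
  "RSC \<Omega> M nv s m \<longleftrightarrow> (AE x in lebesgue_on \<Omega>. \<exists>j\<in>{1..M}. m x = nv j \<and> s x \<bullet> nv j = 0)"

definition slip_region :: "(real^3) set \<Rightarrow> (real^3 \<Rightarrow> real^3) \<Rightarrow> real^3 \<Rightarrow> (real^3) set" where
  "slip_region \<Omega> m n = {x\<in>\<Omega>. m x = n}"


section \<open>Planar curl\<close>

text \<open>An orthonormal frame (the columns of the matrix) whose first axis points in direction \<open>n\<close>,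
  for a unit vector \<open>n\<close>. The planar total variation does not depend on the choice of the other
  two axes.\<close>

definition frame :: "real^3 \<Rightarrow> real^3^3" where
  "frame n = (SOME Q. orthogonal_matrix Q \<and> Q *v axis 1 1 = n)"

definition slice_point :: "real^3 \<Rightarrow> real \<Rightarrow> real^2 \<Rightarrow> real^3" where
  "slice_point n t y = frame n *v vector [t, y$1, y$2]"

definition slice :: "(real^3) set \<Rightarrow> real^3 \<Rightarrow> real \<Rightarrow> (real^2) set" where
  "slice \<Omega> n t = {y. slice_point n t y \<in> \<Omega>}"

definition planar_curl :: "(real^3) set \<Rightarrow> real^3 \<Rightarrow>
    (real^3 \<Rightarrow> real^3) \<Rightarrow> (real^3 \<Rightarrow> real^3) \<Rightarrow> ennreal" where
  "planar_curl \<Omega> n s m =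
     (\<integral>\<^sup>+t. tv_vector (slice \<Omega> n t)
              (\<lambda>y. indicator (slip_region \<Omega> m n) (slice_point n t y) *\<^sub>R s (slice_point n t y))
        \<partial>lebesgue)"

definition total_curl :: "(real^3) set \<Rightarrow> nat \<Rightarrow> (nat \<Rightarrow> real^3) \<Rightarrow>
    (real^3 \<Rightarrow> real^3) \<Rightarrow> (real^3 \<Rightarrow> real^3) \<Rightarrow> ennreal" where
  "total_curl \<Omega> M nv s m = (\<Sum>j=1..M. planar_curl \<Omega> (nv j) s m)"


section \<open>Laminated quantities\<close>

text \<open>The pair \<open>(c\<^sub>1 x, c\<^sub>2 x)\<close>; arbitrary on the null set where (RSC) fails.\<close>

definition slip_coeffs :: "nat \<Rightarrow> (nat \<Rightarrow> real^3) \<Rightarrow> (nat \<Rightarrow> nat \<Rightarrow> real^3) \<Rightarrow>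
    (real^3 \<Rightarrow> real^3) \<Rightarrow> (real^3 \<Rightarrow> real^3) \<Rightarrow> real^3 \<Rightarrow> real \<times> real" where
  "slip_coeffs M nv b s m x =
     (THE c. \<exists>j\<in>{1..M}. m x = nv j \<and> s x = fst c *\<^sub>R b 1 j + snd c *\<^sub>R b 2 j)"

definition slip_coeff :: "nat \<Rightarrow> (nat \<Rightarrow> real^3) \<Rightarrow> (nat \<Rightarrow> nat \<Rightarrow> real^3) \<Rightarrow>
    (real^3 \<Rightarrow> real^3) \<Rightarrow> (real^3 \<Rightarrow> real^3) \<Rightarrow> nat \<Rightarrow> real^3 \<Rightarrow> real" where
  "slip_coeff M nv b s m i x =
     (if i = 1 then fst (slip_coeffs M nv b s m x) else snd (slip_coeffs M nv b s m x))"

definition planar_curl_lam :: "(real^3) set \<Rightarrow> nat \<Rightarrow> (nat \<Rightarrow> real^3) \<Rightarrow>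
    (nat \<Rightarrow> nat \<Rightarrow> real^3) \<Rightarrow> real^3 \<Rightarrow> (real^3 \<Rightarrow> real^3) \<Rightarrow> (real^3 \<Rightarrow> real^3) \<Rightarrow> ennreal" where
  "planar_curl_lam \<Omega> M nv b n s m =
     (\<Sum>i=1..2. \<integral>\<^sup>+t. tv_scalar (slice \<Omega> n t)
              (\<lambda>y. indicator (slip_region \<Omega> m n) (slice_point n t y) *
                   slip_coeff M nv b s m i (slice_point n t y))
        \<partial>lebesgue)"

definition total_curl_lam :: "(real^3) set \<Rightarrow> nat \<Rightarrow> (nat \<Rightarrow> real^3) \<Rightarrow>
    (nat \<Rightarrow> nat \<Rightarrow> real^3) \<Rightarrow> (real^3 \<Rightarrow> real^3) \<Rightarrow> (real^3 \<Rightarrow> real^3) \<Rightarrow> ennreal" where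
  "total_curl_lam \<Omega> M nv b s m = (\<Sum>j=1..M. planar_curl_lam \<Omega> M nv b (nv j) s m)"

definition L1_lam :: "(real^3) set \<Rightarrow> nat \<Rightarrow> (nat \<Rightarrow> real^3) \<Rightarrow>
    (nat \<Rightarrow> nat \<Rightarrow> real^3) \<Rightarrow> (real^3 \<Rightarrow> real^3) \<Rightarrow> (real^3 \<Rightarrow> real^3) \<Rightarrow> ennreal" where
  "L1_lam \<Omega> M nv b s m =
     (\<Sum>i=1..2. \<integral>\<^sup>+x\<in>\<Omega>. ennreal \<bar>slip_coeff M nv b s m i x\<bar> \<partial>lebesgue)"


section \<open>Energies\<close>

text \<open>Values in \<open>[0,\<infinity>]\<close>, with the convention \<open>0 * \<infinity> = 0\<close> for vanishing \<open>\<sigma>\<close> or \<open>\<tau>\<close>.\<close>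

definition elastic_energy :: "(real^3) set \<Rightarrow> (real^3 \<Rightarrow> real^3) \<Rightarrow>
    (real^3 \<Rightarrow> real^3) \<Rightarrow> (real^3 \<Rightarrow> real^3) \<Rightarrow> ennreal" where
  "elastic_energy \<Omega> u s m =
     (\<integral>\<^sup>+x\<in>\<Omega>. ennreal ((norm (sym_part (weak_grad \<Omega> u x - s x \<otimes> m x)))\<^sup>2) \<partial>lebesgue)"

definition energy :: "(real^3) set \<Rightarrow> nat \<Rightarrow> (nat \<Rightarrow> real^3) \<Rightarrow> (nat \<Rightarrow> nat \<Rightarrow> real^3) \<Rightarrow>
    real \<Rightarrow> real \<Rightarrow> (real^3 \<Rightarrow> real^3) \<Rightarrow> (real^3 \<Rightarrow> real^3) \<Rightarrow> (real^3 \<Rightarrow> real^3) \<Rightarrow> ennreal" where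
  "energy \<Omega> M nv b \<sigma> \<tau> u s m =
     (if SSC \<Omega> M nv b s m
      then elastic_energy \<Omega> u s m + ennreal \<sigma> * total_curl \<Omega> M nv s m
           + ennreal \<tau> * (\<integral>\<^sup>+x\<in>\<Omega>. ennreal (norm (s x \<otimes> m x)) \<partial>lebesgue)
      else \<infinity>)"

definition energy_rel :: "(real^3) set \<Rightarrow> nat \<Rightarrow> (nat \<Rightarrow> real^3) \<Rightarrow> (nat \<Rightarrow> nat \<Rightarrow> real^3) \<Rightarrow>
    real \<Rightarrow> real \<Rightarrow> (real^3 \<Rightarrow> real^3) \<Rightarrow> (real^3 \<Rightarrow> real^3) \<Rightarrow> (real^3 \<Rightarrow> real^3) \<Rightarrow> ennreal" where
  "energy_rel \<Omega> M nv b \<sigma> \<tau> u s m =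
     (if RSC \<Omega> M nv s m
      then elastic_energy \<Omega> u s m + ennreal \<sigma> * total_curl_lam \<Omega> M nv b s m
           + ennreal \<tau> * L1_lam \<Omega> M nv b s m
      else \<infinity>)"

end

theory Submission
  imports Defs
begin

text \<open>The recovery pair is a simple laminate. Where \<open>m = nv j\<close>, the slip
\<open>s = c\<^sub>1 b\<^sub>1 + c\<^sub>2 b\<^sub>2\<close> is replaced by a field which, as a function of the height
\<open>t = x \<bullet> nv j\<close>, alternates on a fine scale between \<open>2 c\<^sub>1 b\<^sub>1\<close> and \<open>2 c\<^sub>2 b\<^sub>2\<close>, and \<open>m\<close> is kept.
Such a field satisfies the single-slip condition, and it has to be compared with \<open>s\<close> in the
three terms of the energy.

The planar curl differentiates only along the planes
\<open>t = const\<close>, so the interfaces of the layers cost nothing: on each plane the new curl is twice the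
total variation of one of the two coefficients. If \<open>L\<close> is the set of heights that carry the first
slip direction, the new curl and mass for the layers \<open>L\<close> and for the complementary layers add up to
at most twice the laminated quantities. Hence, for every index \<open>j\<close>, one of the two choices does
not exceed them (\<open>exists_favourable_phase\<close>), whatever the thickness of the layers.

The difference of the two slip fields is \<open>\<theta> f\<close> with
\<open>f = c\<^sub>1 b\<^sub>1 - c\<^sub>2 b\<^sub>2\<close> and a square wave \<open>\<theta> = \<plusminus>1\<close> in \<open>t\<close>. A finite elastic energy forces \<open>s \<in> L\<^sup>2\<close>, since
\<open>|(s \<otimes> m)\<^sub>s\<^sub>y\<^sub>m|\<^sup>2 = |s|\<^sup>2 / 2\<close> for \<open>s \<bottom> m\<close>; so \<open>f\<close>, set to zero outside the region \<open>m = nv j\<close>,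
is an \<open>L\<^sup>2\<close> limit of test fields \<open>h\<close> supported in \<open>\<Omega>\<close>. If \<open>W\<close> is a small primitive of \<open>\<theta>\<close>, then
\<open>\<nabla>(W h) = \<theta> h \<otimes> nv j + W \<nabla>h\<close> is close in \<open>L\<^sup>2\<close> to \<open>\<theta> f \<otimes> nv j\<close>. The displacement is therefore
corrected by the sum \<open>w\<close> of the fields \<open>W h\<close> (\<open>laminate_corrector_exists\<close>). As \<open>w\<close> has compact support in
\<open>\<Omega>\<close>, it changes neither the membership in \<open>H1\<close> nor the trace.

To make the new field bounded, the coefficients are first composed with
\<open>t \<mapsto> K arctan (t / K)\<close>. This changes them little in \<open>L\<^sup>2\<close> for large \<open>K\<close> and does not increase any total
variation (\<open>tv_scalar_compose_le\<close>); the latter is the analytic core and is proved by mollification.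

The total variation of a slice is treated as an arbitrary function of the height. Its integral is
then a lower integral; such integrals are superadditive and split over measurable sets, which is
all that the layers need.\<close>

section \<open>Continuously differentiable maps and test fields\<close>

text \<open>In finite dimension, continuity of all directional derivatives amounts to continuity of the
derivative in operator norm, which \<open>C1c\<close> asks for; it is easier to check for products and
compositions. Lemma \<open>C1c_iff\<close> makes the transition.\<close>

definition C1_map :: "('a::euclidean_space \<Rightarrow> 'b::real_normed_vector) \<Rightarrow> bool" where
  "C1_map f \<longleftrightarrow> (\<forall>x. f differentiable (at x)) \<and>
     (\<forall>v. continuous_on UNIV (\<lambda>x. frechet_derivative f (at x) v))"

lemma C1_mapI:
  assumes "\<And>x. (f has_derivative f' x) (at x)" "\<And>v. continuous_on UNIV (\<lambda>x. f' x v)"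
  shows "C1_map f"
proof -
  have "frechet_derivative f (at x) = f' x" for x
    using frechet_derivative_at[OF assms(1)] by simp
  then show ?thesis
    using assms by (auto simp: C1_map_def differentiable_def)
qed

lemma C1_map_has_derivative:
  "C1_map f \<Longrightarrow> (f has_derivative frechet_derivative f (at x)) (at x)"
  by (simp add: C1_map_def frechet_derivative_works)

lemma C1_map_continuous_derivative [continuous_intros]:
  "C1_map f \<Longrightarrow> continuous_on S (\<lambda>x. frechet_derivative f (at x) v)"
  by (auto simp: C1_map_def intro: continuous_on_subset)

lemma C1_map_continuous: "C1_map f \<Longrightarrow> continuous_on S f"
  by (meson C1_map_has_derivative continuous_at_imp_continuous_on has_derivative_continuous)

lemma C1_map_const: "C1_map (\<lambda>x. c)"
  by (rule C1_mapI[where f'="\<lambda>_ _. 0"]) auto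

lemma C1_map_add: "C1_map f \<Longrightarrow> C1_map g \<Longrightarrow> C1_map (\<lambda>x. f x + g x)"
  by (rule C1_mapI[where f'="\<lambda>x v. frechet_derivative f (at x) v + frechet_derivative g (at x) v"])
     (auto intro!: has_derivative_add C1_map_has_derivative continuous_intros)

lemma C1_map_scaleR:
  fixes f :: "'a::euclidean_space \<Rightarrow> real"
  shows "C1_map f \<Longrightarrow> C1_map g \<Longrightarrow> C1_map (\<lambda>x. f x *\<^sub>R g x)"
  by (rule C1_mapI[where f'="\<lambda>x v. f x *\<^sub>R frechet_derivative g (at x) v + frechet_derivative f (at x) v *\<^sub>R g x"])
     (auto intro!: has_derivative_scaleR C1_map_has_derivative continuous_on_add continuous_on_scaleR
        C1_map_continuous_derivative intro: C1_map_continuous)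

lemma C1_map_linear:
  assumes "bounded_linear L" "C1_map f"
  shows "C1_map (\<lambda>x. L (f x))"
  by (rule C1_mapI[where f'="\<lambda>x v. L (frechet_derivative f (at x) v)"])
     (auto intro!: bounded_linear.has_derivative[OF assms(1)] C1_map_has_derivative[OF assms(2)]
        bounded_linear.continuous_on[OF assms(1)] C1_map_continuous_derivative[OF assms(2)])

lemma C1_map_compose_real:
  fixes f :: "'a::euclidean_space \<Rightarrow> real" and T T' :: "real \<Rightarrow> real"
  assumes "C1_map f" "\<And>t. (T has_real_derivative T' t) (at t)" "continuous_on UNIV T'"
  shows "C1_map (\<lambda>x. T (f x))"
proof (rule C1_mapI[where f'="\<lambda>x v. T' (f x) * frechet_derivative f (at x) v"])
  show "((\<lambda>x. T (f x)) has_derivative (\<lambda>v. T' (f x) * frechet_derivative f (at x) v)) (at x)" for x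
    using has_derivative_compose[OF C1_map_has_derivative[OF assms(1)]
        assms(2)[of "f x", unfolded has_field_derivative_def]] by (simp add: o_def)
  show "continuous_on UNIV (\<lambda>x. T' (f x) * frechet_derivative f (at x) v)" for v
    by (intro continuous_intros C1_map_continuous_derivative[OF assms(1)]
      continuous_on_compose2[OF assms(3)] C1_map_continuous[OF assms(1)]) auto
qed

lemma C1_map_shift:
  assumes "C1_map f"
  shows "frechet_derivative (\<lambda>x. f (x + z)) (at x) = frechet_derivative f (at (x + z))"
    and "C1_map (\<lambda>x. f (x + z))"
proof -
  have d: "((\<lambda>x. f (x + z)) has_derivative frechet_derivative f (at (x + z))) (at x)" for x
  proof -
    have "((\<lambda>x. x + z) has_derivative (\<lambda>v. v)) (at x)" by (auto intro!: derivative_eq_intros)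
    from has_derivative_compose[OF this C1_map_has_derivative[OF assms]] show ?thesis .
  qed
  show "frechet_derivative (\<lambda>x. f (x + z)) (at x) = frechet_derivative f (at (x + z))"
    using frechet_derivative_at[OF d] by simp
  show "C1_map (\<lambda>x. f (x + z))"
    using d by (rule C1_mapI) 
      (auto intro!: continuous_on_compose2[OF C1_map_continuous_derivative[OF assms, of UNIV]] continuous_intros)
qed

lemma C1c_iff:
  fixes \<phi> :: "'a::euclidean_space \<Rightarrow> 'b::real_normed_vector"
  shows "\<phi> \<in> C1c U \<longleftrightarrow> C1_map \<phi> \<and> (\<exists>K. compact K \<and> K \<subseteq> U \<and> (\<forall>x. x \<notin> K \<longrightarrow> \<phi> x = 0))"
proof
  assume \<phi>: "\<phi> \<in> C1c U"
  then obtain D :: "'a \<Rightarrow> 'a \<Rightarrow>\<^sub>L 'b" where D: "continuous_on UNIV D" "\<And>x. (\<phi> has_derivative blinfun_apply (D x)) (at x)"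
    by (auto simp: C1c_def)
  have "C1_map \<phi>"
    by (rule C1_mapI[OF D(2)]) (intro continuous_intros D)
  moreover have "\<forall>x. x \<notin> closure {x. \<phi> x \<noteq> 0} \<longrightarrow> \<phi> x = 0"
    using closure_subset[of "{x. \<phi> x \<noteq> 0}"] by auto
  ultimately show "C1_map \<phi> \<and> (\<exists>K. compact K \<and> K \<subseteq> U \<and> (\<forall>x. x \<notin> K \<longrightarrow> \<phi> x = 0))"
    using \<phi> unfolding C1c_def by blast
next
  assume *: "C1_map \<phi> \<and> (\<exists>K. compact K \<and> K \<subseteq> U \<and> (\<forall>x. x \<notin> K \<longrightarrow> \<phi> x = 0))"
  then obtain K where K: "compact K" "K \<subseteq> U" "\<And>x. x \<notin> K \<Longrightarrow> \<phi> x = 0" and c: "C1_map \<phi>"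
    by auto
  define D where "D x = Blinfun (frechet_derivative \<phi> (at x))" for x
  have D: "blinfun_apply (D x) = frechet_derivative \<phi> (at x)" for x
    unfolding D_def by (rule bounded_linear_Blinfun_apply) 
      (use C1_map_has_derivative[OF c] has_derivative_bounded_linear in blast)
  have "continuous_on UNIV D"
    by (rule continuous_on_blinfun_componentwise) (simp add: D C1_map_continuous_derivative[OF c])
  moreover have "closure {x. \<phi> x \<noteq> 0} \<subseteq> K"
    using K by (intro closure_minimal compact_imp_closed) auto
  moreover from this have "compact (closure {x. \<phi> x \<noteq> 0})"
    using K(1) by (metis closed_closure compact_Int_closed inf.absorb_iff2)
  ultimately show "\<phi> \<in> C1c U"
    using K(2) C1_map_has_derivative[OF c] by (auto simp: C1c_def D intro!: exI[of _ D])
qed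

lemma C1cE:
  fixes \<phi> :: "'a::euclidean_space \<Rightarrow> 'b::real_normed_vector"
  assumes "\<phi> \<in> C1c U"
  obtains K where "compact K" "K \<subseteq> U" "\<And>x. x \<notin> K \<Longrightarrow> \<phi> x = 0"
    "\<And>x v. x \<notin> K \<Longrightarrow> frechet_derivative \<phi> (at x) v = 0" 
proof -
  obtain K where K: "compact K" "K \<subseteq> U" "\<And>x. x \<notin> K \<Longrightarrow> \<phi> x = 0"
    using assms by (auto simp: C1c_iff)
  have "frechet_derivative \<phi> (at x) v = 0" if "x \<notin> K" for x v
  proof -
    have "open (- K)" using K(1) compact_imp_closed by blast
    have "(\<phi> has_derivative (\<lambda>_. 0)) (at x)"
      by (rule has_derivative_transform_within_open[of "\<lambda>_. 0" _ _ UNIV "- K"])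
        (use that K \<open>open (- K)\<close> in auto)
    then show ?thesis
      by (metis frechet_derivative_at)
  qed
  with K that show ?thesis by blast
qed

lemma C1c_C1_map: "\<phi> \<in> C1c U \<Longrightarrow> C1_map \<phi>"
  by (simp add: C1c_iff)

lemma C1c_mono: "\<phi> \<in> C1c U \<Longrightarrow> U \<subseteq> V \<Longrightarrow> \<phi> \<in> C1c V"
  by (auto simp: C1c_def)

text \<open>The derivative is continuous and vanishes off a compact set, so a single constant bounds the map and
its derivative and serves as a Lipschitz constant. It supplies the dominating functions below.\<close>

lemma C1c_bounds:
  fixes \<phi> :: "'a::euclidean_space \<Rightarrow> 'b::real_normed_vector"
  assumes "\<phi> \<in> C1c U"
  obtains B where "B > 0" "\<And>x. norm (\<phi> x) \<le> B"
    "\<And>x v. norm (frechet_derivative \<phi> (at x) v) \<le> B * norm v"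
    "\<And>x y. norm (\<phi> x - \<phi> y) \<le> B * norm (x - y)"
proof -
  obtain D :: "'a \<Rightarrow> 'a \<Rightarrow>\<^sub>L 'b" where D: "continuous_on UNIV D" "\<And>x. (\<phi> has_derivative blinfun_apply (D x)) (at x)"
    using assms by (auto simp: C1c_def)
  obtain K where K: "compact K" "K \<subseteq> U" "\<And>x. x \<notin> K \<Longrightarrow> \<phi> x = 0"
    "\<And>x v. x \<notin> K \<Longrightarrow> frechet_derivative \<phi> (at x) v = 0" 
    using C1cE[OF assms] by metis
  have fD: "frechet_derivative \<phi> (at x) = blinfun_apply (D x)" for x
    using frechet_derivative_at[OF D(2)] by simp
  have "bounded (D ` K)" "bounded (\<phi> ` K)"
    using K(1) D(1) C1_map_continuous[OF C1c_C1_map[OF assms]]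
    by (auto intro!: compact_imp_bounded compact_continuous_image intro: continuous_on_subset)
  then obtain B1 B2 where B: "\<And>x. x \<in> K \<Longrightarrow> norm (D x) \<le> B1" "\<And>x. x \<in> K \<Longrightarrow> norm (\<phi> x) \<le> B2"
    by (auto simp: bounded_iff)
  define B where "B = max 1 (max B1 B2)"
  have B0: "B > 0" by (simp add: B_def)
  have b: "norm (blinfun_apply (D x) v) \<le> B * norm v" for x v
  proof (cases "x \<in> K")
    case True
    have "norm (blinfun_apply (D x) v) \<le> norm (D x) * norm v" by (rule norm_blinfun)
    also have "\<dots> \<le> B * norm v" using B(1)[OF True] by (intro mult_right_mono) (auto simp: B_def)
    finally show ?thesis .
  next
    case False then show ?thesis using K(4)[OF False] fD B0 by simp
  qed
  have "norm (\<phi> x - \<phi> y) \<le> B * norm (x - y)" for x y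
    by (rule differentiable_bound[of UNIV \<phi> "\<lambda>x. blinfun_apply (D x)"])
       (use D(2) b in \<open>auto intro!: onorm_bound simp: B0 less_imp_le\<close>)
  moreover have "norm (\<phi> x) \<le> B" for x
    using B(2)[of x] K(3)[of x] B0 by (cases "x \<in> K") (auto simp: B_def)
  ultimately show ?thesis using that[of B] B0 b fD by auto
qed

lemma C1c_add: "\<phi> \<in> C1c U \<Longrightarrow> \<psi> \<in> C1c U \<Longrightarrow> (\<lambda>x. \<phi> x + \<psi> x) \<in> C1c U"
  unfolding C1c_iff
  apply (auto intro: C1_map_add)
  subgoal for K L by (rule exI[of _ "K \<union> L"]) auto
  done

lemma C1c_zero: "(\<lambda>x. 0) \<in> C1c U"
  unfolding C1c_iff by (auto intro: C1_map_const exI[of _ "{}"])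

lemma C1c_sum: "(\<And>i. i \<in> I \<Longrightarrow> \<phi> i \<in> C1c U) \<Longrightarrow> (\<lambda>x. \<Sum>i\<in>I. \<phi> i x) \<in> C1c U"
  by (induction I rule: infinite_finite_induct) (auto intro: C1c_add C1c_zero)

lemma C1c_linear:
  "bounded_linear L \<Longrightarrow> \<phi> \<in> C1c U \<Longrightarrow> (\<lambda>x. L (\<phi> x)) \<in> C1c U"
  unfolding C1c_iff using C1_map_linear by (metis linear_0 bounded_linear.linear)

lemma C1c_scaleR_C1_map:
  fixes f :: "'a::euclidean_space \<Rightarrow> real"
  shows "C1_map f \<Longrightarrow> \<phi> \<in> C1c U \<Longrightarrow> (\<lambda>x. f x *\<^sub>R \<phi> x) \<in> C1c U"
  unfolding C1c_iff by (metis C1_map_scaleR scaleR_zero_right)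

lemma integrable_compact_support:
  fixes f :: "'a::euclidean_space \<Rightarrow> 'b::{banach, second_countable_topology}"
  assumes "compact K" "continuous_on UNIV f" "\<And>x. x \<notin> K \<Longrightarrow> f x = 0"
  shows "integrable lborel f"
proof -
  have "integrable lborel (\<lambda>x. indicator K x *\<^sub>R f x)"
    using assms by (intro borel_integrable_compact) (auto intro: continuous_on_subset)
  moreover have "(\<lambda>x. indicator K x *\<^sub>R f x) = f"
    using assms(3) by (auto simp: indicator_def)
  ultimately show ?thesis by simp
qed

lemma
  fixes \<phi> :: "'a::euclidean_space \<Rightarrow> 'b::{banach, second_countable_topology}"
  assumes "\<phi> \<in> C1c U"
  shows C1c_integrable: "integrable lborel \<phi>"
    and C1c_integrable_derivative: "integrable lborel (\<lambda>x. frechet_derivative \<phi> (at x) v)"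
proof -
  obtain K where K: "compact K" "K \<subseteq> U" "\<And>x. x \<notin> K \<Longrightarrow> \<phi> x = 0"
    "\<And>x v. x \<notin> K \<Longrightarrow> frechet_derivative \<phi> (at x) v = 0" 
    using C1cE[OF assms] by metis
  note c = C1c_C1_map[OF assms]
  show "integrable lborel \<phi>" "integrable lborel (\<lambda>x. frechet_derivative \<phi> (at x) v)"
    using K C1_map_continuous[OF c] C1_map_continuous_derivative[OF c]
    by (auto intro!: integrable_compact_support[OF K(1)])
qed

lemma lborel_distr_plus_right: "distr lborel borel (\<lambda>x. x + z) = (lborel :: 'a::euclidean_space measure)"
proof -
  have "(\<lambda>x. x + z) = (\<lambda>x. z + x)" by (rule ext) (rule add.commute)
  then show ?thesis using lborel_distr_plus[of z] by simp
qed

lemma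
  fixes f :: "'a::euclidean_space \<Rightarrow> 'b::{banach, second_countable_topology}"
  shows lborel_integral_shift: "(LINT x|lborel. f (x + z)) = (LINT x|lborel. f x)"
    and lborel_integrable_shift: "integrable lborel f \<Longrightarrow> integrable lborel (\<lambda>x. f (x + z))"
proof -
  show 2: "integrable lborel f \<Longrightarrow> integrable lborel (\<lambda>x. f (x + z))" for f :: "'a \<Rightarrow> 'b" and z
    using integrable_distr[of "\<lambda>x. x + z" lborel borel f] by (simp add: lborel_distr_plus_right)
  show "(LINT x|lborel. f (x + z)) = (LINT x|lborel. f x)"
  proof (cases "integrable lborel f")
    case True
    then have "f \<in> borel_measurable borel" by auto
    then show ?thesis using integral_distr[of "\<lambda>x. x + z" lborel borel f] by (simp add: lborel_distr_plus_right)
  next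
    case False
    then have "\<not> integrable lborel (\<lambda>x. f (x + z))"
      using 2[of "\<lambda>x. f (x + z)" "- z"] by auto
    with False show ?thesis by (simp add: not_integrable_integral_eq)
  qed
qed

lemma lborel_nn_integral_shift:
  fixes f :: "'a::euclidean_space \<Rightarrow> ennreal"
  assumes "f \<in> borel_measurable borel"
  shows "(\<integral>\<^sup>+x. f (x + z) \<partial>lborel) = (\<integral>\<^sup>+x. f x \<partial>lborel)"
  using nn_integral_distr[of "\<lambda>x. x + z" lborel borel f] assms
  by (simp add: lborel_distr_plus_right)

text \<open>Difference quotients have integral zero by translation invariance, and they converge to the
derivative boundedly and on a common bounded set. This is the only form of integration by parts used.\<close>

theorem integral_derivative_C1c:
  fixes \<phi> :: "'a::euclidean_space \<Rightarrow> 'b::{banach, second_countable_topology}"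
  assumes "\<phi> \<in> C1c U"
  shows "(LINT x|lborel. frechet_derivative \<phi> (at x) v) = 0"
proof -
  obtain K where K: "compact K" "K \<subseteq> U" "\<And>x. x \<notin> K \<Longrightarrow> \<phi> x = 0"
    "\<And>x v. x \<notin> K \<Longrightarrow> frechet_derivative \<phi> (at x) v = 0" 
    using C1cE[OF assms] by metis
  obtain B where B: "B > 0" "\<And>x y. norm (\<phi> x - \<phi> y) \<le> B * norm (x - y)"
    using C1c_bounds[OF assms] by metis
  obtain R where R: "\<forall>x\<in>K. norm x \<le> R"
    using compact_imp_bounded[OF K(1)] unfolding bounded_iff by blast
  define q where "q n x = real (Suc n) *\<^sub>R (\<phi> (x + (1 / Suc n) *\<^sub>R v) - \<phi> x)" for n x
  note c = C1c_C1_map[OF assms]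
  have cont: "continuous_on S \<phi>" for S using C1_map_continuous[OF c] .
  have [measurable]: "\<phi> \<in> borel_measurable borel"
    using cont by (rule borel_measurable_continuous_onI)
  have "(\<lambda>n. LINT x|lborel. q n x) \<longlonglongrightarrow> (LINT x|lborel. frechet_derivative \<phi> (at x) v)"
  proof (rule integral_dominated_convergence[where w="\<lambda>x. indicator (cball 0 (R + norm v)) x *\<^sub>R (B * norm v)"])
    show "integrable lborel (\<lambda>x. indicator (cball 0 (R + norm v)) x *\<^sub>R (B * norm v) :: real)"
      by (rule borel_integrable_compact) auto
    show "AE x in lborel. (\<lambda>n. q n x) \<longlonglongrightarrow> frechet_derivative \<phi> (at x) v"
    proof (rule AE_I2)
      fix x
      let ?D = "frechet_derivative \<phi> (at x)"
      show "(\<lambda>n. q n x) \<longlonglongrightarrow> ?D v"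
      proof (cases "v = 0")
        case True
        then show ?thesis
          using linear_0[OF has_derivative_linear[OF C1_map_has_derivative[OF c, of x]]] by (simp add: q_def)
      next
        case False
        define h where "h n = (1 / Suc n) *\<^sub>R v" for n
        have sc: "?D (r *\<^sub>R v) = r *\<^sub>R ?D v" for r
          using linear_scale[OF has_derivative_linear[OF C1_map_has_derivative[OF c, of x]]] .
        have "h \<longlonglongrightarrow> 0" unfolding h_def
          by (rule tendsto_eq_intros LIMSEQ_Suc[OF lim_const_over_n] refl | simp)+
        then have h0: "filterlim h (at 0) sequentially"
          using False by (simp add: filterlim_at h_def)
        have "(\<lambda>h. norm (\<phi> (x + h) - \<phi> x - ?D h) / norm h) \<midarrow>0\<rightarrow> 0"
          using C1_map_has_derivative[OF c, of x] by (simp add: has_derivative_at)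
        from filterlim_compose[OF this h0]
        have "(\<lambda>n. norm (\<phi> (x + h n) - \<phi> x - ?D (h n)) / norm (h n)) \<longlonglongrightarrow> 0"
          by simp
        from tendsto_mult_right[OF this, of "norm v"]
        have "(\<lambda>n. norm (\<phi> (x + h n) - \<phi> x - ?D (h n)) / norm (h n) * norm v) \<longlonglongrightarrow> 0" by simp
        moreover have "norm (\<phi> (x + h n) - \<phi> x - ?D (h n)) / norm (h n) * norm v = norm (q n x - ?D v)" for n
        proof -
          have "q n x - ?D v = real (Suc n) *\<^sub>R (\<phi> (x + h n) - \<phi> x - ?D (h n))"
            unfolding q_def h_def sc by (simp add: scaleR_diff_right del: of_nat_Suc)
          moreover have "norm (h n) = norm v / real (Suc n)" by (simp add: h_def)
          ultimately show ?thesis using False by (simp only: norm_scaleR) (simp del: of_nat_Suc)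
        qed
        ultimately show ?thesis by (simp add: tendsto_norm_zero_iff LIM_zero_iff)
      qed
    qed
    show "AE x in lborel. norm (q n x) \<le> indicator (cball 0 (R + norm v)) x *\<^sub>R (B * norm v)" for n
    proof (rule AE_I2)
      fix x
      have "norm (q n x) \<le> real (Suc n) * (B * norm ((1 / Suc n) *\<^sub>R v))"
        unfolding q_def norm_scaleR using B(2)[of "x + (1 / Suc n) *\<^sub>R v" x]
        by (intro mult_mono) (simp_all del: of_nat_Suc)
      also have "\<dots> = B * norm v" by simp
      finally have 1: "norm (q n x) \<le> B * norm v" .
      show "norm (q n x) \<le> indicator (cball 0 (R + norm v)) x *\<^sub>R (B * norm v)"
      proof (cases "x \<in> cball 0 (R + norm v)")
        case False
        have "norm ((1 / Suc n) *\<^sub>R v) \<le> norm v" by (simp add: divide_simps algebra_simps)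
        then have "norm (x + (1 / Suc n) *\<^sub>R v) > R" 
          using False norm_diff_ineq[of x "(1 / Suc n) *\<^sub>R v"] by auto
        moreover have "norm x > R" using False norm_ge_zero[of v] by (simp del: norm_ge_zero)
        ultimately have "x \<notin> K" "x + (1 / Suc n) *\<^sub>R v \<notin> K"
          using R by fastforce+
        then show ?thesis using K(3) B(1) by (simp add: q_def)
      qed (use 1 in simp)
    qed
    show "(\<lambda>x. frechet_derivative \<phi> (at x) v) \<in> borel_measurable lborel"
      using C1_map_continuous_derivative[OF c] by (auto intro: borel_measurable_continuous_onI)
    show "q n \<in> borel_measurable lborel" for n
      unfolding q_def by measurable
  qed
  moreover have "(LINT x|lborel. q n x) = 0" for n
    unfolding q_def integral_scaleR_right
    by (subst Bochner_Integration.integral_diff)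
       (use lborel_integrable_shift[OF C1c_integrable[OF assms]] C1c_integrable[OF assms]
         lborel_integral_shift[of \<phi> "(1 / Suc n) *\<^sub>R v"] in simp_all)
  ultimately show ?thesis by (simp add: LIMSEQ_const_iff)
qed

section \<open>Mollification and cutoff functions\<close>

lemma C1_map_norm_square: "C1_map (\<lambda>x::'a::euclidean_space. a - (norm x)\<^sup>2)"
proof (rule C1_mapI[where f'="\<lambda>x v. - (2 * (x \<bullet> v))"])
  show "((\<lambda>x. a - (norm x)\<^sup>2) has_derivative (\<lambda>v. - (2 * (x \<bullet> v)))) (at x)" for x :: 'a
    unfolding power2_norm_eq_inner
    by (auto intro!: derivative_eq_intros simp: inner_commute)
qed (intro continuous_intros)

text \<open>Squaring the positive part removes its kink, so \<open>(max 0 (d\<^sup>2 - |x|\<^sup>2))\<^sup>2\<close> is a \<open>C\<^sup>1\<close> bump.\<close>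

lemma pos_part_square_derivative:
  "((\<lambda>t::real. (max 0 t)\<^sup>2) has_real_derivative 2 * max 0 t) (at t)"
proof -
  consider "t < 0" | "t = 0" | "t > 0" by linarith
  then show ?thesis
  proof cases
    case 1
    have "((\<lambda>t::real. 0) has_real_derivative 0) (at t)" by simp
    then have "((\<lambda>t::real. (max 0 t)\<^sup>2) has_real_derivative 0) (at t)"
      by (rule has_field_derivative_transform_within_open[where S="{..<0}"]) (use 1 in auto)
    then show ?thesis using 1 by simp
  next
    case 2
    have "((\<lambda>h. ((max 0 (0 + h))\<^sup>2 - (max 0 0)\<^sup>2) / h) \<longlongrightarrow> 0) (at (0::real))"
    proof (rule Lim_null_comparison[where g="\<lambda>h. \<bar>h\<bar>"])
      show "\<forall>\<^sub>F h in at (0::real). norm (((max 0 (0 + h))\<^sup>2 - (max 0 0)\<^sup>2) / h) \<le> \<bar>h\<bar>"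
        by (rule always_eventually) (auto simp: max_def power2_eq_square)
    qed (auto intro!: tendsto_eq_intros)
    then show ?thesis using 2 by (simp add: DERIV_def)
  next
    case 3
    have "((\<lambda>t::real. t\<^sup>2) has_real_derivative 2 * t) (at t)" by (auto intro!: derivative_eq_intros)
    then have "((\<lambda>t::real. (max 0 t)\<^sup>2) has_real_derivative 2 * t) (at t)"
      by (rule has_field_derivative_transform_within_open[where S="{0<..}"]) (use 3 in auto)
    then show ?thesis using 3 by simp
  qed
qed

text \<open>Evenness makes \<open>y \<mapsto> \<rho> (x - y)\<close> a translate of \<open>\<rho>\<close>, hence again of integral one.\<close>

definition mollifier :: "real \<Rightarrow> ('a::euclidean_space \<Rightarrow> real) \<Rightarrow> bool" where
  "mollifier d \<rho> \<longleftrightarrow> \<rho> \<in> C1c UNIV \<and> (\<forall>x. 0 \<le> \<rho> x) \<and> (\<forall>x. d \<le> norm x \<longrightarrow> \<rho> x = 0) \<and>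
     (\<forall>x. \<rho> (- x) = \<rho> x) \<and> (LINT x|lborel. \<rho> x) = 1"

lemma mollifier_exists:
  assumes "d > 0"
  shows "\<exists>\<rho> :: 'a::euclidean_space \<Rightarrow> real. mollifier d \<rho>"
proof -
  define r :: "'a \<Rightarrow> real" where "r x = (max 0 (d\<^sup>2 - (norm x)\<^sup>2))\<^sup>2" for x
  have c: "C1_map r"
    unfolding r_def by (rule C1_map_compose_real[OF C1_map_norm_square pos_part_square_derivative])
      (intro continuous_intros)
  have r0: "r x = 0" if "d \<le> norm x" for x
    using that assms power_mono[of d "norm x" 2] by (simp add: r_def)
  have rc: "r \<in> C1c UNIV"
    unfolding C1c_iff using c r0 by (auto intro!: exI[of _ "cball 0 d"] simp: not_le)
  have int: "integrable lborel r" by (rule C1c_integrable[OF rc])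
  have pos: "r x > 0" if "norm x < d" for x
    using that power_strict_mono[of "norm x" d 2] by (simp add: r_def)
  define I where "I = (LINT x|lborel. r x)"
  have "I \<noteq> 0"
  proof
    assume "I = 0"
    moreover have "(LINT x|lborel. r x) = 0 \<longleftrightarrow> (AE x in lborel. r x = 0)"
      by (rule integral_nonneg_eq_0_iff_AE[OF int]) (simp add: r_def)
    ultimately have "AE x in lborel. r x = 0" by (simp only: I_def)
    then have "AE x in lborel. x \<notin> ball (0::'a) d"
      by eventually_elim (use pos in force)
    then have "emeasure lborel (ball (0::'a) d) = 0"
      using AE_iff_null_sets[of "ball (0::'a) d" lborel] by auto
    then show False
      using assms by (simp add: emeasure_lborel_ball_finite emeasure_ball content_eq_0 unit_ball_vol_pos less_imp_neq[symmetric])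
  qed
  moreover have "I \<ge> 0" unfolding I_def by (rule integral_nonneg_AE) (simp add: r_def)
  ultimately have I: "I > 0" by simp
  have "mollifier d (\<lambda>x. (1 / I) *\<^sub>R r x)"
    unfolding mollifier_def
  proof (intro conjI allI impI)
    show "(\<lambda>x. (1 / I) *\<^sub>R r x) \<in> C1c UNIV"
      by (rule C1c_linear[OF bounded_linear_scaleR_right rc])
    show "(LINT x|lborel. (1 / I) *\<^sub>R r x) = 1"
      using I int by (simp add: I_def)
  qed (use I r0 in \<open>auto simp: r_def\<close>)
  then show ?thesis by blast
qed

definition convolve :: "('a::euclidean_space \<Rightarrow> real) \<Rightarrow> ('a \<Rightarrow> real) \<Rightarrow> 'a \<Rightarrow> real" where
  "convolve F \<rho> x = (LINT y|lborel. F y * \<rho> (x - y))"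

lemma integrable_mult_bounded:
  fixes F \<rho> :: "'a \<Rightarrow> real"
  assumes "integrable M F" "\<rho> \<in> borel_measurable M" "\<And>x. \<bar>\<rho> x\<bar> \<le> B"
  shows "integrable M (\<lambda>x. F x * \<rho> x)"
proof (rule Bochner_Integration.integrable_bound)
  show "integrable M (\<lambda>x. B * F x)" using assms by simp
  have "B \<ge> 0" using assms(3) abs_ge_zero order_trans by blast
  then show "AE x in M. norm (F x * \<rho> x) \<le> norm (B * F x)"
    using assms(3) by (intro AE_I2) (simp add: abs_mult mult.commute[of B] mult_left_mono)
qed (use assms in measurable)

text \<open>All derivatives fall on the kernel. Its difference quotients are bounded by a Lipschitz constant, so
dominated convergence applies with a multiple of \<open>|F|\<close> as majorant.\<close>

lemma C1_map_convolve:
  assumes F: "integrable lborel F" and \<rho>: "\<rho> \<in> C1c U"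
  shows "C1_map (convolve F \<rho>)"
proof (rule C1_mapI)
  obtain B where B: "B > 0" "\<And>x. norm (\<rho> x) \<le> B" "\<And>x y. norm (\<rho> x - \<rho> y) \<le> B * norm (x - y)"
    "\<And>x v. norm (frechet_derivative \<rho> (at x) v) \<le> B * norm v"
    using C1c_bounds[OF \<rho>] by metis
  note c = C1c_C1_map[OF \<rho>]
  have m1[measurable]: "\<rho> \<in> borel_measurable borel"
    using C1_map_continuous[OF c] by (rule borel_measurable_continuous_onI)
  have m2[measurable]: "(\<lambda>x. frechet_derivative \<rho> (at x) v) \<in> borel_measurable borel" for v
    using C1_map_continuous_derivative[OF c] by (rule borel_measurable_continuous_onI)
  have m3[measurable]: "F \<in> borel_measurable borel" using F by auto
  let ?D = "\<lambda>x v. LINT y|lborel. F y * frechet_derivative \<rho> (at (x - y)) v"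
  have linD: "linear (frechet_derivative \<rho> (at x))" for x
    using has_derivative_linear[OF C1_map_has_derivative[OF c]] .
  have i1: "integrable lborel (\<lambda>y. F y * \<rho> (x - y))" for x
    by (rule integrable_mult_bounded[OF F, of _ B]) (use B(2) in auto)
  have m2'[measurable]: "(\<lambda>y. frechet_derivative \<rho> (at (x - y)) v) \<in> borel_measurable borel" for x v
    by (rule measurable_compose[OF _ m2]) simp
  have i2: "integrable lborel (\<lambda>y. F y * frechet_derivative \<rho> (at (x - y)) v)" for x v
    by (rule integrable_mult_bounded[OF F, of _ "B * norm v"]) (use B(4) in auto)
  show "continuous_on UNIV (\<lambda>x. ?D x v)" for v
    unfolding continuous_on_sequentially o_def
  proof safe
    fix X :: "nat \<Rightarrow> 'a" and x assume X: "X \<longlonglongrightarrow> x"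
    show "(\<lambda>n. ?D (X n) v) \<longlonglongrightarrow> ?D x v"
    proof (rule integral_dominated_convergence[where w="\<lambda>y. (B * norm v) * \<bar>F y\<bar>"])
      show "AE y in lborel. (\<lambda>n. F y * frechet_derivative \<rho> (at (X n - y)) v)
          \<longlonglongrightarrow> F y * frechet_derivative \<rho> (at (x - y)) v"
      proof (rule AE_I2)
        fix y
        have "(\<lambda>n. X n - y) \<longlonglongrightarrow> x - y" using X by (intro tendsto_intros)
        with C1_map_continuous_derivative[OF c, of UNIV v]
        have "(\<lambda>n. frechet_derivative \<rho> (at (X n - y)) v) \<longlonglongrightarrow> frechet_derivative \<rho> (at (x - y)) v"
          by (auto simp: continuous_on_sequentially o_def)
        then show "(\<lambda>n. F y * frechet_derivative \<rho> (at (X n - y)) v)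
          \<longlonglongrightarrow> F y * frechet_derivative \<rho> (at (x - y)) v" by (rule tendsto_mult_left)
      qed
      show "AE y in lborel. norm (F y * frechet_derivative \<rho> (at (X n - y)) v) \<le> B * norm v * \<bar>F y\<bar>" for n
        using mult_right_mono[OF B(4)[of "X n - _" v] abs_ge_zero[of "F _"]]
        by (auto simp: abs_mult mult.commute)
    qed (use F in auto)
  qed
  show "(convolve F \<rho> has_derivative ?D x) (at x)" for x
    unfolding has_derivative_at
  proof
    show "bounded_linear (?D x)"
    proof (rule bounded_linear_intro[where K="B * (LINT y|lborel. \<bar>F y\<bar>)"])
      show "?D x (v + w) = ?D x v + ?D x w" for v w
        using i2 by (simp add: linear_add[OF linD] algebra_simps)
      show "?D x (r *\<^sub>R v) = r *\<^sub>R ?D x v" for r v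
        using i2 by (simp add: linear_scale[OF linD] algebra_simps)
      show "norm (?D x v) \<le> norm v * (B * (LINT y|lborel. \<bar>F y\<bar>))" for v
      proof -
        have "norm (?D x v) \<le> (LINT y|lborel. norm (F y * frechet_derivative \<rho> (at (x - y)) v))"
          by (rule integral_norm_bound)
        also have "\<dots> \<le> (LINT y|lborel. (B * norm v) * \<bar>F y\<bar>)"
          using mult_right_mono[OF B(4)[of "x - _" v] abs_ge_zero[of "F _"]] F
          by (intro integral_mono integrable_norm[OF i2]) (auto simp: abs_mult mult.commute)
        finally show ?thesis by (simp add: ac_simps)
      qed
    qed
    show "((\<lambda>h. norm (convolve F \<rho> (x + h) - convolve F \<rho> x - ?D x h) / norm h) \<longlongrightarrow> 0) (at 0)"
      unfolding tendsto_at_iff_sequentially o_def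
    proof safe
      fix X :: "nat \<Rightarrow> 'a" assume X: "\<forall>i. X i \<in> UNIV - {0}" "X \<longlonglongrightarrow> 0"
      let ?q = "\<lambda>n y. (\<rho> (x - y + X n) - \<rho> (x - y) - frechet_derivative \<rho> (at (x - y)) (X n)) / norm (X n)"
      have lim: "(\<lambda>n. LINT y|lborel. F y * ?q n y) \<longlonglongrightarrow> (LINT y|(lborel :: 'a measure). (0::real))"
      proof (rule integral_dominated_convergence[where M=lborel and s="\<lambda>n y. F y * ?q n y"
            and f="\<lambda>_. 0" and w="\<lambda>y. (2 * B) * \<bar>F y\<bar>"])
        show "AE y in lborel. (\<lambda>n. F y * ?q n y) \<longlonglongrightarrow> 0"
        proof (rule AE_I2)
          fix y
          have "((\<lambda>h. norm (\<rho> (x - y + h) - \<rho> (x - y) - frechet_derivative \<rho> (at (x - y)) h) / norm h) \<longlongrightarrow> 0) (at 0)"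
            using C1_map_has_derivative[OF c, of "x - y"] by (simp add: has_derivative_at)
          then have "(\<lambda>n. norm (?q n y)) \<longlonglongrightarrow> 0"
            using X unfolding tendsto_at_iff_sequentially o_def by auto
          then have "(\<lambda>n. ?q n y) \<longlonglongrightarrow> 0" by (rule tendsto_norm_zero_cancel)
          then show "(\<lambda>n. F y * ?q n y) \<longlonglongrightarrow> 0" by (rule tendsto_mult_right_zero)
        qed
        show "AE y in lborel. norm (F y * ?q n y) \<le> 2 * B * \<bar>F y\<bar>" for n
        proof (rule AE_I2)
          fix y
          have "norm (\<rho> (x - y + X n) - \<rho> (x - y) - frechet_derivative \<rho> (at (x - y)) (X n)) \<le> 2 * B * norm (X n)"
            using B(3)[of "x - y + X n" "x - y"] B(4)[of "x - y" "X n"] by (auto simp: abs_le_iff)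
          then have "\<bar>?q n y\<bar> \<le> 2 * B"
            using X(1) by (simp add: field_simps)
          then show "norm (F y * ?q n y) \<le> 2 * B * \<bar>F y\<bar>"
            unfolding real_norm_def abs_mult by (metis abs_ge_zero mult.commute mult_left_mono)
        qed
      qed (use F in auto)
      have eq: "\<bar>LINT y|lborel. F y * ?q n y\<bar> = 
          norm (convolve F \<rho> (x + X n) - convolve F \<rho> x - ?D x (X n)) / norm (X n)" for n
      proof -
        have "convolve F \<rho> (x + X n) - convolve F \<rho> x - ?D x (X n) =
          (LINT y|lborel. F y * \<rho> (x + X n - y) - F y * \<rho> (x - y) - F y * frechet_derivative \<rho> (at (x - y)) (X n))"
          unfolding convolve_def
          by (subst Bochner_Integration.integral_diff Bochner_Integration.integrable_diff; 
              (intro Bochner_Integration.integrable_diff i1 i2)?)+ simp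
        also have "\<dots> = (LINT y|lborel. norm (X n) * (F y * ?q n y))"
        proof (rule Bochner_Integration.integral_cong[OF refl])
          fix y
          have "norm (X n) * (F y * ?q n y) =
              F y * (\<rho> (x - y + X n) - \<rho> (x - y) - frechet_derivative \<rho> (at (x - y)) (X n))"
            using X(1) by simp
          moreover have "x - y + X n = x + X n - y" by simp
          ultimately show "F y * \<rho> (x + X n - y) - F y * \<rho> (x - y)
              - F y * frechet_derivative \<rho> (at (x - y)) (X n) = norm (X n) * (F y * ?q n y)"
            by (simp add: algebra_simps)
        qed
        also have "\<dots> = norm (X n) * (LINT y|lborel. F y * ?q n y)" by simp
        finally show ?thesis using X(1) by (simp add: abs_mult)
      qed
      show "(\<lambda>n. norm (convolve F \<rho> (x + X n) - convolve F \<rho> x - ?D x (X n)) / norm (X n)) \<longlonglongrightarrow> 0"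
        using tendsto_rabs[OF lim] by (simp only: eq Bochner_Integration.integral_zero abs_zero)
    qed
  qed
qed

lemma integral_mollifier_reflected:
  fixes \<rho> :: "'a::euclidean_space \<Rightarrow> real"
  assumes "mollifier d \<rho>"
  shows "(LINT y|lborel. \<rho> (x - y)) = 1"
proof -
  have "(LINT y|lborel. \<rho> (x - y)) = (LINT y|lborel. \<rho> (y + (- x)))"
    using assms by (intro Bochner_Integration.integral_cong) (auto simp: mollifier_def, metis minus_diff_eq)
  also have "\<dots> = 1" using assms unfolding lborel_integral_shift by (simp add: mollifier_def)
  finally show ?thesis .
qed

text \<open>The indicator of a closed neighbourhood of \<open>K\<close>, mollified at a scale below its thickness, is
constantly one on \<open>K\<close>.\<close>

lemma C1_cutoff_exists:
  fixes K U :: "'a::euclidean_space set"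
  assumes "compact K" "open U" "K \<subseteq> U"
  obtains \<eta> :: "'a \<Rightarrow> real" where "\<eta> \<in> C1c U" "\<And>x. 0 \<le> \<eta> x" "\<And>x. \<eta> x \<le> 1" "\<And>x. x \<in> K \<Longrightarrow> \<eta> x = 1"
proof (cases "K = {}")
  case True
  then show ?thesis using that[of "\<lambda>x. 0"] by (simp add: C1c_zero)
next
  case False
  obtain e where e: "e > 0" "{x. infdist x K \<le> e} \<subseteq> U"
    using compact_in_open_separated[OF False assms] .
  obtain \<rho> :: "'a \<Rightarrow> real" where \<rho>: "mollifier (e/2) \<rho>"
    using mollifier_exists[of "e/2"] e by auto
  define K' where "K' = {x. infdist x K \<le> e/2}"
  have K': "compact K'" unfolding K'_def using compact_infdist_le[OF False assms(1), of "e/2"] e by simp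
  define \<eta> where "\<eta> = convolve (indicator K') \<rho>"
  have int: "integrable lborel (indicator K' :: 'a \<Rightarrow> real)"
    using emeasure_compact_finite[OF K'] K' by (auto simp: compact_imp_closed borel_closed top.not_eq_extremum)
  have ri: "integrable lborel (\<lambda>y. \<rho> (x - y))" for x
    using integral_mollifier_reflected[OF \<rho>, of x] not_integrable_integral_eq by fastforce
  have i2: "integrable lborel (\<lambda>y. indicator K' y * \<rho> (x - y))" for x
    using integrable_mult_indicator[OF _ ri, of K' x] K' by (simp add: compact_imp_closed borel_closed)
  have \<rho>0: "\<rho> x \<ge> 0" for x using \<rho> by (simp add: mollifier_def)
  show ?thesis
  proof (rule that[of \<eta>])
    show "\<eta> \<in> C1c U"
      unfolding C1c_iff
    proof (intro conjI exI[of _ "{x. infdist x K \<le> e}"] allI impI)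
      show "C1_map \<eta>"
        unfolding \<eta>_def using int \<rho> by (auto simp: mollifier_def intro: C1_map_convolve)
      show "compact {x. infdist x K \<le> e}" by (rule compact_infdist_le[OF False assms(1) e(1)])
      fix x assume x: "x \<notin> {x. infdist x K \<le> e}"
      have z: "indicator K' y * \<rho> (x - y) = 0" for y
      proof (cases "y \<in> K'")
        case True
        have "infdist x K \<le> infdist y K + dist x y" by (rule infdist_triangle)
        then have "e/2 \<le> norm (x - y)" using x True by (simp add: K'_def dist_norm)
        then show ?thesis using \<rho> by (simp add: mollifier_def)
      qed simp
      show "\<eta> x = 0" unfolding \<eta>_def convolve_def z by simp
    qed (use e in simp)
    show "0 \<le> \<eta> x" for x
      unfolding \<eta>_def convolve_def using \<rho>0 by (intro integral_nonneg_AE) auto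
    show "\<eta> x \<le> 1" for x
    proof -
      have "\<eta> x \<le> (LINT y|lborel. \<rho> (x - y))"
        unfolding \<eta>_def convolve_def using \<rho>0 by (intro integral_mono i2 ri) (auto simp: indicator_def)
      then show ?thesis using integral_mollifier_reflected[OF \<rho>] by simp
    qed
    show "\<eta> x = 1" if "x \<in> K" for x
    proof -
      have z: "indicator K' y * \<rho> (x - y) = \<rho> (x - y)" for y
      proof (cases "y \<in> K'")
        case False
        have "infdist y K \<le> dist y x" using that by (rule infdist_le)
        then have "e/2 \<le> norm (x - y)" using False by (simp add: K'_def dist_norm norm_minus_commute)
        then show ?thesis using \<rho> by (simp add: mollifier_def)
      qed simp
      show ?thesis unfolding \<eta>_def convolve_def z by (rule integral_mollifier_reflected[OF \<rho>])
    qed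
  qed
qed

section \<open>Density of test fields in Lebesgue spaces\<close>

lemma C1c_borel_measurable_lebesgue:
  fixes \<phi> :: "'a::euclidean_space \<Rightarrow> 'b::euclidean_space"
  shows "\<phi> \<in> C1c U \<Longrightarrow> \<phi> \<in> borel_measurable lebesgue"
  using C1_map_continuous[OF C1c_C1_map, of \<phi> U UNIV]
  by (metis borel_measurable_continuous_onI measurable_completion measurable_lborel2)

text \<open>By regularity, \<open>A\<close> lies between a compact and an open set that differ by little; a cutoff between these
two can differ from the indicator of \<open>A\<close> only in the gap.\<close>

lemma indicator_C1c_approximation:
  fixes A U :: "'a::euclidean_space set"
  assumes A: "A \<in> sets lebesgue" "A \<subseteq> U" "emeasure lebesgue A < \<infinity>" and U: "open U" and e: "e > (0::real)"
  shows "\<exists>\<eta> :: 'a \<Rightarrow> real. \<eta> \<in> C1c U \<and> (\<forall>x. 0 \<le> \<eta> x \<and> \<eta> x \<le> 1) \<and>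
    emeasure lebesgue {x. \<eta> x \<noteq> indicator A x} < ennreal e"
proof -
  have e2: "e/2 > 0" using e by simp
  obtain T where T: "closed T" "T \<subseteq> A" "emeasure lebesgue (A - T) < ennreal (e/2)"
    using sets_lebesgue_inner_closed[OF A(1) e2] by metis
  define K where "K n = T \<inter> cball 0 (real n)" for n :: nat
  have K: "compact (K n)" for n unfolding K_def using T(1) by (simp add: closed_Int_compact)
  have Kl: "K n \<in> sets lebesgue" for n 
    by (rule sets_completionI_sets) (simp add: borel_compact[OF K])
  have "(\<lambda>n. emeasure lebesgue (A - K n)) \<longlonglongrightarrow> emeasure lebesgue (\<Inter>n. A - K n)"
  proof (rule Lim_emeasure_decseq)
    show "range (\<lambda>n. A - K n) \<subseteq> sets lebesgue" using A Kl by auto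
    show "decseq (\<lambda>n. A - K n)" by (auto simp: decseq_def K_def)
    show "emeasure lebesgue (A - K n) \<noteq> \<infinity>" for n
      using emeasure_mono[of "A - K n" A lebesgue] A by auto
  qed
  moreover have "(\<Inter>n. A - K n) = A - T"
    using real_arch_simple by (fastforce simp: K_def)
  ultimately have "(\<lambda>n. emeasure lebesgue (A - K n)) \<longlonglongrightarrow> emeasure lebesgue (A - T)" by simp
  from order_tendstoD(2)[OF this T(3)] obtain n where n: "emeasure lebesgue (A - K n) < ennreal (e/2)"
    by (auto simp: eventually_sequentially)
  obtain V where V: "open V" "A \<subseteq> V" "emeasure lebesgue (V - A) < ennreal (e/2)"
    using sets_lebesgue_outer_open[OF A(1) e2] by metis
  have "K n \<subseteq> V \<inter> U" using V T A by (auto simp: K_def)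
  then obtain \<eta> :: "'a \<Rightarrow> real" where \<eta>: "\<eta> \<in> C1c (V \<inter> U)" "\<And>x. 0 \<le> \<eta> x" "\<And>x. \<eta> x \<le> 1" "\<And>x. x \<in> K n \<Longrightarrow> \<eta> x = 1"
    using C1_cutoff_exists[OF K[of n], of "V \<inter> U"] V U by (metis open_Int)
  have out: "\<eta> x = 0" if "x \<notin> V \<inter> U" for x
    using \<eta>(1) that by (auto simp: C1c_iff)
  have sub: "{x. \<eta> x \<noteq> indicator A x} \<subseteq> (A - K n) \<union> (V - A)"
    using \<eta>(4) out T(2) A(2) V(2) by (fastforce simp: K_def indicator_def split: if_splits)
  have Vl: "V \<in> sets lebesgue" using V(1) by (intro sets_completionI_sets) simp
  have sets: "A - K n \<in> sets lebesgue" "V - A \<in> sets lebesgue" using A(1) Kl[of n] Vl by (simp_all add: sets.Diff)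
  have "emeasure lebesgue {x. \<eta> x \<noteq> indicator A x} \<le> emeasure lebesgue ((A - K n) \<union> (V - A))"
    using sets by (intro emeasure_mono sub sets.Un)
  also have "\<dots> \<le> emeasure lebesgue (A - K n) + emeasure lebesgue (V - A)"
    using sets by (rule emeasure_subadditive)
  also have "\<dots> < ennreal (e/2) + ennreal (e/2)"
    using n V(3) by (rule add_strict_mono)
  also have "\<dots> = ennreal e" using e by (simp flip: ennreal_plus)
  finally show ?thesis using \<eta> C1c_mono[OF \<eta>(1), of U] by auto
qed

text \<open>A crude substitute for the triangle inequality in \<open>L\<^sup>p\<close>.\<close>

lemma norm_sum_power_le:
  fixes a :: "'i \<Rightarrow> 'b::real_normed_vector"
  assumes "finite I" "p > 0"
  shows "norm (\<Sum>i\<in>I. a i) ^ p \<le> real (card I) ^ p * (\<Sum>i\<in>I. norm (a i) ^ p)"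
proof (cases "I = {}")
  case True then show ?thesis using assms by (simp add: zero_power)
next
  case False
  define m where "m = Max ((\<lambda>i. norm (a i)) ` I)"
  have "norm (\<Sum>i\<in>I. a i) \<le> real (card I) * m"
    using sum_norm_le[of I a "\<lambda>_. m"] assms by (simp add: m_def)
  moreover obtain j where j: "j \<in> I" "m = norm (a j)"
  proof -
    have "m \<in> (\<lambda>i. norm (a i)) ` I" unfolding m_def using assms False by (intro Max_in) auto
    then show thesis using that by blast
  qed
  ultimately have "norm (\<Sum>i\<in>I. a i) ^ p \<le> (real (card I) * norm (a j)) ^ p"
    by (intro power_mono) auto
  also have "\<dots> = real (card I) ^ p * norm (a j) ^ p" by (rule power_mult_distrib)
  also have "\<dots> \<le> real (card I) ^ p * (\<Sum>i\<in>I. norm (a i) ^ p)"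
    using member_le_sum[of j I "\<lambda>i. norm (a i) ^ p"] assms j by (intro mult_left_mono) auto
  finally show ?thesis .
qed

lemma norm_add_power_le:
  fixes a b :: "'b::real_normed_vector"
  shows "norm (a + b) ^ p \<le> 2 ^ p * (norm a ^ p + norm b ^ p)"
proof -
  have "norm (a + b) ^ p \<le> (2 * max (norm a) (norm b)) ^ p"
    using norm_triangle_ineq[of a b] by (intro power_mono) auto
  also have "\<dots> \<le> 2 ^ p * (norm a ^ p + norm b ^ p)"
    by (auto simp: power_mult_distrib max_def)
  finally show ?thesis .
qed

lemma simple_function_C1c_approximation:
  fixes s :: "'a::euclidean_space \<Rightarrow> 'b::euclidean_space"
  assumes "simple_function lebesgue s" "\<And>x. x \<notin> U \<Longrightarrow> s x = 0" "p > 0" "e > (0::real)" "open U"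
    and fin: "(\<integral>\<^sup>+x. ennreal (norm (s x) ^ p) \<partial>lebesgue) < \<infinity>"
  shows "\<exists>g\<in>C1c U. (\<integral>\<^sup>+x. ennreal (norm (s x - g x) ^ p) \<partial>lebesgue) < ennreal e"
proof -
  define V where "V = range s - {0}"
  have V: "finite V" using simple_functionD(1)[OF assms(1)] by (simp add: V_def)
  define n where "n = card V"
  \<comment> \<open>the error allowed for the level set of \<open>v\<close>: the weight of this set in the estimate is \<open>n\<^sup>p |v|\<^sup>p\<close>, and there are \<open>n\<close> of them\<close>
  define E where "E v = e / (2 * (n + 1) * (real n ^ p * norm v ^ p + 1))" for v :: 'b
  have E0: "E v > 0" for v
  proof -
    have "real n ^ p * norm v ^ p + 1 > 0" by (rule add_nonneg_pos) auto
    then show ?thesis using assms(4) by (simp add: E_def)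
  qed
  let ?A = "\<lambda>v. s -` {v}"
  have A: "?A v \<in> sets lebesgue" for v
    using simple_functionD(2)[OF assms(1), of "{v}"] by simp
  have "emeasure lebesgue (?A v) < \<infinity>" if "v \<in> V" for v
  proof -
    have "ennreal (norm v ^ p) * emeasure lebesgue (?A v) = (\<integral>\<^sup>+x. ennreal (norm v ^ p) * indicator (?A v) x \<partial>lebesgue)"
      using A by (simp add: nn_integral_cmult_indicator)
    also have "\<dots> \<le> (\<integral>\<^sup>+x. ennreal (norm (s x) ^ p) \<partial>lebesgue)"
      by (intro nn_integral_mono) (auto simp: indicator_def)
    finally have "ennreal (norm v ^ p) * emeasure lebesgue (?A v) < \<infinity>" using fin by simp
    then show ?thesis
      using that by (auto simp: V_def ennreal_mult_less_top)
  qed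
  then have "\<forall>v\<in>V. \<exists>\<eta> :: 'a \<Rightarrow> real. \<eta> \<in> C1c U \<and> (\<forall>x. 0 \<le> \<eta> x \<and> \<eta> x \<le> 1) \<and>
    emeasure lebesgue {x. \<eta> x \<noteq> indicator (?A v) x} < ennreal (E v)"
    using assms(2,5) E0 A by (intro ballI indicator_C1c_approximation) (auto simp: V_def)
  then obtain \<eta> :: "'b \<Rightarrow> 'a \<Rightarrow> real" where \<eta>: "\<And>v. v \<in> V \<Longrightarrow> \<eta> v \<in> C1c U"
    "\<And>v x. v \<in> V \<Longrightarrow> 0 \<le> \<eta> v x \<and> \<eta> v x \<le> 1" 
    "\<And>v. v \<in> V \<Longrightarrow> emeasure lebesgue {x. \<eta> v x \<noteq> indicator (?A v) x} < ennreal (E v)"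
    by metis
  define g where "g x = (\<Sum>v\<in>V. \<eta> v x *\<^sub>R v)" for x
  have g: "g \<in> C1c U"
    unfolding g_def by (intro C1c_sum C1c_linear[OF bounded_linear_scaleR_left] \<eta>)
  let ?B = "\<lambda>v. {x. \<eta> v x \<noteq> indicator (?A v) x}"
  have B: "?B v \<in> sets lebesgue" if "v \<in> V" for v
  proof -
    have [measurable]: "\<eta> v \<in> borel_measurable lebesgue" by (rule C1c_borel_measurable_lebesgue[OF \<eta>(1)[OF that]])
    have [measurable]: "?A v \<in> sets lebesgue" by (rule A)
    have "{x \<in> space lebesgue. \<eta> v x \<noteq> indicator (?A v) x} \<in> sets lebesgue" by measurable
    then show ?thesis by simp
  qed
  have le: "norm (s x - g x) ^ p \<le> (\<Sum>v\<in>V. real n ^ p * norm v ^ p * indicator (?B v) x)" for x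
  proof -
    have s_eq: "s x = (\<Sum>v\<in>V. indicator (?A v) x *\<^sub>R v)"
    proof (cases "s x = 0")
      case True then show ?thesis by (auto simp: V_def indicator_def intro!: sum.neutral[symmetric])
    next
      case False
      then have "s x \<in> V" by (simp add: V_def)
      have "(\<Sum>v\<in>V. indicator (?A v) x *\<^sub>R v) = (\<Sum>v\<in>V. if v = s x then v else 0)"
        by (intro sum.cong) (auto simp: indicator_def)
      also have "\<dots> = s x" using V \<open>s x \<in> V\<close> by simp
      finally show ?thesis by simp
    qed
    have "(\<Sum>v\<in>V. (indicator (?A v) x - \<eta> v x) *\<^sub>R v) = (\<Sum>v\<in>V. indicator (?A v) x *\<^sub>R v) - g x"
      by (simp add: g_def sum_subtractf scaleR_diff_left)
    with s_eq have "s x - g x = (\<Sum>v\<in>V. (indicator (?A v) x - \<eta> v x) *\<^sub>R v)"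
      by (simp only:)
    then have "norm (s x - g x) ^ p \<le> real n ^ p * (\<Sum>v\<in>V. norm ((indicator (?A v) x - \<eta> v x) *\<^sub>R v) ^ p)"
      using norm_sum_power_le[OF V assms(3), of "\<lambda>v. (indicator (?A v) x - \<eta> v x) *\<^sub>R v"]
      by (simp only: n_def)
    also have "\<dots> \<le> real n ^ p * (\<Sum>v\<in>V. norm v ^ p * indicator (?B v) x)"
    proof (intro mult_left_mono sum_mono)
      fix v assume v: "v \<in> V"
      have "\<bar>indicator (?A v) x - \<eta> v x\<bar> \<le> 1" using \<eta>(2)[OF v, of x] by (auto simp: indicator_def)
      then have "\<bar>indicator (?A v) x - \<eta> v x\<bar> ^ p \<le> 1" by (intro power_le_one) auto
      then have *: "norm ((indicator (?A v) x - \<eta> v x) *\<^sub>R v) ^ p \<le> norm v ^ p"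
        by (simp add: power_mult_distrib mult_left_le_one_le)
      have **: "norm ((indicator (?A v) x - \<eta> v x) *\<^sub>R v) ^ p = 0" if "x \<notin> ?B v"
        using that assms(3) by simp
      show "norm ((indicator (?A v) x - \<eta> v x) *\<^sub>R v) ^ p \<le> norm v ^ p * indicator (?B v) x"
      proof (cases "x \<in> ?B v")
        case True
        then have "indicator (?B v) x = (1::real)" by (rule indicator_simps)
        then show ?thesis using * by (simp only: mult_1_right)
      next
        case False
        then have "norm ((indicator (?A v) x - \<eta> v x) *\<^sub>R v) ^ p = 0" by (rule **)
        then show ?thesis by (simp only:) simp
      qed
    qed simp
    finally show ?thesis by (simp add: sum_distrib_left mult.assoc)
  qed
  have "(\<integral>\<^sup>+x. ennreal (norm (s x - g x) ^ p) \<partial>lebesgue)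
      \<le> (\<integral>\<^sup>+x. (\<Sum>v\<in>V. ennreal (real n ^ p * norm v ^ p) * indicator (?B v) x) \<partial>lebesgue)"
  proof (rule nn_integral_mono)
    fix x
    have "ennreal (norm (s x - g x) ^ p) \<le> ennreal (\<Sum>v\<in>V. real n ^ p * norm v ^ p * indicator (?B v) x)"
      using le by (rule ennreal_leI)
    also have "\<dots> = (\<Sum>v\<in>V. ennreal (real n ^ p * norm v ^ p) * indicator (?B v) x)"
      by (subst sum_ennreal[symmetric]) (auto simp: ennreal_mult ennreal_indicator intro!: sum.cong)
    finally show "ennreal (norm (s x - g x) ^ p) \<le> (\<Sum>v\<in>V. ennreal (real n ^ p * norm v ^ p) * indicator (?B v) x)" .
  qed
  also have "\<dots> = (\<Sum>v\<in>V. ennreal (real n ^ p * norm v ^ p) * emeasure lebesgue (?B v))"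
  proof (subst nn_integral_sum)
    show "(\<lambda>x. ennreal (real n ^ p * norm v ^ p) * indicator (?B v) x) \<in> borel_measurable lebesgue" if "v \<in> V" for v
      using B[OF that] by (intro borel_measurable_times_ennreal borel_measurable_const borel_measurable_indicator)
    show "(\<Sum>v\<in>V. \<integral>\<^sup>+x. ennreal (real n ^ p * norm v ^ p) * indicator (?B v) x \<partial>lebesgue)
        = (\<Sum>v\<in>V. ennreal (real n ^ p * norm v ^ p) * emeasure lebesgue (?B v))"
      by (intro sum.cong refl nn_integral_cmult_indicator B)
  qed
  also have "\<dots> \<le> (\<Sum>v\<in>V. ennreal (e / (2 * (n + 1))))"
  proof (intro sum_mono)
    fix v assume v: "v \<in> V"
    have "ennreal (real n ^ p * norm v ^ p) * emeasure lebesgue (?B v) \<le> ennreal (real n ^ p * norm v ^ p) * ennreal (E v)"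
      using \<eta>(3)[OF v] by (intro mult_left_mono) auto
    also have "\<dots> = ennreal (real n ^ p * norm v ^ p * E v)"
      using E0[of v] by (simp add: ennreal_mult)
    also have "\<dots> \<le> ennreal (e / (2 * (n + 1)))"
    proof (rule ennreal_leI)
      define q where "q = real n ^ p * norm v ^ p"
      have q: "q \<ge> 0" by (simp add: q_def)
      have "q * E v = (e / (2 * (n + 1))) * (q / (q + 1))" by (simp add: E_def q_def)
      also have "\<dots> \<le> (e / (2 * (n + 1))) * 1"
        using q assms(4) by (intro mult_left_mono) auto
      finally show "real n ^ p * norm v ^ p * E v \<le> e / (2 * (n + 1))" by (simp add: q_def)
    qed
    finally show "ennreal (real n ^ p * norm v ^ p) * emeasure lebesgue (?B v) \<le> ennreal (e / (2 * (n + 1)))" .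
  qed
  also have "\<dots> = ennreal (n * (e / (2 * (n + 1))))"
    using assms(4) by (simp add: n_def ennreal_of_nat_eq_real_of_nat flip: ennreal_mult)
  also have "\<dots> < ennreal e"
    using assms(4) by (intro ennreal_lessI) (auto simp: field_simps intro: add_nonneg_pos)
  finally show ?thesis using g by blast
qed

text \<open>Simple functions approximate \<open>f\<close> pointwise with values bounded by \<open>2 |f|\<close>, hence in \<open>L\<^sup>p\<close>; they are finite
sums of indicators, which are handled by the previous lemmas. The exponents \<open>1\<close> (mollification) and
\<open>2\<close> (weak gradients, correctors) are used below.\<close>

theorem C1c_dense_Lp:
  fixes f :: "'a::euclidean_space \<Rightarrow> 'b::euclidean_space"
  assumes f: "f \<in> borel_measurable lebesgue" "\<And>x. x \<notin> U \<Longrightarrow> f x = 0" and "p > 0" "e > (0::real)" "open U"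
    and fin: "(\<integral>\<^sup>+x. ennreal (norm (f x) ^ p) \<partial>lebesgue) < \<infinity>"
  shows "\<exists>g\<in>C1c U. (\<integral>\<^sup>+x. ennreal (norm (f x - g x) ^ p) \<partial>lebesgue) < ennreal e"
proof -
  obtain s where s: "\<And>i. simple_function lebesgue (s i)" "\<And>x. (\<lambda>i. s i x) \<longlonglongrightarrow> f x"
    "\<And>i x. norm (s i x) \<le> 2 * norm (f x)"
    using borel_measurable_implies_sequence_metric[OF f(1), of 0] by auto
  have ms[measurable]: "s i \<in> borel_measurable lebesgue" for i
    using borel_measurable_simple_function[OF s(1)] .
  note f(1)[measurable]
  have fin3: "(\<integral>\<^sup>+x. ennreal ((c * norm (f x)) ^ p) \<partial>lebesgue) < \<infinity>" if "c \<ge> 0" for c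
  proof -
    have "(\<integral>\<^sup>+x. ennreal ((c * norm (f x)) ^ p) \<partial>lebesgue) = ennreal (c ^ p) * (\<integral>\<^sup>+x. ennreal (norm (f x) ^ p) \<partial>lebesgue)"
      using that by (subst nn_integral_cmult[symmetric]) (auto simp: ennreal_mult power_mult_distrib)
    then show ?thesis using fin by (simp add: ennreal_mult_less_top)
  qed
  have "(\<lambda>i. \<integral>\<^sup>+x. ennreal (norm (f x - s i x) ^ p) \<partial>lebesgue) \<longlonglongrightarrow> (\<integral>\<^sup>+x. ennreal 0 \<partial>(lebesgue :: 'a measure))"
  proof (rule nn_integral_dominated_convergence[where w="\<lambda>x. ennreal ((3 * norm (f x)) ^ p)"])
    show "AE x in lebesgue. ennreal (norm (f x - s i x) ^ p) \<le> ennreal ((3 * norm (f x)) ^ p)" for i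
    proof (rule AE_I2, rule ennreal_leI, rule power_mono)
      show "norm (f x - s i x) \<le> 3 * norm (f x)" for x
        using norm_triangle_ineq4[of "f x" "s i x"] s(3)[of i x] by linarith
    qed simp
    show "AE x in lebesgue. (\<lambda>i. ennreal (norm (f x - s i x) ^ p)) \<longlonglongrightarrow> ennreal 0"
    proof (rule AE_I2, rule tendsto_ennrealI)
      fix x
      have "(\<lambda>i. norm (f x - s i x) ^ p) \<longlonglongrightarrow> norm (f x - f x) ^ p"
        by (intro tendsto_intros s)
      moreover have "norm (f x - f x) ^ p = 0" using assms(3) by simp
      ultimately show "(\<lambda>i. norm (f x - s i x) ^ p) \<longlonglongrightarrow> 0" by (simp only:)
    qed
  qed (use fin3[of 3] in auto)
  then have "(\<lambda>i. \<integral>\<^sup>+x. ennreal (norm (f x - s i x) ^ p) \<partial>lebesgue) \<longlonglongrightarrow> 0" by simp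
  then have "\<forall>\<^sub>F i in sequentially. (\<integral>\<^sup>+x. ennreal (norm (f x - s i x) ^ p) \<partial>lebesgue) < ennreal (e / 2 ^ (p + 1))"
    using assms(4) by (intro order_tendstoD(2)) auto
  then obtain i where i: "(\<integral>\<^sup>+x. ennreal (norm (f x - s i x) ^ p) \<partial>lebesgue) < ennreal (e / 2 ^ (p + 1))"
    by (auto simp: eventually_sequentially)
  have "(\<integral>\<^sup>+x. ennreal (norm (s i x) ^ p) \<partial>lebesgue) \<le> (\<integral>\<^sup>+x. ennreal ((2 * norm (f x)) ^ p) \<partial>lebesgue)"
    by (intro nn_integral_mono ennreal_leI power_mono s(3)) auto
  also have "\<dots> < \<infinity>" by (rule fin3) simp
  finally have "\<exists>g\<in>C1c U. (\<integral>\<^sup>+x. ennreal (norm (s i x - g x) ^ p) \<partial>lebesgue) < ennreal (e / 2 ^ (p + 1))"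
  proof (intro simple_function_C1c_approximation s)
    show "s i x = 0" if "x \<notin> U" for x using s(3)[of i x] f(2)[OF that] by simp
  qed (use assms in auto)
  then obtain g where g: "g \<in> C1c U" "(\<integral>\<^sup>+x. ennreal (norm (s i x - g x) ^ p) \<partial>lebesgue) < ennreal (e / 2 ^ (p + 1))"
    by blast
  note [measurable] = C1c_borel_measurable_lebesgue[OF g(1)]
  have "(\<integral>\<^sup>+x. ennreal (norm (f x - g x) ^ p) \<partial>lebesgue) \<le>
     (\<integral>\<^sup>+x. ennreal (2 ^ p) * (ennreal (norm (f x - s i x) ^ p) + ennreal (norm (s i x - g x) ^ p)) \<partial>lebesgue)"
  proof (rule nn_integral_mono)
    fix x
    have "norm (f x - g x) ^ p \<le> 2 ^ p * (norm (f x - s i x) ^ p + norm (s i x - g x) ^ p)"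
      using norm_add_power_le[of "f x - s i x" "s i x - g x" p] by simp
    then show "ennreal (norm (f x - g x) ^ p) \<le> 
       ennreal (2 ^ p) * (ennreal (norm (f x - s i x) ^ p) + ennreal (norm (s i x - g x) ^ p))"
      by (simp flip: ennreal_plus ennreal_mult)
  qed
  also have "\<dots> = ennreal (2 ^ p) * ((\<integral>\<^sup>+x. ennreal (norm (f x - s i x) ^ p) \<partial>lebesgue) + (\<integral>\<^sup>+x. ennreal (norm (s i x - g x) ^ p) \<partial>lebesgue))"
    by (simp add: nn_integral_cmult nn_integral_add)
  also have "\<dots> < ennreal (2 ^ p) * (ennreal (e / 2 ^ (p + 1)) + ennreal (e / 2 ^ (p + 1)))"
    by (intro ennreal_mult_strict_left_mono add_strict_mono i g(2)) auto
  also have "\<dots> = ennreal e"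
    using assms(4) by (simp flip: ennreal_plus ennreal_mult)
  finally show ?thesis using g(1) by blast
qed

section \<open>Total variation of a composition\<close>

lemma lborel_distr_reflect: "distr lborel borel (\<lambda>x. t - x) = (lborel :: 'a::euclidean_space measure)"
  using lborel_affine[of "-1" t] by (simp add: density_1)

lemma lborel_integral_reflect:
  fixes f :: "'a::euclidean_space \<Rightarrow> real"
  assumes "f \<in> borel_measurable borel"
  shows "(LINT x|lborel. f (t - x)) = (LINT x|lborel. f x)"
  using integral_distr[of "\<lambda>x. t - x" lborel borel f] assms
  by (simp add: lborel_distr_reflect)

lemma lborel_integrable_reflect:
  fixes f :: "'a::euclidean_space \<Rightarrow> real"
  assumes "integrable lborel f"
  shows "integrable lborel (\<lambda>x. f (t - x))"
  using integrable_distr[of "\<lambda>x. t - x" lborel borel f] assms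
  by (simp add: lborel_distr_reflect)

text \<open>Clear for test functions, which are Lipschitz with compact support; the general case follows by
density, because translations preserve the \<open>L\<^sup>1\<close> distance.\<close>

lemma L1_translation_continuous:
  fixes F :: "'a::euclidean_space \<Rightarrow> real"
  assumes F: "integrable lborel F" and e: "e > (0::real)"
  shows "\<exists>d>0. \<forall>z. norm z < d \<longrightarrow> (\<integral>\<^sup>+x. ennreal \<bar>F (x - z) - F x\<bar> \<partial>lborel) \<le> ennreal e"
proof -
  have [measurable]: "F \<in> borel_measurable borel" using F by auto
  have "\<exists>g\<in>C1c UNIV. (\<integral>\<^sup>+x. ennreal (norm (F x - g x) ^ 1) \<partial>lebesgue) < ennreal (e/3)"
  proof (rule C1c_dense_Lp)
    show "F \<in> borel_measurable lebesgue" by (simp add: measurable_completion)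
    show "(\<integral>\<^sup>+x. ennreal (norm (F x) ^ 1) \<partial>lebesgue) < \<infinity>"
      using F by (simp add: nn_integral_completion integrable_iff_bounded)
  qed (use e in auto)
  then obtain g :: "'a \<Rightarrow> real" where g: "g \<in> C1c UNIV" "(\<integral>\<^sup>+x. ennreal \<bar>F x - g x\<bar> \<partial>lborel) < ennreal (e/3)"
    by (auto simp: nn_integral_completion)
  have [measurable]: "g \<in> borel_measurable borel"
    using C1_map_continuous[OF C1c_C1_map[OF g(1)]] by (rule borel_measurable_continuous_onI)
  obtain B where B: "B > 0" "\<And>x y. norm (g x - g y) \<le> B * norm (x - y)"
    using C1c_bounds[OF g(1)] by metis
  obtain K where K: "compact K" "\<And>x. x \<notin> K \<Longrightarrow> g x = 0"
    using C1cE[OF g(1)] by metis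
  obtain R where R: "\<forall>x\<in>K. norm x \<le> R"
    using compact_imp_bounded[OF K(1)] unfolding bounded_iff by blast
  define S where "S = cball (0::'a) (R + 1)"
  define v where "v = measure lborel S"
  have v: "v \<ge> 0" "emeasure lborel S = ennreal v"
    using emeasure_compact_finite[of S] by (auto simp: S_def v_def emeasure_eq_ennreal_measure)
  \<comment> \<open>the bound \<open>1\<close> keeps the supports of all translates of \<open>g\<close> inside \<open>S\<close>\<close>
  define d where "d = min 1 (e / (3 * (B * v + 1)))"
  have pos: "B * v + 1 > 0" using B v by (intro add_nonneg_pos) auto
  have d: "d > 0" using pos e by (simp add: d_def)
  have "(\<integral>\<^sup>+x. ennreal \<bar>F (x - z) - F x\<bar> \<partial>lborel) \<le> ennreal e" if z: "norm z < d" for z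
  proof -
    have "(\<integral>\<^sup>+x. ennreal \<bar>g (x - z) - g x\<bar> \<partial>lborel) \<le> (\<integral>\<^sup>+x. ennreal (B * norm z) * indicator S x \<partial>lborel)"
    proof (rule nn_integral_mono)
      fix x
      show "ennreal \<bar>g (x - z) - g x\<bar> \<le> ennreal (B * norm z) * indicator S x"
      proof (cases "x \<in> S")
        case True
        then show ?thesis using B(2)[of "x - z" x] by (simp add: ennreal_leI)
      next
        case False
        have "norm x > R + 1" using False by (simp add: S_def)
        moreover have "norm z < 1" using z by (simp add: d_def)
        moreover have "norm x \<le> norm (x - z) + norm z" using norm_triangle_sub[of x z] by (simp add: add.commute)
        ultimately have "norm (x - z) > R" "norm x > R" by linarith+
        then have "x - z \<notin> K" "x \<notin> K" using R by force+
        then show ?thesis using K(2) by simp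
      qed
    qed
    also have "\<dots> = ennreal (B * norm z * v)"
      using B v by (simp add: S_def nn_integral_cmult_indicator ennreal_mult)
    also have "\<dots> \<le> ennreal (e/3)"
    proof (rule ennreal_leI)
      have "B * norm z * v = (B * v) * norm z" by simp
      also have "\<dots> \<le> (B * v + 1) * (e / (3 * (B * v + 1)))"
        using z B v by (intro mult_mono) (auto simp: d_def)
      also have "\<dots> = e / 3"
      proof -
        have "q * (e / (3 * q)) = e / 3" if "q > 0" for q :: real using that by simp
        then show ?thesis using pos .
      qed
      finally show "B * norm z * v \<le> e / 3" .
    qed
    finally have 1: "(\<integral>\<^sup>+x. ennreal \<bar>g (x - z) - g x\<bar> \<partial>lborel) \<le> ennreal (e/3)" .
    have 2: "(\<integral>\<^sup>+x. ennreal \<bar>F (x - z) - g (x - z)\<bar> \<partial>lborel) = (\<integral>\<^sup>+x. ennreal \<bar>F x - g x\<bar> \<partial>lborel)"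
      using lborel_nn_integral_shift[of "\<lambda>x. ennreal \<bar>F x - g x\<bar>" "- z"] by simp
    have "(\<integral>\<^sup>+x. ennreal \<bar>F (x - z) - F x\<bar> \<partial>lborel)
       \<le> (\<integral>\<^sup>+x. ennreal \<bar>F (x - z) - g (x - z)\<bar> + ennreal \<bar>g (x - z) - g x\<bar> + ennreal \<bar>F x - g x\<bar> \<partial>lborel)"
      by (intro nn_integral_mono) (auto simp flip: ennreal_plus intro!: ennreal_leI)
    also have "\<dots> = (\<integral>\<^sup>+x. ennreal \<bar>F (x - z) - g (x - z)\<bar> \<partial>lborel) + (\<integral>\<^sup>+x. ennreal \<bar>g (x - z) - g x\<bar> \<partial>lborel)
        + (\<integral>\<^sup>+x. ennreal \<bar>F x - g x\<bar> \<partial>lborel)"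
      by (simp add: nn_integral_add)
    also have "\<dots> \<le> ennreal (e/3) + ennreal (e/3) + ennreal (e/3)"
      unfolding 2 using 1 g(2) by (intro add_mono) auto
    also have "\<dots> = ennreal e" using e by (simp flip: ennreal_plus)
    finally show ?thesis .
  qed
  then show ?thesis using d by blast
qed

lemma convolve_eq:
  fixes F :: "'a::euclidean_space \<Rightarrow> real"
  assumes "F \<in> borel_measurable borel" "\<rho> \<in> borel_measurable borel"
  shows "convolve F \<rho> x = (LINT z|lborel. F (x - z) * \<rho> z)"
proof -
  have [measurable]: "F \<in> borel_measurable borel" "\<rho> \<in> borel_measurable borel" using assms by auto
  show ?thesis unfolding convolve_def
    using lborel_integral_reflect[of "\<lambda>y. F y * \<rho> (x - y)" x] by simp
qed

text \<open>The convolution averages the translates \<open>F (x - z)\<close> with weight \<open>\<rho> z\<close>, so its distance to \<open>F\<close> is an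
average of the distances of the translates.\<close>

lemma convolve_L1_close:
  fixes F :: "'a::euclidean_space \<Rightarrow> real"
  assumes F: "integrable lborel F" and \<rho>: "mollifier d \<rho>"
    and close: "\<And>z. norm z < d \<Longrightarrow> (\<integral>\<^sup>+x. ennreal \<bar>F (x - z) - F x\<bar> \<partial>lborel) \<le> ennreal e"
  shows "(\<integral>\<^sup>+x. ennreal \<bar>convolve F \<rho> x - F x\<bar> \<partial>lborel) \<le> ennreal e"
proof -
  have [measurable]: "F \<in> borel_measurable borel" using F by auto
  have rc: "\<rho> \<in> C1c UNIV" using \<rho> by (simp add: mollifier_def)
  have [measurable]: "\<rho> \<in> borel_measurable borel"
    using C1_map_continuous[OF C1c_C1_map[OF rc]] by (rule borel_measurable_continuous_onI)
  have \<rho>0: "\<rho> x \<ge> 0" for x using \<rho> by (simp add: mollifier_def)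
  have ri: "integrable lborel \<rho>" by (rule C1c_integrable[OF rc])
  obtain B where B: "\<And>x. norm (\<rho> x) \<le> B" using C1c_bounds[OF rc] by metis
  have i1: "integrable lborel (\<lambda>z. F (x - z) * \<rho> z)" for x
    by (rule integrable_mult_bounded[OF lborel_integrable_reflect[OF F], of _ B]) (use B in auto)
  have "(\<integral>\<^sup>+x. ennreal \<bar>convolve F \<rho> x - F x\<bar> \<partial>lborel) \<le> (\<integral>\<^sup>+x. (\<integral>\<^sup>+z. ennreal (\<bar>F (x - z) - F x\<bar> * \<rho> z) \<partial>lborel) \<partial>lborel)"
  proof (rule nn_integral_mono)
    fix x
    have "convolve F \<rho> x - F x = (LINT z|lborel. F (x - z) * \<rho> z) - (LINT z|lborel. F x * \<rho> z)"
      using \<rho> by (simp add: convolve_eq mollifier_def)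
    also have "\<dots> = (LINT z|lborel. F (x - z) * \<rho> z - F x * \<rho> z)"
      using i1 ri by (subst Bochner_Integration.integral_diff) auto
    also have "\<dots> = (LINT z|lborel. (F (x - z) - F x) * \<rho> z)" by (simp add: algebra_simps)
    finally have "ennreal \<bar>convolve F \<rho> x - F x\<bar> = ennreal (norm (LINT z|lborel. (F (x - z) - F x) * \<rho> z))" by simp
    also have "\<dots> \<le> (\<integral>\<^sup>+z. ennreal (norm ((F (x - z) - F x) * \<rho> z)) \<partial>lborel)"
    proof (rule integral_norm_bound_ennreal)
      show "integrable lborel (\<lambda>z. (F (x - z) - F x) * \<rho> z)"
        using Bochner_Integration.integrable_diff[OF i1[of x] integrable_mult_right[OF ri, of "F x"]]
        by (simp add: algebra_simps)
    qed
    also have "\<dots> = (\<integral>\<^sup>+z. ennreal (\<bar>F (x - z) - F x\<bar> * \<rho> z) \<partial>lborel)"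
      by (simp add: abs_mult \<rho>0)
    finally show "ennreal \<bar>convolve F \<rho> x - F x\<bar> \<le> (\<integral>\<^sup>+z. ennreal (\<bar>F (x - z) - F x\<bar> * \<rho> z) \<partial>lborel)" .
  qed
  also have "\<dots> = (\<integral>\<^sup>+z. (\<integral>\<^sup>+x. ennreal (\<bar>F (x - z) - F x\<bar> * \<rho> z) \<partial>lborel) \<partial>lborel)"
    by (rule lborel_pair.Fubini') (simp add: split_beta')
  also have "\<dots> \<le> (\<integral>\<^sup>+z. ennreal (\<rho> z) * ennreal e \<partial>lborel)"
  proof (rule nn_integral_mono)
    fix z
    have "(\<integral>\<^sup>+x. ennreal (\<bar>F (x - z) - F x\<bar> * \<rho> z) \<partial>lborel) = ennreal (\<rho> z) * (\<integral>\<^sup>+x. ennreal \<bar>F (x - z) - F x\<bar> \<partial>lborel)"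
      by (subst nn_integral_cmult[symmetric]) (auto simp: ennreal_mult \<rho>0 mult.commute)
    also have "\<dots> \<le> ennreal (\<rho> z) * ennreal e"
    proof (cases "norm z < d")
      case True then show ?thesis by (intro mult_left_mono close) auto
    next
      case False
      then have "\<rho> z = 0" using \<rho> by (simp add: mollifier_def)
      then show ?thesis by simp
    qed
    finally show "(\<integral>\<^sup>+x. ennreal (\<bar>F (x - z) - F x\<bar> * \<rho> z) \<partial>lborel) \<le> ennreal (\<rho> z) * ennreal e" .
  qed
  also have "\<dots> = ennreal e"
    using \<rho> nn_integral_eq_integral[OF ri] \<rho>0 by (simp add: nn_integral_multc mollifier_def)
  finally show ?thesis .
qed

text \<open>By Fubini, testing \<open>F * \<rho>\<close> against \<open>g\<close> is averaging the tests of \<open>F\<close> against the translates of \<open>g\<close>.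
Thus an upper bound for the latter is an upper bound for the former; in the application \<open>g\<close> is the
divergence of a test field and the bound is the total variation of \<open>F\<close>.\<close>

lemma integral_convolve_mult:
  fixes F g :: "'a::euclidean_space \<Rightarrow> real"
  assumes F: "integrable lborel F" and \<rho>: "mollifier d \<rho>"
    and g: "g \<in> borel_measurable borel" "\<And>x. \<bar>g x\<bar> \<le> C"
    and bound: "\<And>z. norm z < d \<Longrightarrow> (LINT x|lborel. F x * g (x + z)) \<le> v"
  shows "(LINT x|lborel. convolve F \<rho> x * g x) \<le> v"
proof -
  have [measurable]: "F \<in> borel_measurable borel" using F by auto
  have rc: "\<rho> \<in> C1c UNIV" using \<rho> by (simp add: mollifier_def)
  have [measurable]: "\<rho> \<in> borel_measurable borel"
    using C1_map_continuous[OF C1c_C1_map[OF rc]] by (rule borel_measurable_continuous_onI)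
  have [measurable]: "g \<in> borel_measurable borel" by fact
  have \<rho>0: "\<rho> x \<ge> 0" for x using \<rho> by (simp add: mollifier_def)
  have ri: "integrable lborel \<rho>" by (rule C1c_integrable[OF rc])
  have C: "C \<ge> 0" using g(2) abs_ge_zero order_trans by blast
  define q where "q z x = F (x - z) * \<rho> z * g x" for z x
  have qi: "integrable (lborel \<Otimes>\<^sub>M lborel) (case_prod q)"
  proof (rule integrableI_bounded)
    show "case_prod q \<in> borel_measurable (lborel \<Otimes>\<^sub>M lborel)" unfolding q_def by measurable
    have "(\<integral>\<^sup>+p. ennreal (norm (case_prod q p)) \<partial>(lborel \<Otimes>\<^sub>M lborel)) = (\<integral>\<^sup>+z. (\<integral>\<^sup>+x. ennreal (norm (q z x)) \<partial>lborel) \<partial>lborel)"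
      unfolding q_def by (subst lborel.nn_integral_fst[symmetric]) (auto simp: split_beta')
    also have "\<dots> \<le> (\<integral>\<^sup>+z. ennreal (\<rho> z) * (ennreal C * (\<integral>\<^sup>+x. ennreal \<bar>F x\<bar> \<partial>lborel)) \<partial>lborel)"
    proof (rule nn_integral_mono)
      fix z
      have "(\<integral>\<^sup>+x. ennreal (norm (q z x)) \<partial>lborel) \<le> (\<integral>\<^sup>+x. ennreal (\<rho> z) * (ennreal C * ennreal \<bar>F (x - z)\<bar>) \<partial>lborel)"
      proof (rule nn_integral_mono)
        fix x
        have "norm (q z x) = \<rho> z * (\<bar>g x\<bar> * \<bar>F (x - z)\<bar>)" by (simp add: q_def abs_mult \<rho>0 ac_simps)
        also have "\<dots> \<le> \<rho> z * (C * \<bar>F (x - z)\<bar>)" using g(2) \<rho>0 by (intro mult_left_mono mult_right_mono) auto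
        finally show "ennreal (norm (q z x)) \<le> ennreal (\<rho> z) * (ennreal C * ennreal \<bar>F (x - z)\<bar>)"
          using C \<rho>0 by (simp flip: ennreal_mult add: ennreal_leI)
      qed
      also have "\<dots> = ennreal (\<rho> z) * (ennreal C * (\<integral>\<^sup>+x. ennreal \<bar>F (x - z)\<bar> \<partial>lborel))"
        by (simp add: nn_integral_cmult)
      also have "(\<integral>\<^sup>+x. ennreal \<bar>F (x - z)\<bar> \<partial>lborel) = (\<integral>\<^sup>+x. ennreal \<bar>F x\<bar> \<partial>lborel)"
        using lborel_nn_integral_shift[of "\<lambda>x. ennreal \<bar>F x\<bar>" "- z"] by simp
      finally show "(\<integral>\<^sup>+x. ennreal (norm (q z x)) \<partial>lborel) \<le> ennreal (\<rho> z) * (ennreal C * (\<integral>\<^sup>+x. ennreal \<bar>F x\<bar> \<partial>lborel))" .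
    qed
    also have "\<dots> = ennreal C * (\<integral>\<^sup>+x. ennreal \<bar>F x\<bar> \<partial>lborel)"
      using \<rho> nn_integral_eq_integral[OF ri] \<rho>0 by (simp add: nn_integral_multc mollifier_def)
    also have "\<dots> < \<infinity>" using F by (simp add: integrable_iff_bounded ennreal_mult_less_top)
    finally show "(\<integral>\<^sup>+p. ennreal (norm (case_prod q p)) \<partial>(lborel \<Otimes>\<^sub>M lborel)) < \<infinity>" .
  qed
  have "(LINT x|lborel. convolve F \<rho> x * g x) = (LINT x|lborel. LINT z|lborel. q z x)"
    by (simp add: convolve_eq q_def)
  also have "\<dots> = (LINT z|lborel. LINT x|lborel. q z x)"
    by (rule lborel_pair.Fubini_integral[OF qi])
  also have "\<dots> \<le> (LINT z|lborel. \<rho> z * v)"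
  proof (rule integral_mono)
    show "integrable lborel (\<lambda>z. LINT x|lborel. q z x)"
      by (rule lborel_pair.integrable_fst'[OF qi, simplified])
    show "integrable lborel (\<lambda>z. \<rho> z * v)" using ri by simp
    fix z
    have "(LINT x|lborel. q z x) = \<rho> z * (LINT x|lborel. F (x - z) * g x)"
      unfolding q_def by (subst integral_mult_right_zero[symmetric]) (simp add: ac_simps)
    also have "(LINT x|lborel. F (x - z) * g x) = (LINT x|lborel. F x * g (x + z))"
      using lborel_integral_shift[of "\<lambda>x. F x * g (x + z)" "- z"] by simp
    finally show "(LINT x|lborel. q z x) \<le> \<rho> z * v"
      using bound[of z] \<rho>0[of z] \<rho> by (cases "norm z < d") (auto simp: mollifier_def intro: mult_left_mono)
  qed
  also have "\<dots> = v" using \<rho> by (simp add: mollifier_def)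
  finally show ?thesis .
qed

lemma divergence_eq_0_outside:
  assumes "\<phi> \<in> C1c U"
  obtains K where "compact K" "K \<subseteq> U" "\<And>x. x \<notin> K \<Longrightarrow> \<phi> x = 0" "\<And>x. x \<notin> K \<Longrightarrow> divergence \<phi> x = 0"
proof -
  obtain K where K: "compact K" "K \<subseteq> U" "\<And>x. x \<notin> K \<Longrightarrow> \<phi> x = 0"
    "\<And>x v. x \<notin> K \<Longrightarrow> frechet_derivative \<phi> (at x) v = 0"
    using C1cE[OF assms] by blast
  from that[OF K(1-3)] show thesis using K(4) by (simp add: divergence_def)
qed

lemma continuous_on_divergence: "C1_map \<phi> \<Longrightarrow> continuous_on S (divergence \<phi>)"
  unfolding divergence_def by (intro continuous_intros)

lemma divergence_bound:
  assumes "\<phi> \<in> C1c U"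
  obtains C where "C > 0" "\<And>x. \<bar>divergence \<phi> x\<bar> \<le> C"
proof -
  obtain B where B: "B > 0" "\<And>x v. norm (frechet_derivative \<phi> (at x) v) \<le> B * norm v"
    using C1c_bounds[OF assms] by metis
  have "\<bar>divergence \<phi> x\<bar> \<le> (\<Sum>e\<in>(Basis::'a set). B)" for x
    unfolding divergence_def
  proof (rule order_trans[OF sum_abs], rule sum_mono)
    fix e :: 'a assume e: "e \<in> Basis"
    have "\<bar>frechet_derivative \<phi> (at x) e \<bullet> e\<bar> \<le> norm (frechet_derivative \<phi> (at x) e) * norm e"
      by (rule Cauchy_Schwarz_ineq2)
    also have "\<dots> \<le> B" using B(2)[of x e] e by simp
    finally show "\<bar>frechet_derivative \<phi> (at x) e \<bullet> e\<bar> \<le> B" .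
  qed
  with B(1) show ?thesis by (intro that[of "real DIM('a) * B"]) auto
qed

lemma integral_divergence_C1c:
  assumes "\<phi> \<in> C1c U"
  shows "(LINT x|lborel. divergence \<phi> x) = 0"
proof -
  have "(\<lambda>x. \<phi> x \<bullet> e) \<in> C1c U" for e
    by (rule C1c_linear[OF bounded_linear_inner_left assms])
  from integral_derivative_C1c[OF this]
  have 1: "(LINT x|lborel. frechet_derivative (\<lambda>x. \<phi> x \<bullet> e) (at x) v) = 0" for e v .
  have 2: "frechet_derivative (\<lambda>x. \<phi> x \<bullet> e) (at x) = (\<lambda>v. frechet_derivative \<phi> (at x) v \<bullet> e)" for e x
    by (rule frechet_derivative_at[symmetric])
       (rule has_derivative_inner_left[OF C1_map_has_derivative[OF C1c_C1_map[OF assms]]])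
  show ?thesis
    unfolding divergence_def
    by (subst Bochner_Integration.integral_sum)
       (use 1[unfolded 2] C1c_integrable_derivative[OF assms] in auto)
qed

lemma frechet_derivative_scaleR_C1:
  fixes h :: "'a::euclidean_space \<Rightarrow> real"
  assumes "C1_map h" "C1_map \<phi>"
  shows "frechet_derivative (\<lambda>x. h x *\<^sub>R \<phi> x) (at x) v =
    h x *\<^sub>R frechet_derivative \<phi> (at x) v + frechet_derivative h (at x) v *\<^sub>R \<phi> x"
  using frechet_derivative_at[OF has_derivative_scaleR[OF C1_map_has_derivative[OF assms(1)] C1_map_has_derivative[OF assms(2)]]]
  by metis

lemma divergence_scaleR:
  fixes h :: "'a::euclidean_space \<Rightarrow> real"
  assumes "C1_map h" "C1_map \<phi>"
  shows "divergence (\<lambda>x. h x *\<^sub>R \<phi> x) x = h x * divergence \<phi> x + frechet_derivative h (at x) (\<phi> x)"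
proof -
  let ?D = "frechet_derivative h (at x)"
  have lin: "linear ?D" using has_derivative_linear[OF C1_map_has_derivative[OF assms(1)]] .
  have "?D (\<phi> x) = ?D (\<Sum>e\<in>Basis. (\<phi> x \<bullet> e) *\<^sub>R e)" by (simp add: euclidean_representation)
  also have "\<dots> = (\<Sum>e\<in>Basis. (\<phi> x \<bullet> e) * ?D e)"
    by (simp add: linear_sum[OF lin] linear_scale[OF lin])
  finally have 1: "?D (\<phi> x) = (\<Sum>e\<in>Basis. (\<phi> x \<bullet> e) * ?D e)" .
  show ?thesis
    unfolding divergence_def frechet_derivative_scaleR_C1[OF assms] 1
    by (simp add: inner_add_left sum.distrib sum_distrib_left mult.commute)
qed

lemma integral_mult_divergence:
  fixes h :: "'a::euclidean_space \<Rightarrow> real"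
  assumes h: "C1_map h" and \<phi>: "\<phi> \<in> C1c U"
  shows "(LINT x|lborel. h x * divergence \<phi> x) = - (LINT x|lborel. frechet_derivative h (at x) (\<phi> x))"
    and "integrable lborel (\<lambda>x. h x * divergence \<phi> x)"
proof -
  note c = C1c_C1_map[OF \<phi>]
  obtain K where K: "compact K" "\<And>x. x \<notin> K \<Longrightarrow> \<phi> x = 0" "\<And>x. x \<notin> K \<Longrightarrow> divergence \<phi> x = 0"
    using divergence_eq_0_outside[OF \<phi>] by metis
  show 1: "integrable lborel (\<lambda>x. h x * divergence \<phi> x)"
    by (rule integrable_compact_support[OF K(1)])
       (auto simp: K intro!: continuous_intros continuous_on_divergence[OF c] C1_map_continuous[OF h])
  have h\<phi>: "(\<lambda>x. h x *\<^sub>R \<phi> x) \<in> C1c U" by (rule C1c_scaleR_C1_map[OF h \<phi>])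
  have 2: "integrable lborel (\<lambda>x. divergence (\<lambda>x. h x *\<^sub>R \<phi> x) x)"
    unfolding divergence_def using C1c_integrable_derivative[OF h\<phi>] by auto
  have "frechet_derivative h (at x) (\<phi> x) = divergence (\<lambda>x. h x *\<^sub>R \<phi> x) x - h x * divergence \<phi> x" for x
    by (simp add: divergence_scaleR[OF h c])
  then have "(LINT x|lborel. frechet_derivative h (at x) (\<phi> x)) =
    (LINT x|lborel. divergence (\<lambda>x. h x *\<^sub>R \<phi> x) x) - (LINT x|lborel. h x * divergence \<phi> x)"
    using 1 2 by simp
  then show "(LINT x|lborel. h x * divergence \<phi> x) = - (LINT x|lborel. frechet_derivative h (at x) (\<phi> x))"
    using integral_divergence_C1c[OF h\<phi>] by simp
qed

text \<open>Both sides are \<open>-\<integral> T' (h) \<nabla>h \<bullet> \<phi>\<close>. The identity turns a test of \<open>T (h)\<close> into a test of \<open>h\<close> with the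
field \<open>T' (h) \<phi>\<close>, which is no longer than \<open>\<phi>\<close> when \<open>|T'| \<le> 1\<close>. The second derivative of \<open>T\<close> is needed
to keep that field in \<open>C\<^sup>1\<close>.\<close>

lemma integral_chain_divergence:
  fixes h :: "'a::euclidean_space \<Rightarrow> real"
  assumes h: "C1_map h" and \<phi>: "\<phi> \<in> C1c U"
    and T: "\<And>t. (T has_real_derivative T' t) (at t)" "\<And>t. (T' has_real_derivative T'' t) (at t)" "continuous_on UNIV T''"
  shows "(LINT x|lborel. T (h x) * divergence \<phi> x) = (LINT x|lborel. h x * divergence (\<lambda>x. T' (h x) *\<^sub>R \<phi> x) x)"
proof -
  have cT': "continuous_on UNIV T'" using T(2) by (meson DERIV_continuous_on has_field_derivative_at_within)
  have h1: "C1_map (\<lambda>x. T (h x))" by (rule C1_map_compose_real[OF h T(1) cT'])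
  have h2: "C1_map (\<lambda>x. T' (h x))" by (rule C1_map_compose_real[OF h T(2,3)])
  have \<psi>: "(\<lambda>x. T' (h x) *\<^sub>R \<phi> x) \<in> C1c U" by (rule C1c_scaleR_C1_map[OF h2 \<phi>])
  have "((\<lambda>x. T (h x)) has_derivative (\<lambda>v. T' (h x) * frechet_derivative h (at x) v)) (at x)" for x
    using has_derivative_compose[OF C1_map_has_derivative[OF h]
        T(1)[of "h x", unfolded has_field_derivative_def]] by (simp add: o_def)
  from frechet_derivative_at[OF this, symmetric]
  have d: "frechet_derivative (\<lambda>x. T (h x)) (at x) v = T' (h x) * frechet_derivative h (at x) v" for x v
    by simp
  have lin: "linear (frechet_derivative h (at x))" for x
    using has_derivative_linear[OF C1_map_has_derivative[OF h]] .
  show ?thesis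
    unfolding integral_mult_divergence(1)[OF h1 \<phi>] integral_mult_divergence(1)[OF h \<psi>] d
    by (simp add: linear_scale[OF lin])
qed

lemma divergence_shift:
  assumes "C1_map \<phi>"
  shows "divergence (\<lambda>x. \<phi> (x + z)) x = divergence \<phi> (x + z)"
  unfolding divergence_def C1_map_shift(1)[OF assms] ..

lemma contraction_if_derivative_le_1:
  fixes T T' :: "real \<Rightarrow> real"
  assumes "\<And>t. (T has_real_derivative T' t) (at t)" "\<And>t. \<bar>T' t\<bar> \<le> 1"
  shows "\<bar>T a - T b\<bar> \<le> \<bar>a - b\<bar>"
proof -
  have "norm (T a - T b) \<le> 1 * norm (a - b)"
    by (rule field_differentiable_bound[of UNIV T T']) (use assms in auto)
  then show ?thesis by simp
qed

text \<open>For a smooth \<open>F\<close> this is the chain identity alone. In general \<open>F\<close> is mollified to \<open>h\<close>, the identity is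
applied to \<open>h\<close>, and the mollification is moved from \<open>h\<close> to translates of the new test field; these stay
supported in \<open>U\<close> when the scale is below the distance of the support of \<open>\<phi>\<close> to the complement of \<open>U\<close>.\<close>

lemma integral_compose_divergence_le:
  fixes F :: "'a::euclidean_space \<Rightarrow> real"
  assumes F: "integrable lborel F" and U: "open U" and \<phi>: "\<phi> \<in> C1c U" "\<And>x. norm (\<phi> x) \<le> 1"
    and T: "\<And>t. (T has_real_derivative T' t) (at t)" "\<And>t. (T' has_real_derivative T'' t) (at t)" "continuous_on UNIV T''"
      "\<And>t. \<bar>T' t\<bar> \<le> 1" "T 0 = 0"
    and v: "\<And>\<psi>. \<psi> \<in> C1c U \<Longrightarrow> (\<And>x. norm (\<psi> x) \<le> 1) \<Longrightarrow> (LINT x|lborel. F x * divergence \<psi> x) \<le> v"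
  shows "(LINT x|lborel. T (F x) * divergence \<phi> x) \<le> v"
proof (rule field_le_epsilon)
  fix e :: real assume e: "e > 0"
  note c = C1c_C1_map[OF \<phi>(1)]
  have [measurable]: "F \<in> borel_measurable borel" using F by auto
  have lipT: "\<bar>T a - T b\<bar> \<le> \<bar>a - b\<bar>" for a b
    by (rule contraction_if_derivative_le_1[OF T(1,4)])
  have cT: "continuous_on UNIV T" using T(1) by (meson DERIV_continuous_on has_field_derivative_at_within)
  have cT': "continuous_on UNIV T'" using T(2) by (meson DERIV_continuous_on has_field_derivative_at_within)
  have [measurable]: "T \<in> borel_measurable borel" using cT by (rule borel_measurable_continuous_onI)
  obtain C where C: "C > 0" "\<And>x. \<bar>divergence \<phi> x\<bar> \<le> C" using divergence_bound[OF \<phi>(1)] by metis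
  have [measurable]: "divergence \<phi> \<in> borel_measurable borel"
    using continuous_on_divergence[OF c] by (rule borel_measurable_continuous_onI)
  obtain K where K: "compact K" "K \<subseteq> U" "\<And>x. x \<notin> K \<Longrightarrow> \<phi> x = 0"
    using \<phi>(1) by (auto simp: C1c_iff)
  obtain d1 where d1: "d1 > 0" "\<And>x z :: 'a. x \<in> K \<Longrightarrow> norm z < d1 \<Longrightarrow> x - z \<in> U"
  proof (cases "K = {}")
    case True then show ?thesis using that[of 1] by simp
  next
    case False
    obtain r where r: "r > 0" "{x. infdist x K \<le> r} \<subseteq> U"
      using compact_in_open_separated[OF False K(1) U K(2)] .
    show ?thesis
    proof (rule that[OF r(1)])
      fix x z :: 'a assume "x \<in> K" "norm z < r"
      then have "infdist (x - z) K \<le> r" using infdist_le[of x K "x - z"] by (simp add: dist_norm)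
      then show "x - z \<in> U" using r(2) by blast
    qed
  qed
  obtain d2 where d2: "d2 > 0" "\<And>z. norm z < d2 \<Longrightarrow> (\<integral>\<^sup>+x. ennreal \<bar>F (x - z) - F x\<bar> \<partial>lborel) \<le> ennreal (e/C)"
    using L1_translation_continuous[OF F, of "e/C"] e C(1) by auto
  define d where "d = min d1 d2"
  obtain \<rho> :: "'a \<Rightarrow> real" where \<rho>: "mollifier d \<rho>" using mollifier_exists[of d] d1(1) d2(1) by (auto simp: d_def)
  define h where "h = convolve F \<rho>"
  have h: "C1_map h" unfolding h_def using \<rho> by (intro C1_map_convolve[OF F, of _ UNIV]) (simp add: mollifier_def)
  have [measurable]: "h \<in> borel_measurable borel" using C1_map_continuous[OF h] by (rule borel_measurable_continuous_onI)
  have close: "(\<integral>\<^sup>+x. ennreal \<bar>h x - F x\<bar> \<partial>lborel) \<le> ennreal (e/C)"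
    unfolding h_def by (rule convolve_L1_close[OF F \<rho>]) (auto simp: d_def intro: d2(2))
  have ih: "integrable lborel (\<lambda>x. h x - F x)"
    using close by (intro integrableI_bounded) (auto intro: le_less_trans)
  have ih': "(LINT x|lborel. \<bar>h x - F x\<bar>) \<le> e / C"
  proof -
    have "ennreal (LINT x|lborel. \<bar>h x - F x\<bar>) \<le> ennreal (e/C)"
      using close nn_integral_eq_integral[OF integrable_abs[OF ih]] by simp
    then show ?thesis using e C(1) by (simp add: ennreal_le_iff)
  qed
  define \<psi> where "\<psi> x = T' (h x) *\<^sub>R \<phi> x" for x
  have h2: "C1_map (\<lambda>x. T' (h x))" by (rule C1_map_compose_real[OF h T(2,3)])
  have \<psi>: "\<psi> \<in> C1c U" unfolding \<psi>_def by (rule C1c_scaleR_C1_map[OF h2 \<phi>(1)])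
  have \<psi>1: "norm (\<psi> x) \<le> 1" for x
    unfolding \<psi>_def using mult_mono[OF T(4)[of "h x"] \<phi>(2)[of x]] by simp
  obtain C' where C': "\<And>x. \<bar>divergence \<psi> x\<bar> \<le> C'" using divergence_bound[OF \<psi>] by metis
  have "(LINT x|lborel. h x * divergence \<psi> x) \<le> v"
    unfolding h_def
  proof (rule integral_convolve_mult[OF F \<rho> _ C'])
    show "divergence \<psi> \<in> borel_measurable borel"
      using continuous_on_divergence[OF C1c_C1_map[OF \<psi>]] by (rule borel_measurable_continuous_onI)
    fix z :: 'a assume z: "norm z < d"
    have "(\<lambda>x. \<psi> (x + z)) \<in> C1c U"
      unfolding C1c_iff
    proof (intro conjI exI[of _ "(\<lambda>x. x - z) ` K"] allI impI)
      show "C1_map (\<lambda>x. \<psi> (x + z))" by (rule C1_map_shift(2)[OF C1c_C1_map[OF \<psi>]])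
      show "compact ((\<lambda>x. x - z) ` K)" using K(1) by (intro compact_continuous_image continuous_intros)
      show "(\<lambda>x. x - z) ` K \<subseteq> U" using d1(2) z by (auto simp: d_def)
      fix x assume x: "x \<notin> (\<lambda>x. x - z) ` K"
      have "x + z \<notin> K"
      proof
        assume "x + z \<in> K"
        then have "(x + z) - z \<in> (\<lambda>x. x - z) ` K" by (rule imageI)
        with x show False by simp
      qed
      then show "\<psi> (x + z) = 0" using K(3) by (simp add: \<psi>_def)
    qed
    from v[OF this] \<psi>1 show "(LINT x|lborel. F x * divergence \<psi> (x + z)) \<le> v"
      by (simp add: divergence_shift[OF C1c_C1_map[OF \<psi>]])
  qed
  then have 1: "(LINT x|lborel. T (h x) * divergence \<phi> x) \<le> v"
    unfolding integral_chain_divergence[OF h \<phi>(1) T(1,2,3)] \<psi>_def .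
  have i1: "integrable lborel (\<lambda>x. T (h x) * divergence \<phi> x)"
    by (rule integral_mult_divergence(2)[OF C1_map_compose_real[OF h T(1) cT'] \<phi>(1)])
  have i2: "integrable lborel (\<lambda>x. T (F x) * divergence \<phi> x)"
  proof (rule integrable_mult_bounded[of _ _ _ C])
    show "integrable lborel (\<lambda>x. T (F x))"
    proof (rule Bochner_Integration.integrable_bound[OF F])
      show "AE x in lborel. norm (T (F x)) \<le> norm (F x)" using lipT[of "F _" 0] T(5) by auto
    qed simp
  qed (use C in auto)
  have "(LINT x|lborel. T (F x) * divergence \<phi> x) - (LINT x|lborel. T (h x) * divergence \<phi> x)
     = (LINT x|lborel. (T (F x) - T (h x)) * divergence \<phi> x)"
    using i1 i2 by (simp add: left_diff_distrib)
  also have "\<dots> \<le> (LINT x|lborel. C * \<bar>h x - F x\<bar>)"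
  proof (rule integral_mono)
    show "integrable lborel (\<lambda>x. (T (F x) - T (h x)) * divergence \<phi> x)"
      using Bochner_Integration.integrable_diff[OF i2 i1] by (simp add: left_diff_distrib)
    show "integrable lborel (\<lambda>x. C * \<bar>h x - F x\<bar>)" using ih by simp
    fix x
    have "(T (F x) - T (h x)) * divergence \<phi> x \<le> \<bar>T (F x) - T (h x)\<bar> * \<bar>divergence \<phi> x\<bar>"
      by (metis abs_ge_self abs_mult)
    also have "\<dots> \<le> \<bar>F x - h x\<bar> * C" using lipT C by (intro mult_mono) auto
    finally show "(T (F x) - T (h x)) * divergence \<phi> x \<le> C * \<bar>h x - F x\<bar>"
      by (simp add: mult.commute abs_minus_commute)
  qed
  also have "\<dots> = C * (LINT x|lborel. \<bar>h x - F x\<bar>)" by simp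
  also have "\<dots> \<le> C * (e / C)" using ih' C(1) by (intro mult_left_mono) auto
  also have "\<dots> = e" using C(1) by simp
  finally show "(LINT x|lborel. T (F x) * divergence \<phi> x) \<le> v + e" using 1 by simp
qed

text \<open>The remaining work is to replace \<open>f\<close>, which is only Lebesgue integrable on \<open>U\<close>, by a Borel
function on the whole space. The condition \<open>T 0 = 0\<close> makes composition with \<open>T\<close> commute with the
extension by zero.\<close>

theorem tv_scalar_compose_le:
  fixes f :: "'a::euclidean_space \<Rightarrow> real"
  assumes U: "open U"
    and T: "\<And>t. (T has_real_derivative T' t) (at t)" "\<And>t. (T' has_real_derivative T'' t) (at t)" "continuous_on UNIV T''"
      "\<And>t. \<bar>T' t\<bar> \<le> 1" "T 0 = 0"
  shows "tv_scalar U (\<lambda>x. T (f x)) \<le> tv_scalar U f"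
proof (cases "set_integrable lebesgue U f \<and> variation U f < \<infinity>")
  case False
  then have "tv_scalar U f = \<infinity>" by (auto simp: tv_scalar_def less_top[symmetric])
  then show ?thesis by simp
next
  case True
  define v where "v = enn2real (variation U f)"
  have v: "variation U f = ennreal v" "v \<ge> 0" using True by (auto simp: v_def)
  let ?F = "\<lambda>x. indicator U x *\<^sub>R f x"
  have iF: "integrable lebesgue ?F" using True by (simp add: set_integrable_def)
  then obtain F where F[measurable]: "F \<in> borel_measurable lborel" "AE x in lborel. ?F x = F x"
    using completion_ex_borel_measurable_real[of ?F lborel] by auto
  have AEF: "AE x in lebesgue. ?F x = F x" using F(2) by (rule AE_completion)
  have FL: "F \<in> borel_measurable lebesgue" by (rule measurable_completion[OF F(1)])
  have intF: "integrable lborel F"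
    using iF integrable_cong_AE[of ?F lebesgue F] AEF FL integrable_completion[OF F(1)] by auto
  have cT: "continuous_on UNIV T" using T(1) by (meson DERIV_continuous_on has_field_derivative_at_within)
  have [measurable]: "T \<in> borel_measurable borel" using cT by (rule borel_measurable_continuous_onI)
  have Ul: "U \<in> sets lebesgue" using U by (intro sets_completionI_sets) simp
  have TF: "T (?F x) = indicator U x *\<^sub>R T (f x)" for x using T(5) by (simp add: indicator_def)
  have mTF: "(\<lambda>x. T (?F x)) \<in> borel_measurable lebesgue"
    by (rule measurable_compose[OF borel_measurable_integrable[OF iF]]) simp
  have lipT: "\<bar>T a - T b\<bar> \<le> \<bar>a - b\<bar>" for a b
    by (rule contraction_if_derivative_le_1[OF T(1,4)])
  have "set_integrable lebesgue U (\<lambda>x. T (f x))"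
    unfolding set_integrable_def TF[symmetric]
  proof (rule Bochner_Integration.integrable_bound[OF iF mTF])
    show "AE x in lebesgue. norm (T (?F x)) \<le> norm (?F x)" using lipT[of "?F _" 0] T(5) by auto
  qed
  moreover have "variation U (\<lambda>x. T (f x)) \<le> variation U f"
    unfolding variation_def[of U "\<lambda>x. T (f x)"]
  proof (rule SUP_least)
    fix \<phi> :: "'a \<Rightarrow> 'a" assume "\<phi> \<in> {\<phi>. \<phi> \<in> C1c U \<and> (\<forall>x. norm (\<phi> x) \<le> 1)}"
    then have \<phi>: "\<phi> \<in> C1c U" "\<And>x. norm (\<phi> x) \<le> 1" by auto
    have transfer: "(LINT x:U|lebesgue. S (f x) * divergence \<psi> x) = (LINT x|lborel. S (F x) * divergence \<psi> x)"
      if \<psi>: "\<psi> \<in> C1c U" and S[measurable]: "S \<in> borel_measurable borel" and S0: "S (0::real) = (0::real)" 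
      for \<psi> :: "'a \<Rightarrow> 'a" and S :: "real \<Rightarrow> real"
    proof -
      have [measurable]: "divergence \<psi> \<in> borel_measurable borel"
        using continuous_on_divergence[OF C1c_C1_map[OF \<psi>]] by (rule borel_measurable_continuous_onI)
      have m: "(\<lambda>x. S (F x) * divergence \<psi> x) \<in> borel_measurable lborel" using F(1) by measurable
      have m2: "(\<lambda>x. S (?F x) * divergence \<psi> x) \<in> borel_measurable lebesgue"
      proof (rule borel_measurable_times)
        show "(\<lambda>x. S (?F x)) \<in> borel_measurable lebesgue"
          by (rule measurable_compose[OF borel_measurable_integrable[OF iF]]) simp
      qed (simp add: measurable_completion)
      have "(LINT x:U|lebesgue. S (f x) * divergence \<psi> x) = (LINT x|lebesgue. S (?F x) * divergence \<psi> x)"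
        unfolding set_lebesgue_integral_def using S0
        by (intro Bochner_Integration.integral_cong) (auto simp: indicator_def)
      also have "\<dots> = (LINT x|lebesgue. S (F x) * divergence \<psi> x)"
        using AEF by (intro integral_cong_AE m2 measurable_completion[OF m]) auto
      also have "\<dots> = (LINT x|lborel. S (F x) * divergence \<psi> x)"
        by (rule integral_completion[OF m])
      finally show ?thesis .
    qed
    have "(LINT x|lborel. T (F x) * divergence \<phi> x) \<le> v"
    proof (rule integral_compose_divergence_le[OF intF U \<phi> T])
      fix \<psi> :: "'a \<Rightarrow> 'a" assume \<psi>: "\<psi> \<in> C1c U" "\<And>x. norm (\<psi> x) \<le> 1"
      have "ennreal (LINT x:U|lebesgue. f x * divergence \<psi> x) \<le> variation U f"
        unfolding variation_def using \<psi> by (intro SUP_upper) auto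
      then have "(LINT x:U|lebesgue. f x * divergence \<psi> x) \<le> v"
        using v by (simp add: ennreal_le_iff)
      then show "(LINT x|lborel. F x * divergence \<psi> x) \<le> v"
        using transfer[OF \<psi>(1), of "\<lambda>t. t"] by simp
    qed
    then show "ennreal (LINT x:U|lebesgue. T (f x) * divergence \<phi> x) \<le> variation U f"
      using transfer[OF \<phi>(1), of T] T(5) v by (simp add: ennreal_leI)
  qed
  ultimately show ?thesis using True by (simp add: tv_scalar_def)
qed

text \<open>A field with values in the line of \<open>w\<close> sees only the combination \<open>\<Sum>i. w\<^sub>i \<phi>\<^sub>i\<close> of the rows of a test
matrix field, and this combination is no longer than the matrix field by Cauchy-Schwarz.\<close>

lemma tv_vector_scaleR_le:
  fixes f :: "'a::euclidean_space \<Rightarrow> real" and w :: "real^'n"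
  assumes c: "c > 0" and w: "norm w = 1"
  shows "tv_vector U (\<lambda>x. (c * f x) *\<^sub>R w) \<le> ennreal c * tv_scalar U f"
proof (cases "set_integrable lebesgue U f")
  case False
  then show ?thesis using c by (simp add: tv_scalar_def ennreal_mult_top)
next
  case True
  have "set_integrable lebesgue U (\<lambda>x. (c * f x) *\<^sub>R w)"
  proof -
    have "integrable lebesgue (\<lambda>x. (c * (indicator U x *\<^sub>R f x)) *\<^sub>R w)"
      using True unfolding set_integrable_def by (intro integrable_scaleR_left integrable_mult_right) auto
    then show ?thesis unfolding set_integrable_def by (simp add: ac_simps)
  qed
  moreover have "(SUP \<phi>\<in>{\<phi> :: 'a \<Rightarrow> 'a^'n. \<phi> \<in> C1c U \<and> (\<forall>x. norm (\<phi> x) \<le> 1)}.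
     ennreal (LINT x:U|lebesgue. \<Sum>i\<in>UNIV. ((c * f x) *\<^sub>R w) $ i * divergence (\<lambda>y. \<phi> y $ i) x)) \<le> ennreal c * variation U f"
  proof (rule SUP_least)
    fix \<phi> :: "'a \<Rightarrow> 'a^'n" assume "\<phi> \<in> {\<phi>. \<phi> \<in> C1c U \<and> (\<forall>x. norm (\<phi> x) \<le> 1)}"
    then have \<phi>: "\<phi> \<in> C1c U" "\<And>x. norm (\<phi> x) \<le> 1" by auto
    define \<psi> where "\<psi> x = (\<Sum>i\<in>UNIV. w $ i *\<^sub>R \<phi> x $ i)" for x
    have row: "(\<lambda>x. \<phi> x $ i) \<in> C1c U" for i by (rule C1c_linear[OF bounded_linear_vec_nth \<phi>(1)])
    have \<psi>: "\<psi> \<in> C1c U" unfolding \<psi>_def by (intro C1c_sum C1c_linear[OF bounded_linear_scaleR_right] row)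
    have \<psi>1: "norm (\<psi> x) \<le> 1" for x
    proof -
      have "norm (\<psi> x) \<le> (\<Sum>i\<in>UNIV. \<bar>w $ i\<bar> * \<bar>norm (\<phi> x $ i)\<bar>)"
        unfolding \<psi>_def by (intro order_trans[OF norm_sum]) simp
      also have "\<dots> \<le> L2_set (\<lambda>i. w $ i) UNIV * L2_set (\<lambda>i. norm (\<phi> x $ i)) UNIV"
        by (rule L2_set_mult_ineq)
      also have "\<dots> = norm w * norm (\<phi> x)" by (simp add: norm_vec_def L2_set_def)
      finally show ?thesis using w \<phi>(2)[of x] by simp
    qed
    have div: "divergence \<psi> x = (\<Sum>i\<in>UNIV. w $ i * divergence (\<lambda>y. \<phi> y $ i) x)" for x
    proof -
      have "(\<psi> has_derivative (\<lambda>v. \<Sum>i\<in>UNIV. w $ i *\<^sub>R frechet_derivative (\<lambda>y. \<phi> y $ i) (at x) v)) (at x)"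
        unfolding \<psi>_def
        by (intro has_derivative_sum has_derivative_scaleR_right C1_map_has_derivative C1c_C1_map[OF row])
      then have "frechet_derivative \<psi> (at x) = (\<lambda>v. \<Sum>i\<in>UNIV. w $ i *\<^sub>R frechet_derivative (\<lambda>y. \<phi> y $ i) (at x) v)"
        by (rule frechet_derivative_at[symmetric])
      then show ?thesis
        unfolding divergence_def
        by (simp add: inner_sum_left sum_distrib_left) (rule sum.swap)
    qed
    have "(LINT x:U|lebesgue. \<Sum>i\<in>UNIV. ((c * f x) *\<^sub>R w) $ i * divergence (\<lambda>y. \<phi> y $ i) x)
       = (LINT x:U|lebesgue. c * (f x * divergence \<psi> x))"
      by (simp add: div sum_distrib_left ac_simps)
    also have "\<dots> = c * (LINT x:U|lebesgue. f x * divergence \<psi> x)" by simp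
    finally have "ennreal (LINT x:U|lebesgue. \<Sum>i\<in>UNIV. ((c * f x) *\<^sub>R w) $ i * divergence (\<lambda>y. \<phi> y $ i) x)
       = ennreal c * ennreal (LINT x:U|lebesgue. f x * divergence \<psi> x)"
      using c by (simp add: ennreal_mult')
    also have "\<dots> \<le> ennreal c * variation U f"
      unfolding variation_def using \<psi> \<psi>1 by (intro mult_left_mono SUP_upper) auto
    finally show "ennreal (LINT x:U|lebesgue. \<Sum>i\<in>UNIV. ((c * f x) *\<^sub>R w) $ i * divergence (\<lambda>y. \<phi> y $ i) x)
       \<le> ennreal c * variation U f" .
  qed
  ultimately show ?thesis using True by (simp add: tv_scalar_def tv_vector_def)
qed

section \<open>Weak gradients and traces\<close>

lemma open_sets_lebesgue [intro]: "open S \<Longrightarrow> S \<in> sets (lebesgue :: 'a::euclidean_space measure)"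
  by (intro sets_completionI_sets) simp

lemma set_integral_eq_lborel_integral:
  fixes f :: "'a::euclidean_space \<Rightarrow> real"
  assumes "f \<in> borel_measurable borel" "\<And>x. x \<notin> S \<Longrightarrow> f x = 0"
  shows "(LINT x:S|lebesgue. f x) = (LINT x|lborel. f x)"
proof -
  have "(LINT x:S|lebesgue. f x) = (LINT x|lebesgue. f x)"
    unfolding set_lebesgue_integral_def using assms(2)
    by (intro Bochner_Integration.integral_cong) (auto simp: indicator_def)
  also have "\<dots> = (LINT x|lborel. f x)"
    using assms(1) by (intro integral_completion) simp
  finally show ?thesis .
qed

lemma L2_on_iff:
  assumes "S \<in> sets lebesgue"
  shows "L2_on S f \<longleftrightarrow> f \<in> borel_measurable (lebesgue_on S) \<and>
    (\<integral>\<^sup>+x\<in>S. ennreal ((norm (f x))\<^sup>2) \<partial>lebesgue) < \<infinity>"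
proof -
  have "(\<integral>\<^sup>+x. ennreal (norm ((norm (f x))\<^sup>2)) \<partial>lebesgue_on S) = (\<integral>\<^sup>+x\<in>S. ennreal ((norm (f x))\<^sup>2) \<partial>lebesgue)"
    using assms by (subst nn_integral_restrict_space) auto
  then show ?thesis
    unfolding L2_on_def integrable_iff_bounded
    by (auto intro: borel_measurable_power borel_measurable_norm)
qed

lemma L2_on_add:
  assumes "L2_on S f" "L2_on S g"
  shows "L2_on S (\<lambda>x. f x + g x)"
  unfolding L2_on_def
proof
  have [measurable]: "f \<in> borel_measurable (lebesgue_on S)" "g \<in> borel_measurable (lebesgue_on S)"
    using assms by (auto simp: L2_on_def)
  show "(\<lambda>x. f x + g x) \<in> borel_measurable (lebesgue_on S)" by measurable
  show "integrable (lebesgue_on S) (\<lambda>x. (norm (f x + g x))\<^sup>2)"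
  proof (rule Bochner_Integration.integrable_bound)
    show "integrable (lebesgue_on S) (\<lambda>x. 2 ^ 2 * ((norm (f x))\<^sup>2 + (norm (g x))\<^sup>2))"
      using assms by (auto simp: L2_on_def)
    show "AE x in lebesgue_on S. norm ((norm (f x + g x))\<^sup>2) \<le> norm (2 ^ 2 * ((norm (f x))\<^sup>2 + (norm (g x))\<^sup>2))"
      using norm_add_power_le[of "f _" "g _" 2] by (intro AE_I2) simp
  qed measurable
qed

lemma L2_on_bound:
  assumes "L2_on S f" "g \<in> borel_measurable (lebesgue_on S)" "AE x in lebesgue_on S. norm (g x) \<le> norm (f x)"
  shows "L2_on S g"
  unfolding L2_on_def
proof
  show "integrable (lebesgue_on S) (\<lambda>x. (norm (g x))\<^sup>2)"
  proof (rule Bochner_Integration.integrable_bound)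
    show "integrable (lebesgue_on S) (\<lambda>x. (norm (f x))\<^sup>2)" using assms by (simp add: L2_on_def)
    show "AE x in lebesgue_on S. norm ((norm (g x))\<^sup>2) \<le> norm ((norm (f x))\<^sup>2)"
      using assms(3) by eventually_elim (simp add: power_mono)
  qed (use assms in measurable)
qed fact

lemma L2_on_bounded_linear:
  fixes L :: "'b::euclidean_space \<Rightarrow> 'c::euclidean_space"
  assumes "L2_on S f" "bounded_linear L"
  shows "L2_on S (\<lambda>x. L (f x))"
proof -
  obtain B where B: "B > 0" "\<And>x. norm (L x) \<le> norm x * B"
    using bounded_linear.pos_bounded[OF assms(2)] by blast
  have f: "f \<in> borel_measurable (lebesgue_on S)" using assms(1) by (simp add: L2_on_def)
  have 1: "L2_on S (\<lambda>x. B *\<^sub>R f x)"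
    using assms(1) by (auto simp: L2_on_def power_mult_distrib)
  show ?thesis
  proof (rule L2_on_bound[OF 1])
    show "(\<lambda>x. L (f x)) \<in> borel_measurable (lebesgue_on S)"
      by (rule measurable_compose[OF f borel_measurable_continuous_onI[OF linear_continuous_on[OF assms(2)]]])
    show "AE x in lebesgue_on S. norm (L (f x)) \<le> norm (B *\<^sub>R f x)"
      using B by (intro AE_I2) (simp add: mult.commute)
  qed
qed

lemma L2_on_component: "L2_on S f \<Longrightarrow> L2_on S (\<lambda>x. f x $ i)"
  for f :: "real^3 \<Rightarrow> 'b::euclidean_space^'n"
  by (rule L2_on_bounded_linear[OF _ bounded_linear_vec_nth])

lemma L2_on_diff: "L2_on S f \<Longrightarrow> L2_on S g \<Longrightarrow> L2_on S (\<lambda>x. f x - g x)"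
  using L2_on_add[of S f "\<lambda>x. - g x"] by (simp add: L2_on_def)

lemma L2_on_compact_support:
  fixes f :: "real^3 \<Rightarrow> 'b::euclidean_space"
  assumes "continuous_on UNIV f" "compact K" "\<And>x. x \<notin> K \<Longrightarrow> f x = 0" "S \<in> sets lebesgue"
  shows "L2_on S f"
  unfolding L2_on_def
proof
  show "f \<in> borel_measurable (lebesgue_on S)"
    using borel_measurable_continuous_onI[OF assms(1)] 
    by (intro measurable_restrict_space1) (simp add: measurable_completion)
  have "integrable lborel (\<lambda>x. (norm (f x))\<^sup>2)"
    by (rule integrable_compact_support[OF assms(2)]) (use assms in \<open>auto intro!: continuous_intros\<close>)
  then have "integrable lebesgue (\<lambda>x. (norm (f x))\<^sup>2)" by (subst integrable_completion) auto
  from integrable_mult_indicator[OF assms(4) this]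
  show "integrable (lebesgue_on S) (\<lambda>x. (norm (f x))\<^sup>2)"
    by (subst integrable_restrict_space) (simp_all add: assms(4))
qed

lemma L2_on_mult_integrable:
  fixes f g :: "real^3 \<Rightarrow> real"
  assumes "L2_on S f" "L2_on S g" "S \<in> sets lebesgue"
  shows "set_integrable lebesgue S (\<lambda>x. f x * g x)"
proof -
  have m: "f \<in> borel_measurable (lebesgue_on S)" "g \<in> borel_measurable (lebesgue_on S)"
    using assms by (auto simp: L2_on_def)
  have "integrable (lebesgue_on S) (\<lambda>x. f x * g x)"
  proof (rule Bochner_Integration.integrable_bound)
    show "integrable (lebesgue_on S) (\<lambda>x. (norm (f x))\<^sup>2 + (norm (g x))\<^sup>2)"
      using assms by (auto simp: L2_on_def)
    show "AE x in lebesgue_on S. norm (f x * g x) \<le> norm ((norm (f x))\<^sup>2 + (norm (g x))\<^sup>2)"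
    proof (rule AE_I2)
      fix x
      have "2 * (\<bar>f x\<bar> * \<bar>g x\<bar>) \<le> \<bar>f x\<bar>\<^sup>2 + \<bar>g x\<bar>\<^sup>2" using sum_squares_bound[of "\<bar>f x\<bar>" "\<bar>g x\<bar>"] by simp
      moreover have "0 \<le> \<bar>f x\<bar> * \<bar>g x\<bar>" by simp
      ultimately have "\<bar>f x\<bar> * \<bar>g x\<bar> \<le> \<bar>f x\<bar>\<^sup>2 + \<bar>g x\<bar>\<^sup>2" by linarith
      then show "norm (f x * g x) \<le> norm ((norm (f x))\<^sup>2 + (norm (g x))\<^sup>2)" by (simp add: abs_mult)
    qed
  qed (use m in measurable)
  then show ?thesis
    using assms(3) by (simp add: integrable_restrict_space set_integrable_def)
qed

lemma
  fixes \<phi> :: "real^3 \<Rightarrow> 'b::euclidean_space"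
  assumes "\<phi> \<in> C1c U" "S \<in> sets lebesgue"
  shows C1c_L2_on: "L2_on S \<phi>"
    and C1c_derivative_L2_on: "L2_on S (\<lambda>x. frechet_derivative \<phi> (at x) v)"
proof -
  obtain K where K: "compact K" "\<And>x. x \<notin> K \<Longrightarrow> \<phi> x = 0"
    "\<And>x v. x \<notin> K \<Longrightarrow> frechet_derivative \<phi> (at x) v = 0" 
    using C1cE[OF assms(1)] by metis
  show "L2_on S \<phi>" "L2_on S (\<lambda>x. frechet_derivative \<phi> (at x) v)"
    using K C1_map_continuous[OF C1c_C1_map[OF assms(1)]] C1_map_continuous_derivative[OF C1c_C1_map[OF assms(1)]]
    by (auto intro!: L2_on_compact_support[OF _ K(1) _ assms(2)])
qed

text \<open>If \<open>g\<close> is a test function close to \<open>f\<close>, then \<open>f\<close> is orthogonal to \<open>g\<close> and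
\<open>\<integral> f\<^sup>2 \<le> \<integral> (f - g)\<^sup>2\<close>, which is arbitrarily small.\<close>

lemma L2_on_eq_0I:
  fixes f :: "real^3 \<Rightarrow> real"
  assumes f: "L2_on S f" and S: "open S" and orth: "\<And>\<phi>. \<phi> \<in> C1c S \<Longrightarrow> (LINT x:S|lebesgue. f x * \<phi> x) = 0"
  shows "AE x in lebesgue_on S. f x = 0"
proof -
  have Sl: "S \<in> sets lebesgue" using S by auto
  have m: "f \<in> borel_measurable (lebesgue_on S)" using f by (simp add: L2_on_def)
  let ?F = "\<lambda>x. indicator S x *\<^sub>R f x"
  have mF: "?F \<in> borel_measurable lebesgue"
    using m Sl by (simp add: borel_measurable_restrict_space_iff)
  have eqF: "(\<integral>\<^sup>+x. ennreal (norm (?F x) ^ 2) \<partial>lebesgue) = (\<integral>\<^sup>+x\<in>S. ennreal ((norm (f x))\<^sup>2) \<partial>lebesgue)"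
    by (intro nn_integral_cong) (auto simp: indicator_def)
  have fin: "(\<integral>\<^sup>+x. ennreal (norm (?F x) ^ 2) \<partial>lebesgue) < \<infinity>"
    unfolding eqF using f Sl by (simp add: L2_on_iff)
  have iF: "integrable lebesgue (\<lambda>x. (?F x)\<^sup>2)"
  proof (rule integrableI_bounded)
    show "(\<lambda>x. (?F x)\<^sup>2) \<in> borel_measurable lebesgue" using mF by (rule borel_measurable_power)
  qed (use fin in simp)
  have small: "(LINT x|lebesgue. (?F x)\<^sup>2) \<le> e" if e: "e > 0" for e :: real
  proof -
    obtain g where g: "g \<in> C1c S" "(\<integral>\<^sup>+x. ennreal (norm (?F x - g x) ^ 2) \<partial>lebesgue) < ennreal e"
      using C1c_dense_Lp[OF mF _ _ e S fin] by auto
    have mg: "g \<in> borel_measurable lebesgue" by (rule C1c_borel_measurable_lebesgue[OF g(1)])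
    have id: "integrable lebesgue (\<lambda>x. (?F x - g x)\<^sup>2)"
    proof (rule integrableI_bounded)
      show "(\<lambda>x. (?F x - g x)\<^sup>2) \<in> borel_measurable lebesgue" using mF mg by measurable
    qed (use g(2) in \<open>auto intro: less_trans\<close>)
    have "ennreal (LINT x|lebesgue. (?F x - g x)\<^sup>2) < ennreal e"
      using g(2) nn_integral_eq_integral[OF id] by simp
    then have le: "(LINT x|lebesgue. (?F x - g x)\<^sup>2) \<le> e" using e by (simp add: ennreal_less_iff)
    have ip: "integrable lebesgue (\<lambda>x. ?F x * g x)" and zero: "(LINT x|lebesgue. ?F x * g x) = 0"
      using L2_on_mult_integrable[OF f C1c_L2_on[OF g(1) Sl] Sl] orth[OF g(1)]
      by (simp_all add: set_integrable_def set_lebesgue_integral_def mult.assoc)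
    have "(LINT x|lebesgue. (?F x)\<^sup>2) \<le> (LINT x|lebesgue. (?F x - g x)\<^sup>2 + 2 * (?F x * g x))"
    proof (rule integral_mono[OF iF])
      show "integrable lebesgue (\<lambda>x. (?F x - g x)\<^sup>2 + 2 * (?F x * g x))" using id ip by simp
      show "(?F x)\<^sup>2 \<le> (?F x - g x)\<^sup>2 + 2 * (?F x * g x)" for x
        by (simp add: power2_eq_square algebra_simps)
    qed
    also have "\<dots> = (LINT x|lebesgue. (?F x - g x)\<^sup>2)" using id ip zero by simp
    finally show ?thesis using le by simp
  qed
  have "(LINT x|lebesgue. (?F x)\<^sup>2) \<le> 0" by (rule field_le_epsilon) (use small in auto)
  moreover have "(LINT x|lebesgue. (?F x)\<^sup>2) \<ge> 0" by (rule integral_nonneg_AE) auto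
  ultimately have "(LINT x|lebesgue. (?F x)\<^sup>2) = 0" by (rule antisym)
  moreover have "(LINT x|lebesgue. (?F x)\<^sup>2) = 0 \<longleftrightarrow> (AE x in lebesgue. (?F x)\<^sup>2 = 0)"
    by (rule integral_nonneg_eq_0_iff_AE[OF iF]) simp
  ultimately have "AE x in lebesgue. (?F x)\<^sup>2 = 0" by (simp only:)
  then have "AE x in lebesgue. x \<in> S \<longrightarrow> f x = 0" by eventually_elim auto
  then show ?thesis using Sl by (simp add: AE_restrict_space_iff)
qed

lemma weak_gradient_unique:
  assumes S: "open S" and G: "has_weak_gradient S u G" and H: "has_weak_gradient S u H"
  shows "AE x in lebesgue_on S. G x = H x"
proof -
  have Sl: "S \<in> sets lebesgue" using S by auto
  have L2: "L2_on S G" "L2_on S H" using G H by (auto simp: has_weak_gradient_def)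
  have "AE x in lebesgue_on S. G x $ i $ j - H x $ i $ j = 0" for i j
  proof (rule L2_on_eq_0I[OF _ S])
    show "L2_on S (\<lambda>x. G x $ i $ j - H x $ i $ j)" by (intro L2_on_diff L2_on_component L2)
    fix \<phi> :: "real^3 \<Rightarrow> real" assume \<phi>: "\<phi> \<in> C1c S"
    have "set_integrable lebesgue S (\<lambda>x. G x $ i $ j * \<phi> x)" "set_integrable lebesgue S (\<lambda>x. H x $ i $ j * \<phi> x)"
      by (intro L2_on_mult_integrable L2_on_component L2 C1c_L2_on[OF \<phi> Sl] Sl)+
    moreover have "(LINT x:S|lebesgue. G x $ i $ j * \<phi> x) = (LINT x:S|lebesgue. H x $ i $ j * \<phi> x)"
    proof -
      have "- (LINT x:S|lebesgue. G x $ i $ j * \<phi> x) = (LINT x:S|lebesgue. u x $ i * frechet_derivative \<phi> (at x) (axis j 1))"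
        using G \<phi> by (simp add: has_weak_gradient_def)
      also have "\<dots> = - (LINT x:S|lebesgue. H x $ i $ j * \<phi> x)"
        using H \<phi> by (simp add: has_weak_gradient_def)
      finally show ?thesis by simp
    qed
    ultimately show "(LINT x:S|lebesgue. (G x $ i $ j - H x $ i $ j) * \<phi> x) = 0"
      by (simp add: left_diff_distrib)
  qed
  then have "AE x in lebesgue_on S. \<forall>i\<in>UNIV. \<forall>j\<in>UNIV. G x $ i $ j - H x $ i $ j = 0"
    by (intro AE_finite_allI) auto
  then show ?thesis by eventually_elim (simp add: vec_eq_iff)
qed

lemma has_weak_gradient_add:
  assumes S: "open S" and G: "has_weak_gradient S u G" and H: "has_weak_gradient S w H"
  shows "has_weak_gradient S (\<lambda>x. u x + w x) (\<lambda>x. G x + H x)"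
  unfolding has_weak_gradient_def
proof (intro conjI allI impI)
  have Sl: "S \<in> sets lebesgue" using S by auto
  have L2: "L2_on S G" "L2_on S H" "L2_on S u" "L2_on S w" using G H by (auto simp: has_weak_gradient_def)
  show "L2_on S (\<lambda>x. u x + w x)" "L2_on S (\<lambda>x. G x + H x)" by (intro L2_on_add L2)+
  fix \<phi> :: "real^3 \<Rightarrow> real" and i j assume \<phi>: "\<phi> \<in> C1c S"
  let ?d = "\<lambda>x. frechet_derivative \<phi> (at x) (axis j 1)"
  have i: "set_integrable lebesgue S (\<lambda>x. G x $ i $ j * \<phi> x)" "set_integrable lebesgue S (\<lambda>x. H x $ i $ j * \<phi> x)"
    "set_integrable lebesgue S (\<lambda>x. u x $ i * ?d x)" "set_integrable lebesgue S (\<lambda>x. w x $ i * ?d x)"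
    by (intro L2_on_mult_integrable L2_on_component L2 C1c_L2_on[OF \<phi> Sl] C1c_derivative_L2_on[OF \<phi> Sl] Sl)+
  have "(LINT x:S|lebesgue. (u x + w x) $ i * ?d x) = (LINT x:S|lebesgue. u x $ i * ?d x) + (LINT x:S|lebesgue. w x $ i * ?d x)"
    using i by (simp add: distrib_right)
  also have "\<dots> = - (LINT x:S|lebesgue. G x $ i $ j * \<phi> x) + - (LINT x:S|lebesgue. H x $ i $ j * \<phi> x)"
    using G H \<phi> by (simp add: has_weak_gradient_def)
  also have "\<dots> = - (LINT x:S|lebesgue. (G x + H x) $ i $ j * \<phi> x)"
    using i by (simp add: distrib_right)
  finally show "(LINT x:S|lebesgue. (u x + w x) $ i * ?d x) = - (LINT x:S|lebesgue. (G x + H x) $ i $ j * \<phi> x)" .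
qed

definition jacobian_matrix :: "(real^3 \<Rightarrow> real^3) \<Rightarrow> real^3 \<Rightarrow> real^3^3" where
  "jacobian_matrix w x = (\<chi> i j. frechet_derivative w (at x) (axis j 1) $ i)"

lemma continuous_on_jacobian_matrix:
  "C1_map w \<Longrightarrow> continuous_on A (jacobian_matrix w)"
  unfolding jacobian_matrix_def
  by (intro continuous_on_vec_lambda continuous_on_component C1_map_continuous_derivative)

lemma C1c_has_weak_gradient:
  assumes S: "open S" and w: "w \<in> C1c S"
  shows "has_weak_gradient S w (jacobian_matrix w)"
  unfolding has_weak_gradient_def
proof (intro conjI allI impI)
  have Sl: "S \<in> sets lebesgue" using S by auto
  note c = C1c_C1_map[OF w]
  show "L2_on S w" by (rule C1c_L2_on[OF w Sl])
  obtain K where K: "compact K" "K \<subseteq> S" "\<And>x. x \<notin> K \<Longrightarrow> w x = 0"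
    "\<And>x v. x \<notin> K \<Longrightarrow> frechet_derivative w (at x) v = 0" 
    using C1cE[OF w] by metis
  show "L2_on S (jacobian_matrix w)"
    by (rule L2_on_compact_support[OF continuous_on_jacobian_matrix[OF c] K(1) _ Sl])
       (auto simp: jacobian_matrix_def K(4) vec_eq_iff)
  fix \<phi> :: "real^3 \<Rightarrow> real" and i j assume \<phi>: "\<phi> \<in> C1c S"
  let ?e = "axis j 1 :: real^3"
  let ?d = "\<lambda>x. frechet_derivative \<phi> (at x) ?e" and ?D = "\<lambda>x. frechet_derivative w (at x) ?e $ i"
  note c\<phi> = C1c_C1_map[OF \<phi>]
  have wi: "(\<lambda>x. w x $ i) \<in> C1c S" by (rule C1c_linear[OF bounded_linear_vec_nth w])
  have Dwi: "frechet_derivative (\<lambda>x. w x $ i) (at x) v = frechet_derivative w (at x) v $ i" for x v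
    by (simp flip: frechet_derivative_at[OF bounded_linear.has_derivative[OF bounded_linear_vec_nth C1_map_has_derivative[OF c]]])
  have prod: "(\<lambda>x. w x $ i *\<^sub>R \<phi> x) \<in> C1c S"
    by (rule C1c_scaleR_C1_map[OF C1c_C1_map[OF wi] \<phi>])
  have cont: "continuous_on UNIV (\<lambda>x. w x $ i)" "continuous_on UNIV \<phi>" "continuous_on UNIV ?d" "continuous_on UNIV ?D"
    by (intro continuous_on_component C1_map_continuous[OF c] C1_map_continuous[OF c\<phi>]
      C1_map_continuous_derivative[OF c] C1_map_continuous_derivative[OF c\<phi>])+
  have i1: "integrable lborel (\<lambda>x. w x $ i * ?d x)" "integrable lborel (\<lambda>x. ?D x * \<phi> x)"
    by (rule integrable_compact_support[OF K(1)], auto intro!: continuous_on_mult cont simp: K)+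
  have "0 = (LINT x|lborel. frechet_derivative (\<lambda>x. w x $ i *\<^sub>R \<phi> x) (at x) ?e)"
    by (rule integral_derivative_C1c[OF prod, symmetric])
  also have "\<dots> = (LINT x|lborel. w x $ i * ?d x + ?D x * \<phi> x)"
    unfolding frechet_derivative_scaleR_C1[OF C1c_C1_map[OF wi] c\<phi>] Dwi by simp
  also have "\<dots> = (LINT x|lborel. w x $ i * ?d x) + (LINT x|lborel. ?D x * \<phi> x)"
    using i1 by simp
  finally have "(LINT x|lborel. w x $ i * ?d x) = - (LINT x|lborel. ?D x * \<phi> x)" by simp
  moreover have out: "w x = 0" "?D x = 0" if "x \<notin> S" for x
  proof -
    have "x \<notin> K" using K(2) that by (rule contra_subsetD)
    then show "w x = 0" "?D x = 0" by (simp_all add: K(3,4))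
  qed
  moreover have "(LINT x:S|lebesgue. w x $ i * ?d x) = (LINT x|lborel. w x $ i * ?d x)"
    using out by (intro set_integral_eq_lborel_integral borel_measurable_continuous_onI continuous_on_mult cont) auto
  moreover have "(LINT x:S|lebesgue. ?D x * \<phi> x) = (LINT x|lborel. ?D x * \<phi> x)"
    using out by (intro set_integral_eq_lborel_integral borel_measurable_continuous_onI continuous_on_mult cont) auto
  ultimately show "(LINT x:S|lebesgue. w x $ i * ?d x) = - (LINT x:S|lebesgue. jacobian_matrix w x $ i $ j * \<phi> x)"
    by (simp add: jacobian_matrix_def)
qed

lemma weak_grad_works: "u \<in> H1 S \<Longrightarrow> has_weak_gradient S u (weak_grad S u)"
  unfolding H1_def weak_grad_def using someI_ex[of "has_weak_gradient S u"] by simp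

lemma
  assumes S: "open S" and u: "u \<in> H1 S" and w: "w \<in> C1c S"
  shows H1_add_C1c: "(\<lambda>x. u x + w x) \<in> H1 S"
    and weak_grad_add_C1c: "AE x in lebesgue_on S. weak_grad S (\<lambda>x. u x + w x) x = weak_grad S u x + jacobian_matrix w x"
proof -
  have *: "has_weak_gradient S (\<lambda>x. u x + w x) (\<lambda>x. weak_grad S u x + jacobian_matrix w x)"
    by (rule has_weak_gradient_add[OF S weak_grad_works[OF u] C1c_has_weak_gradient[OF S w]])
  then show 1: "(\<lambda>x. u x + w x) \<in> H1 S" by (auto simp: H1_def)
  show "AE x in lebesgue_on S. weak_grad S (\<lambda>x. u x + w x) x = weak_grad S u x + jacobian_matrix w x"
    by (rule weak_gradient_unique[OF S weak_grad_works[OF 1] *])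
qed

text \<open>Adding \<open>w\<close> to every member of the approximating sequence changes neither the \<open>H1\<close> distances nor, since
\<open>w\<close> vanishes near the boundary, the boundary values.\<close>

lemma has_trace_add_C1c:
  assumes S: "open S" and tr: "has_trace S u h" and w: "w \<in> C1c S"
  shows "has_trace S (\<lambda>x. u x + w x) h"
proof -
  have Sl: "S \<in> sets lebesgue" using S by auto
  obtain v where u: "u \<in> H1 S" and h: "h \<in> borel_measurable (hausdorff_measure 2)"
    and v: "\<And>k. v k \<in> H1 S" "\<And>k. continuous_on (closure S) (v k)"
    and lim1: "(\<lambda>k. \<integral>\<^sup>+x\<in>S. ennreal ((norm (v k x - u x))\<^sup>2 +
                  (norm (weak_grad S (v k) x - weak_grad S u x))\<^sup>2) \<partial>lebesgue) \<longlonglongrightarrow> 0"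
    and lim2: "\<And>R. R > 0 \<Longrightarrow> (\<lambda>k. \<integral>\<^sup>+x\<in>frontier S \<inter> cball 0 R. ennreal ((norm (v k x - h x))\<^sup>2)
                  \<partial>hausdorff_measure 2) \<longlonglongrightarrow> 0"
    using tr unfolding has_trace_def by blast
  define v' where "v' k x = v k x + w x" for k x
  have w0: "w x = 0" if "x \<in> frontier S" for x
    using w that S by (auto simp: C1c_iff frontier_def interior_open)
  have eq1: "(\<integral>\<^sup>+x\<in>S. ennreal ((norm (v' k x - (u x + w x)))\<^sup>2 +
        (norm (weak_grad S (v' k) x - weak_grad S (\<lambda>x. u x + w x) x))\<^sup>2) \<partial>lebesgue)
      = (\<integral>\<^sup>+x\<in>S. ennreal ((norm (v k x - u x))\<^sup>2 +
                  (norm (weak_grad S (v k) x - weak_grad S u x))\<^sup>2) \<partial>lebesgue)" for k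
  proof (rule nn_integral_cong_AE)
    have "AE x in lebesgue_on S. weak_grad S (v' k) x - weak_grad S (\<lambda>x. u x + w x) x = weak_grad S (v k) x - weak_grad S u x"
      using weak_grad_add_C1c[OF S u w] weak_grad_add_C1c[OF S v(1)[of k] w] unfolding v'_def
      by eventually_elim simp
    then have "AE x in lebesgue. x \<in> S \<longrightarrow> weak_grad S (v' k) x - weak_grad S (\<lambda>x. u x + w x) x = weak_grad S (v k) x - weak_grad S u x"
      using Sl by (simp add: AE_restrict_space_iff)
    then show "AE x in lebesgue. ennreal ((norm (v' k x - (u x + w x)))\<^sup>2 +
        (norm (weak_grad S (v' k) x - weak_grad S (\<lambda>x. u x + w x) x))\<^sup>2) * indicator S x =
       ennreal ((norm (v k x - u x))\<^sup>2 + (norm (weak_grad S (v k) x - weak_grad S u x))\<^sup>2) * indicator S x"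
      by eventually_elim (auto simp: v'_def indicator_def)
  qed
  have eq2: "(\<integral>\<^sup>+x\<in>frontier S \<inter> cball 0 R. ennreal ((norm (v' k x - h x))\<^sup>2) \<partial>hausdorff_measure 2)
     = (\<integral>\<^sup>+x\<in>frontier S \<inter> cball 0 R. ennreal ((norm (v k x - h x))\<^sup>2) \<partial>hausdorff_measure 2)" for k R
    by (intro nn_integral_cong) (auto simp: v'_def w0 indicator_def)
  show ?thesis
    unfolding has_trace_def
  proof (intro conjI exI[of _ v'] allI impI)
    show "(\<lambda>x. u x + w x) \<in> H1 S" by (rule H1_add_C1c[OF S u w])
    show "v' k \<in> H1 S" for k unfolding v'_def by (rule H1_add_C1c[OF S v(1) w])
    show "continuous_on (closure S) (v' k)" for k
      unfolding v'_def by (intro continuous_on_add v(2) C1_map_continuous C1c_C1_map[OF w])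
    show "(\<lambda>k. \<integral>\<^sup>+x\<in>S. ennreal ((norm (v' k x - (u x + w x)))\<^sup>2 +
        (norm (weak_grad S (v' k) x - weak_grad S (\<lambda>x. u x + w x) x))\<^sup>2) \<partial>lebesgue) \<longlonglongrightarrow> 0"
      unfolding eq1 by (rule lim1)
    show "(\<lambda>k. \<integral>\<^sup>+x\<in>frontier S \<inter> cball 0 R. ennreal ((norm (v' k x - h x))\<^sup>2) \<partial>hausdorff_measure 2) \<longlonglongrightarrow> 0"
      if "R > 0" for R
      unfolding eq2 by (rule lim2[OF that])
  qed (rule h)
qed

lemma dirichlet_on_add_C1c:
  "open S \<Longrightarrow> dirichlet_on S \<Gamma> g u \<Longrightarrow> w \<in> C1c S \<Longrightarrow> dirichlet_on S \<Gamma> g (\<lambda>x. u x + w x)"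
  unfolding dirichlet_on_def using has_trace_add_C1c by blast

section \<open>Slices and slip coefficients\<close>

lemma borel_measurable_lebesgue_on_AE:
  fixes f g :: "'a::euclidean_space \<Rightarrow> 'b::euclidean_space"
  assumes S: "S \<in> sets lebesgue" and f: "f \<in> borel_measurable (lebesgue_on S)"
    and ae: "AE x in lebesgue_on S. f x = g x"
  shows "g \<in> borel_measurable (lebesgue_on S)"
proof -
  have "(\<lambda>x. indicator S x *\<^sub>R f x) \<in> borel_measurable lebesgue"
    using f S by (simp add: borel_measurable_restrict_space_iff)
  moreover have "AE x in lebesgue. indicator S x *\<^sub>R f x = indicator S x *\<^sub>R g x"
    using ae S by (simp add: AE_restrict_space_iff) (auto elim!: eventually_mono simp: indicator_def)
  ultimately have "(\<lambda>x. indicator S x *\<^sub>R g x) \<in> borel_measurable lebesgue"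
    by (rule borel_measurable_AE)
  then show ?thesis using S by (simp add: borel_measurable_restrict_space_iff)
qed

lemma frame_orthogonal:
  assumes "norm n = 1"
  shows "orthogonal_matrix (frame n)" "frame n *v axis 1 1 = n"
proof -
  have "\<exists>Q. orthogonal_matrix Q \<and> Q *v axis 1 1 = n"
    using orthogonal_matrix_exists_basis[OF assms, of 1] by metis
  then have "orthogonal_matrix (frame n) \<and> frame n *v axis 1 1 = n"
    unfolding frame_def by (rule someI_ex)
  then show "orthogonal_matrix (frame n)" "frame n *v axis 1 1 = n" by auto
qed

lemma slice_point_inner:
  assumes "norm n = 1"
  shows "slice_point n t y \<bullet> n = t"
proof -
  have "orthogonal_transformation ((*v) (frame n))"
    using frame_orthogonal(1)[OF assms] by (simp add: orthogonal_transformation_matrix)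
  then have "(frame n *v a) \<bullet> (frame n *v c) = a \<bullet> c" for a c
    by (simp add: orthogonal_transformation_def)
  then have "slice_point n t y \<bullet> n = vector [t, y$1, y$2] \<bullet> (axis 1 1 :: real^3)"
    unfolding slice_point_def using frame_orthogonal(2)[OF assms] by metis
  then show ?thesis by (simp add: inner_axis)
qed

lemma open_slice:
  assumes "open S"
  shows "open (slice S n t)"
proof -
  have "continuous_on UNIV (\<lambda>y. vector [t, y$1, y$2] :: real^3)"
    unfolding continuous_on_componentwise[where f="\<lambda>y. vector [t, y$1, y$2] :: real^3"] 
    by (auto simp: Basis_vec_def inner_axis forall_3 intro!: continuous_intros)
  then have "continuous_on UNIV (\<lambda>y. slice_point n t y)"
    unfolding slice_point_def by (intro matrix_vector_mult_linear_continuous_on[THEN continuous_on_compose2]) auto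
  then show ?thesis
    unfolding slice_def using assms open_vimage[of S "slice_point n t"] by (simp add: vimage_def)
qed

text \<open>The coefficient of \<open>p\<close> of a vector in the plane of the unit vectors \<open>p\<close> and \<open>q\<close>: the inner product
with the first element of the basis dual to \<open>(p, q)\<close>.\<close>

definition dual_coeff :: "real^3 \<Rightarrow> real^3 \<Rightarrow> real^3 \<Rightarrow> real" where
  "dual_coeff p q v = (v \<bullet> p - (p \<bullet> q) * (v \<bullet> q)) / (1 - (p \<bullet> q)\<^sup>2)"

text \<open>The denominator is the squared length of the component of \<open>p\<close> orthogonal to \<open>q\<close>.\<close>

lemma dual_coeff_denominator_pos:
  assumes "norm p = 1" "norm q = 1" "p \<noteq> q" "independent {p, q}"
  shows "1 - (p \<bullet> q)\<^sup>2 > 0"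
proof -
  have pp: "p \<bullet> p = 1" "q \<bullet> q = 1" using assms by (simp_all add: dot_square_norm)
  have "(norm (p - (p \<bullet> q) *\<^sub>R q))\<^sup>2 = 1 - (p \<bullet> q)\<^sup>2"
    unfolding power2_norm_eq_inner by (simp add: inner_diff pp power2_eq_square inner_commute)
  moreover have "p - (p \<bullet> q) *\<^sub>R q \<noteq> 0"
  proof
    assume "p - (p \<bullet> q) *\<^sub>R q = 0"
    then have "p = (p \<bullet> q) *\<^sub>R q" by simp
    then have "p \<in> span ({p, q} - {p})"
      using assms(3) by (metis span_base span_mul insert_Diff_if insertI1 singletonD singletonI)
    then show False using assms(4) unfolding dependent_def by blast
  qed
  ultimately show ?thesis by (metis zero_less_norm_iff zero_less_power)
qed

lemma dual_coeff_combination: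
  assumes "norm p = 1" "norm q = 1" "p \<noteq> q" "independent {p, q}"
  shows "dual_coeff p q (a *\<^sub>R p + c *\<^sub>R q) = a"
proof -
  have pp: "p \<bullet> p = 1" "q \<bullet> q = 1" using assms by (simp_all add: dot_square_norm)
  have nz: "1 - (p \<bullet> q)\<^sup>2 \<noteq> 0" using dual_coeff_denominator_pos[OF assms] by simp
  have "(a *\<^sub>R p + c *\<^sub>R q) \<bullet> p - (p \<bullet> q) * ((a *\<^sub>R p + c *\<^sub>R q) \<bullet> q) = a * (1 - (p \<bullet> q)\<^sup>2)"
    by (simp add: inner_add_left pp inner_commute[of q p] power2_eq_square algebra_simps)
  then show ?thesis using nz by (simp add: dual_coeff_def)
qed

text \<open>The plane orthogonal to \<open>n\<close> has dimension two, so it is spanned by \<open>p\<close> and \<open>q\<close>.\<close>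

lemma dual_coeff_expansion:
  assumes pq: "norm p = 1" "norm q = 1" "p \<noteq> q" "independent {p, q}"
    and n: "norm n = 1" "p \<bullet> n = 0" "q \<bullet> n = 0" and v: "v \<bullet> n = 0"
  shows "v = dual_coeff p q v *\<^sub>R p + dual_coeff q p v *\<^sub>R q"
proof -
  have "{x. n \<bullet> x = 0} \<subseteq> span {p, q}"
  proof (rule card_ge_dim_independent)
    show "{p, q} \<subseteq> {x. n \<bullet> x = 0}" using n by (simp add: inner_commute)
    have "n \<noteq> 0" using n(1) by auto
    then show "dim {x. n \<bullet> x = 0} \<le> card {p, q}" using pq(3) by (simp add: dim_hyperplane)
  qed fact
  then have "v \<in> span {p, q}" using v by (auto simp: inner_commute)
  then obtain a c where ac: "v = a *\<^sub>R p + c *\<^sub>R q"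
    by (auto simp: span_insert span_singleton algebra_simps)
  have "dual_coeff p q v = a" unfolding ac by (rule dual_coeff_combination[OF pq])
  moreover have "dual_coeff q p v = c"
    unfolding ac using dual_coeff_combination[of q p c a] pq by (simp add: add.commute insert_commute)
  ultimately show ?thesis using ac by simp
qed

lemma borel_measurable_dual_coeff [measurable]: "dual_coeff p q \<in> borel_measurable borel"
  unfolding dual_coeff_def by measurable

lemma dual_coeff_bound:
  assumes "norm p = 1" "norm q = 1" "p \<noteq> q" "independent {p, q}"
  shows "\<bar>dual_coeff p q v\<bar> \<le> 2 / (1 - (p \<bullet> q)\<^sup>2) * norm v"
proof -
  have "\<bar>v \<bullet> p\<bar> \<le> norm v" "\<bar>v \<bullet> q\<bar> \<le> norm v" "\<bar>p \<bullet> q\<bar> \<le> 1"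
    using Cauchy_Schwarz_ineq2[of v p] Cauchy_Schwarz_ineq2[of v q] Cauchy_Schwarz_ineq2[of p q] assms by auto
  moreover have "\<bar>(p \<bullet> q) * (v \<bullet> q)\<bar> \<le> 1 * norm v"
    unfolding abs_mult using calculation by (intro mult_mono) auto
  ultimately have "\<bar>v \<bullet> p - (p \<bullet> q) * (v \<bullet> q)\<bar> \<le> 2 * norm v" by linarith
  then show ?thesis
    using dual_coeff_denominator_pos[OF assms] by (simp add: dual_coeff_def divide_right_mono)
qed

lemma slip_systemsD:
  assumes "slip_systems M nv b" "j \<in> {1..M}"
  shows "norm (nv j) = 1" "norm (b 1 j) = 1" "norm (b 2 j) = 1" "b 1 j \<bullet> nv j = 0" "b 2 j \<bullet> nv j = 0"
    "b 1 j \<noteq> b 2 j" "independent {b 1 j, b 2 j}" "independent {b 2 j, b 1 j}"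
  using assms by (auto simp: slip_systems_def insert_commute)

text \<open>Equal normals would be parallel. Hence the index of the slip system at a point is determined by \<open>m\<close>.\<close>

lemma slip_normals_inj:
  assumes "slip_systems M nv b" "i \<in> {1..M}" "j \<in> {1..M}" "nv i = nv j"
  shows "i = j"
proof (rule ccontr)
  assume "i \<noteq> j"
  then have "nv i \<noteq> 1 *\<^sub>R nv j" using assms unfolding slip_systems_def by blast
  then show False using assms by simp
qed

lemma slip_coeffs_eq:
  assumes S: "slip_systems M nv b" and j: "j \<in> {1..M}" "m x = nv j" "s x \<bullet> nv j = 0"
  shows "slip_coeffs M nv b s m x = (dual_coeff (b 1 j) (b 2 j) (s x), dual_coeff (b 2 j) (b 1 j) (s x))"
  unfolding slip_coeffs_def
proof (rule the_equality)
  note D = slip_systemsD[OF S j(1)]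
  show "\<exists>i\<in>{1..M}. m x = nv i \<and> s x = fst (dual_coeff (b 1 j) (b 2 j) (s x), dual_coeff (b 2 j) (b 1 j) (s x)) *\<^sub>R b 1 i
      + snd (dual_coeff (b 1 j) (b 2 j) (s x), dual_coeff (b 2 j) (b 1 j) (s x)) *\<^sub>R b 2 i"
    using dual_coeff_expansion[OF D(2,3,6,7,1,4,5) j(3)] j by (intro bexI[of _ j]) auto
  fix c assume "\<exists>i\<in>{1..M}. m x = nv i \<and> s x = fst c *\<^sub>R b 1 i + snd c *\<^sub>R b 2 i"
  then obtain i where i: "i \<in> {1..M}" "m x = nv i" "s x = fst c *\<^sub>R b 1 i + snd c *\<^sub>R b 2 i" by blast
  have "i = j" using slip_normals_inj[OF S i(1) j(1)] i j by simp
  then have sx: "s x = fst c *\<^sub>R b 1 j + snd c *\<^sub>R b 2 j" using i by simp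
  have "dual_coeff (b 1 j) (b 2 j) (s x) = fst c"
    unfolding sx by (rule dual_coeff_combination[OF D(2,3,6,7)])
  moreover have "dual_coeff (b 2 j) (b 1 j) (s x) = snd c"
    unfolding sx using dual_coeff_combination[OF D(3,2) D(6)[symmetric] D(8), of "snd c" "fst c"] by (simp add: add.commute)
  ultimately show "c = (dual_coeff (b 1 j) (b 2 j) (s x), dual_coeff (b 2 j) (b 1 j) (s x))" by (simp add: prod_eq_iff)
qed

lemma slip_coeff_properties:
  assumes S: "slip_systems M nv b" and j: "j \<in> {1..M}" "m x = nv j" "s x \<bullet> nv j = 0"
  shows "slip_coeff M nv b s m 1 x = dual_coeff (b 1 j) (b 2 j) (s x)"
    and "slip_coeff M nv b s m 2 x = dual_coeff (b 2 j) (b 1 j) (s x)"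
    and "s x = slip_coeff M nv b s m 1 x *\<^sub>R b 1 j + slip_coeff M nv b s m 2 x *\<^sub>R b 2 j"
proof -
  note D = slip_systemsD[OF S j(1)]
  show 1: "slip_coeff M nv b s m 1 x = dual_coeff (b 1 j) (b 2 j) (s x)"
    and 2: "slip_coeff M nv b s m 2 x = dual_coeff (b 2 j) (b 1 j) (s x)"
    by (simp_all add: slip_coeff_def slip_coeffs_eq[where s=s and m=m and x=x, OF S j])
  show "s x = slip_coeff M nv b s m 1 x *\<^sub>R b 1 j + slip_coeff M nv b s m 2 x *\<^sub>R b 2 j"
    unfolding 1 2 by (rule dual_coeff_expansion[OF D(2,3,6,7,1,4,5) j(3)])
qed

lemma slip_coeff_bound:
  assumes S: "slip_systems M nv b"
  obtains C where "C > 0"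
    "\<And>s m x i j. j \<in> {1..M} \<Longrightarrow> m x = nv j \<Longrightarrow> s x \<bullet> nv j = 0 \<Longrightarrow> i \<in> {1,2} \<Longrightarrow> \<bar>slip_coeff M nv b s m i x\<bar> \<le> C * norm (s x)"
proof -
  define K where "K j = 2 / (1 - (b 1 j \<bullet> b 2 j)\<^sup>2)" for j :: nat
  have K: "K j > 0" if "j \<in> {1..M}" for j
    using dual_coeff_denominator_pos[OF slip_systemsD(2,3,6,7)[OF S that]] by (simp add: K_def)
  define C where "C = 1 + (\<Sum>j=1..M. K j)"
  have KC: "K j \<le> C" if "j \<in> {1..M}" for j
    using member_le_sum[OF that, of K] K by (auto simp: C_def less_imp_le intro: order_trans)
  have "C > 0" unfolding C_def using K by (intro add_pos_nonneg sum_nonneg) (auto simp: less_imp_le)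
  moreover have "\<bar>slip_coeff M nv b s m i x\<bar> \<le> C * norm (s x)"
    if j: "j \<in> {1..M}" "m x = nv j" "s x \<bullet> nv j = 0" and i: "i \<in> {1,2}" for s m x i j
  proof -
    note D = slip_systemsD[OF S j(1)]
    have "\<bar>slip_coeff M nv b s m i x\<bar> \<le> K j * norm (s x)"
      using i slip_coeff_properties(1,2)[where s=s and m=m and x=x, OF S j] dual_coeff_bound[OF D(2,3,6,7), of "s x"]
        dual_coeff_bound[OF D(3,2) D(6)[symmetric] D(8), of "s x"]
      by (auto simp: K_def inner_commute)
    also have "\<dots> \<le> C * norm (s x)" using KC[OF j(1)] by (rule mult_right_mono) simp
    finally show ?thesis .
  qed
  ultimately show thesis by (rule that)
qed

text \<open>Off a null set the coefficients are given by \<open>dual_coeff\<close>; on it they are arbitrary, which is harmless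
because Lebesgue measure is complete.\<close>

lemma slip_coeff_measurable:
  assumes S: "slip_systems M nv b" and \<Omega>: "\<Omega> \<in> sets lebesgue" and f: "slip_field \<Omega> s m" and R: "RSC \<Omega> M nv s m"
    and i: "i \<in> {1, 2}"
  shows "slip_coeff M nv b s m i \<in> borel_measurable (lebesgue_on \<Omega>)"
proof -
  have [measurable]: "s \<in> borel_measurable (lebesgue_on \<Omega>)" "m \<in> borel_measurable (lebesgue_on \<Omega>)"
    using f by (auto simp: slip_field_def)
  define d where "d x = (\<Sum>j=1..M. if m x = nv j then dual_coeff (b i j) (b (3 - i) j) (s x) else 0)" for x
  have "d \<in> borel_measurable (lebesgue_on \<Omega>)" unfolding d_def by measurable
  moreover have "AE x in lebesgue_on \<Omega>. d x = slip_coeff M nv b s m i x"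
    using R unfolding RSC_def
  proof eventually_elim
    case (elim x)
    then obtain j where j: "j \<in> {1..M}" "m x = nv j" "s x \<bullet> nv j = 0" by blast
    have "d x = (\<Sum>k=1..M. if k = j then dual_coeff (b i j) (b (3 - i) j) (s x) else 0)"
      unfolding d_def using j slip_normals_inj[OF S _ j(1)] by (intro sum.cong) auto
    also have "\<dots> = dual_coeff (b i j) (b (3 - i) j) (s x)" using j(1) by simp
    also have "\<dots> = slip_coeff M nv b s m i x"
      using i slip_coeff_properties(1,2)[where s=s and m=m and x=x, OF S j] by auto
    finally show ?case .
  qed
  ultimately show ?thesis by (rule borel_measurable_lebesgue_on_AE[OF \<Omega>])
qed

section \<open>Lower integrals over layers\<close>

text \<open>For a function that need not be measurable, the integral is the supremum over simple minorants,
and this supremum is attained by a measurable minorant. Applied to the total variation on slices as a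
function of the height, this yields additivity estimates without a measurability proof.\<close>

lemma nn_integral_minorant:
  fixes f :: "'a \<Rightarrow> ennreal"
  shows "\<exists>h\<in>borel_measurable M. h \<le> f \<and> integral\<^sup>N M h = integral\<^sup>N M f"
proof -
  let ?S = "{g. simple_function M g \<and> g \<le> f}"
  have "?S \<noteq> {}" by (auto intro!: exI[of _ "\<lambda>_. 0"] simp: le_fun_def)
  from ennreal_SUP_countable_SUP[OF this, of "integral\<^sup>S M"]
  obtain F :: "nat \<Rightarrow> ennreal" where F: "range F \<subseteq> integral\<^sup>S M ` ?S" "(\<integral>\<^sup>+x. f x \<partial>M) = (SUP i. F i)"
    unfolding nn_integral_def by auto
  then have "\<forall>i. \<exists>g. g \<in> ?S \<and> F i = integral\<^sup>S M g" by blast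
  then obtain g where g: "\<And>i. simple_function M (g i)" "\<And>i. g i \<le> f" "\<And>i. F i = integral\<^sup>S M (g i)" by (simp, metis)
  define h where "h x = (SUP i. g i x)" for x
  have hm: "h \<in> borel_measurable M"
    unfolding h_def using g(1) by (intro borel_measurable_SUP borel_measurable_simple_function) auto
  have hf: "h x \<le> f x" for x unfolding h_def using g(2) by (auto intro: SUP_least simp: le_fun_def)
  have "F i \<le> (\<integral>\<^sup>+x. h x \<partial>M)" for i
    unfolding g(3) nn_integral_eq_simple_integral[OF g(1), symmetric] h_def
    by (intro nn_integral_mono SUP_upper) auto
  then have "(\<integral>\<^sup>+x. f x \<partial>M) \<le> (\<integral>\<^sup>+x. h x \<partial>M)" unfolding F(2) by (rule SUP_least)
  moreover have "(\<integral>\<^sup>+x. h x \<partial>M) \<le> (\<integral>\<^sup>+x. f x \<partial>M)" by (intro nn_integral_mono hf)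
  ultimately have "integral\<^sup>N M h = integral\<^sup>N M f" by (intro antisym)
  moreover have "h \<le> f" using hf by (rule le_funI)
  ultimately show ?thesis using hm by blast
qed

text \<open>Lower integrals are superadditive; the reverse inequality fails in general.\<close>

lemma nn_integral_add_le_arbitrary:
  fixes f g :: "'a \<Rightarrow> ennreal"
  shows "(\<integral>\<^sup>+x. f x \<partial>M) + (\<integral>\<^sup>+x. g x \<partial>M) \<le> (\<integral>\<^sup>+x. f x + g x \<partial>M)"
proof -
  obtain f' where f': "f' \<in> borel_measurable M" "f' \<le> f" "integral\<^sup>N M f' = integral\<^sup>N M f"
    using nn_integral_minorant[of M f] by blast
  obtain g' where g': "g' \<in> borel_measurable M" "g' \<le> g" "integral\<^sup>N M g' = integral\<^sup>N M g"
    using nn_integral_minorant[of M g] by blast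
  have "(\<integral>\<^sup>+x. f x \<partial>M) + (\<integral>\<^sup>+x. g x \<partial>M) = (\<integral>\<^sup>+x. f' x + g' x \<partial>M)"
    using f' g' by (simp add: nn_integral_add)
  also have "\<dots> \<le> (\<integral>\<^sup>+x. f x + g x \<partial>M)" by (intro nn_integral_mono add_mono le_funD[OF f'(2)] le_funD[OF g'(2)])
  finally show ?thesis .
qed

text \<open>Subadditivity does hold across a measurable partition, since a measurable minorant of the whole
splits into measurable minorants of the pieces.\<close>

lemma nn_integral_if_le_arbitrary:
  fixes f g :: "'a \<Rightarrow> ennreal"
  assumes L: "L \<inter> space M \<in> sets M" and c: "c > (0::real)"
  shows "(\<integral>\<^sup>+x. ennreal c * (if x \<in> L then f x else g x) \<partial>M)
     \<le> ennreal c * ((\<integral>\<^sup>+x\<in>L. f x \<partial>M) + (\<integral>\<^sup>+x\<in>- L. g x \<partial>M))"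
proof -
  obtain h where h[measurable]: "h \<in> borel_measurable M" and hle: "h \<le> (\<lambda>x. ennreal c * (if x \<in> L then f x else g x))"
    and eq: "(\<integral>\<^sup>+x. h x \<partial>M) = (\<integral>\<^sup>+x. ennreal c * (if x \<in> L then f x else g x) \<partial>M)"
    using nn_integral_minorant[of M "\<lambda>x. ennreal c * (if x \<in> L then f x else g x)"] by blast
  have le: "h x \<le> ennreal c * (if x \<in> L then f x else g x)" for x
    using hle by (rule le_funD)
  define k where "k x = ennreal (1 / c) * h x" for x
  have [measurable]: "k \<in> borel_measurable M" unfolding k_def by measurable
  have cc: "ennreal (1 / c) * (ennreal c * y) = y" for y
    using c by (simp add: mult.assoc[symmetric] flip: ennreal_mult)
  have kl: "k x \<le> (if x \<in> L then f x else g x)" for x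
    unfolding k_def using mult_left_mono[OF le[of x], of "ennreal (1 / c)"] by (simp add: cc)
  have hk: "h x = ennreal c * k x" for x
    unfolding k_def using cc[of "h x"] by (simp add: mult.left_commute)
  have [measurable]: "(\<lambda>x. indicator L x :: ennreal) \<in> borel_measurable M"
    using L by (simp add: borel_measurable_indicator_iff)
  have [measurable]: "(\<lambda>x. indicator (- L) x :: ennreal) \<in> borel_measurable M"
  proof (subst borel_measurable_indicator_iff)
    have "- L \<inter> space M = space M - (L \<inter> space M)" by auto
    then show "- L \<inter> space M \<in> sets M" using L by auto
  qed
  have "(\<integral>\<^sup>+x. h x \<partial>M) = ennreal c * (\<integral>\<^sup>+x. k x \<partial>M)"
    unfolding hk by (rule nn_integral_cmult) measurable
  also have "(\<integral>\<^sup>+x. k x \<partial>M) = (\<integral>\<^sup>+x. k x * indicator L x + k x * indicator (- L) x \<partial>M)"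
    by (intro nn_integral_cong) (auto simp: indicator_def)
  also have "\<dots> = (\<integral>\<^sup>+x\<in>L. k x \<partial>M) + (\<integral>\<^sup>+x\<in>- L. k x \<partial>M)"
    by (rule nn_integral_add) measurable
  also have "\<dots> \<le> (\<integral>\<^sup>+x\<in>L. f x \<partial>M) + (\<integral>\<^sup>+x\<in>- L. g x \<partial>M)"
  proof (intro add_mono nn_integral_mono)
    fix x
    show "k x * indicator L x \<le> f x * indicator L x" using kl[of x] by (cases "x \<in> L") simp_all
    show "k x * indicator (- L) x \<le> g x * indicator (- L) x" using kl[of x] by (cases "x \<in> L") simp_all
  qed
  finally show ?thesis by (simp add: eq mult_left_mono)
qed

lemma nn_integral_split_le_arbitrary:
  fixes f :: "'a \<Rightarrow> ennreal"
  shows "(\<integral>\<^sup>+x\<in>L. f x \<partial>M) + (\<integral>\<^sup>+x\<in>- L. f x \<partial>M) \<le> (\<integral>\<^sup>+x. f x \<partial>M)"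
  by (rule order_trans[OF nn_integral_add_le_arbitrary])
     (auto intro!: nn_integral_mono simp: indicator_def)

section \<open>Rank-one matrices and their symmetric parts\<close>

lemma norm_matrix_square: "(norm (A :: real^3^3))\<^sup>2 = (\<Sum>i\<in>UNIV. \<Sum>j\<in>UNIV. (A $ i $ j)\<^sup>2)"
  unfolding power2_norm_eq_inner inner_vec_def by (simp add: power2_eq_square)

lemma norm_tensor: "norm (a \<otimes> c) = norm a * norm c"
proof -
  have "(norm (a \<otimes> c))\<^sup>2 = (norm a)\<^sup>2 * (norm c)\<^sup>2"
    unfolding norm_matrix_square unfolding power2_norm_eq_inner inner_vec_def tensor_def
    by (simp add: sum_product power2_eq_square ac_simps)
  then show ?thesis by (simp add: power_mult_distrib[symmetric])
qed

lemma norm_transpose: "norm (transpose A) = norm (A :: real^3^3)"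
proof -
  have "(norm (transpose A))\<^sup>2 = (norm A)\<^sup>2"
    unfolding norm_matrix_square by (simp add: transpose_def) (rule sum.swap)
  then show ?thesis by simp
qed

lemma bounded_linear_sym_part: "bounded_linear sym_part"
  unfolding linear_conv_bounded_linear[symmetric]
  by (rule linearI) (simp_all add: sym_part_def transpose_def vec_eq_iff algebra_simps)

lemma norm_sym_part_le: "norm (sym_part A) \<le> norm A"
  using norm_triangle_ineq[of A "transpose A"] by (simp add: sym_part_def norm_transpose)

text \<open>For orthogonal \<open>a\<close> and \<open>n\<close> the matrices \<open>a \<otimes> n\<close> and \<open>n \<otimes> a\<close> are orthogonal of equal norm. Thus the
symmetric part controls the slip, without any inequality of Korn type.\<close>

lemma norm_sym_part_tensor:
  assumes "norm n = 1" "a \<bullet> n = 0"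
  shows "norm a = sqrt 2 * norm (sym_part (a \<otimes> n))"
proof -
  have t: "transpose (a \<otimes> n) = n \<otimes> a" by (simp add: tensor_def transpose_def vec_eq_iff)
  have i: "(p \<otimes> q) \<bullet> (p' \<otimes> q') = (p \<bullet> p') * (q \<bullet> q')" for p q p' q' :: "real^3"
    unfolding tensor_def inner_vec_def by (simp add: sum_product ac_simps)
  have "(norm (sym_part (a \<otimes> n)))\<^sup>2 = (1/4) * ((a \<otimes> n + n \<otimes> a) \<bullet> (a \<otimes> n + n \<otimes> a))"
    unfolding power2_norm_eq_inner sym_part_def t inner_scaleR_left inner_scaleR_right by simp
  also have "(a \<otimes> n + n \<otimes> a) \<bullet> (a \<otimes> n + n \<otimes> a) = 2 * ((a \<bullet> a) * (n \<bullet> n)) + 2 * ((a \<bullet> n) * (n \<bullet> a))"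
    unfolding inner_add_left inner_add_right i by simp
  also have "(1/4) * \<dots> = (norm a)\<^sup>2 / 2"
    using assms by (simp add: dot_square_norm)
  finally have "(sqrt 2 * norm (sym_part (a \<otimes> n)))\<^sup>2 = (norm a)\<^sup>2" by (simp add: power_mult_distrib)
  then show ?thesis by (simp add: power2_eq_iff_nonneg)
qed

lemma tensor_linear_left:
  "(a + c) \<otimes> d = a \<otimes> d + c \<otimes> d" "(a - c) \<otimes> d = a \<otimes> d - c \<otimes> d" "(r *\<^sub>R a) \<otimes> d = r *\<^sub>R (a \<otimes> d)" "0 \<otimes> d = 0"
  by (simp_all add: tensor_def vec_eq_iff algebra_simps)

section \<open>Smooth truncation of the slip coefficients\<close>

text \<open>A bounded contraction that tends to the identity as \<open>K\<close> grows. It takes the place of the clamp to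
\<open>[-K, K]\<close>, which is not of class \<open>C\<^sup>2\<close>.\<close>

definition soft_cap :: "real \<Rightarrow> real \<Rightarrow> real" where
  "soft_cap K t = K * arctan (t / K)"

lemma
  assumes K: "K > 0"
  shows soft_cap_derivative: "(soft_cap K has_real_derivative 1 / (1 + (t / K)\<^sup>2)) (at t)"
    and soft_cap_second_derivative: "((\<lambda>t. 1 / (1 + (t / K)\<^sup>2)) has_real_derivative - (2 * t / K\<^sup>2) / (1 + (t / K)\<^sup>2)\<^sup>2) (at t)"
    and soft_cap_second_continuous: "continuous_on UNIV (\<lambda>t. - (2 * t / K\<^sup>2) / (1 + (t / K)\<^sup>2)\<^sup>2)"
    and soft_cap_derivative_le: "\<bar>1 / (1 + (t / K)\<^sup>2)\<bar> \<le> 1"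
    and soft_cap_0: "soft_cap K 0 = 0"
    and soft_cap_bounded: "\<bar>soft_cap K t\<bar> \<le> 2 * K"
    and soft_cap_abs_le: "\<bar>soft_cap K t\<bar> \<le> \<bar>t\<bar>"
proof -
  have nz: "1 + (t / K)\<^sup>2 \<noteq> 0" for t
    using zero_le_power2[of "t / K"] by linarith
  show 1: "(soft_cap K has_real_derivative 1 / (1 + (t / K)\<^sup>2)) (at t)" for t
    unfolding soft_cap_def using K by (auto intro!: derivative_eq_intros simp: divide_inverse)
  show "((\<lambda>t. 1 / (1 + (t / K)\<^sup>2)) has_real_derivative - (2 * t / K\<^sup>2) / (1 + (t / K)\<^sup>2)\<^sup>2) (at t)"
    using nz K by (auto intro!: derivative_eq_intros simp: power2_eq_square)
  show "continuous_on UNIV (\<lambda>t. - (2 * t / K\<^sup>2) / (1 + (t / K)\<^sup>2)\<^sup>2)"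
    using nz K by (auto intro!: continuous_intros)
  show 2: "\<bar>1 / (1 + (t / K)\<^sup>2)\<bar> \<le> 1" for t
  proof -
    have "\<bar>1 / (1 + q)\<bar> \<le> 1" if "q \<ge> 0" for q :: real using that by simp
    then show ?thesis using zero_le_power2 .
  qed
  show 3: "soft_cap K 0 = 0" by (simp add: soft_cap_def)
  have "\<bar>arctan (t / K)\<bar> \<le> 2"
    using arctan_bounded[of "t / K"] pi_less_4 by (simp add: abs_le_iff)
  then show "\<bar>soft_cap K t\<bar> \<le> 2 * K" using K by (simp add: soft_cap_def abs_mult mult.commute)
  show "\<bar>soft_cap K t\<bar> \<le> \<bar>t\<bar>"
    using contraction_if_derivative_le_1[OF 1 2, of t 0] 3 by simp
qed

lemma soft_cap_tendsto: "(\<lambda>k. soft_cap (real (Suc k)) t) \<longlonglongrightarrow> t"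
proof (cases "t = 0")
  case True then show ?thesis by (simp add: soft_cap_def)
next
  case False
  have "((\<lambda>h. (arctan (0 + h) - arctan 0) / h) \<longlongrightarrow> inverse (1 + 0\<^sup>2)) (at 0)"
    using DERIV_arctan[of 0] unfolding DERIV_def .
  then have 1: "((\<lambda>h. arctan h / h) \<longlongrightarrow> 1) (at 0)" by simp
  have "(\<lambda>k. t / real (Suc k)) \<longlonglongrightarrow> 0" by (rule LIMSEQ_Suc[OF lim_const_over_n])
  then have "filterlim (\<lambda>k. t / real (Suc k)) (at 0) sequentially"
    using False by (simp add: filterlim_at del: of_nat_Suc)
  from tendsto_mult_left[OF filterlim_compose[OF 1 this], of t]
  show ?thesis using False by (simp add: soft_cap_def mult.commute del: of_nat_Suc)
qed

lemma soft_cap_L2_close: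
  assumes c: "L2_on S c" and S: "S \<in> sets lebesgue"
  shows "(\<lambda>k. \<integral>\<^sup>+x. ennreal ((norm (soft_cap (real (Suc k)) (c x) - c x))\<^sup>2) \<partial>lebesgue_on S) \<longlonglongrightarrow> 0"
proof -
  have [measurable]: "c \<in> borel_measurable (lebesgue_on S)" using c by (simp add: L2_on_def)
  have fin: "(\<integral>\<^sup>+x. ennreal (4 * (norm (c x))\<^sup>2) \<partial>lebesgue_on S) < \<infinity>"
    using c unfolding L2_on_def by (simp add: integrable_iff_bounded ennreal_mult nn_integral_cmult ennreal_mult_less_top)
  have [measurable]: "soft_cap K \<in> borel_measurable borel" for K unfolding soft_cap_def by measurable
  have "(\<lambda>k. \<integral>\<^sup>+x. ennreal ((norm (soft_cap (real (Suc k)) (c x) - c x))\<^sup>2) \<partial>lebesgue_on S)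
     \<longlonglongrightarrow> (\<integral>\<^sup>+x. ennreal 0 \<partial>lebesgue_on S)"
  proof (rule nn_integral_dominated_convergence[where w="\<lambda>x. ennreal (4 * (norm (c x))\<^sup>2)"])
    show "AE x in lebesgue_on S. ennreal ((norm (soft_cap (real (Suc k)) (c x) - c x))\<^sup>2) \<le> ennreal (4 * (norm (c x))\<^sup>2)" for k
    proof (rule AE_I2, rule ennreal_leI)
      fix x
      have "norm (soft_cap (real (Suc k)) (c x) - c x) \<le> 2 * norm (c x)"
        using soft_cap_abs_le[of "real (Suc k)" "c x"] by (simp del: of_nat_Suc)
      then have "(norm (soft_cap (real (Suc k)) (c x) - c x))\<^sup>2 \<le> (2 * norm (c x))\<^sup>2" by (rule power_mono) simp
      then show "(norm (soft_cap (real (Suc k)) (c x) - c x))\<^sup>2 \<le> 4 * (norm (c x))\<^sup>2" by (simp add: power_mult_distrib)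
    qed
    show "AE x in lebesgue_on S. (\<lambda>k. ennreal ((norm (soft_cap (real (Suc k)) (c x) - c x))\<^sup>2)) \<longlonglongrightarrow> ennreal 0"
    proof (rule AE_I2, rule tendsto_ennrealI)
      fix x
      have "(\<lambda>k. (norm (soft_cap (real (Suc k)) (c x) - c x))\<^sup>2) \<longlonglongrightarrow> (norm (c x - c x))\<^sup>2"
        by (intro tendsto_intros soft_cap_tendsto)
      then show "(\<lambda>k. (norm (soft_cap (real (Suc k)) (c x) - c x))\<^sup>2) \<longlonglongrightarrow> 0" by simp
    qed
  qed (use fin in auto)
  then show ?thesis by simp
qed

section \<open>The laminate profile\<close>

text \<open>For \<open>C = 1\<close> the function \<open>W\<close> is a triangle wave of slope \<open>\<plusminus>1\<close>, a primitive of the square wave with the sign of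
\<open>sin (N t)\<close>. Taking \<open>C > 1\<close> rounds off its corners.\<close>

lemma smoothed_zigzag:
  assumes N: "N > 0" and C: "C > 1"
  defines "W \<equiv> \<lambda>t. - (arcsin (cos (N * t) / C)) / N" and "W' \<equiv> \<lambda>t. sin (N * t) / sqrt (C\<^sup>2 - (cos (N * t))\<^sup>2)"
  shows "(W has_real_derivative W' t) (at t)" "continuous_on UNIV W'" "\<bar>W t\<bar> \<le> 2 / N" "\<bar>W' t\<bar> \<le> 1"
proof -
  have cs: "(cos (N * t))\<^sup>2 \<le> 1" "\<bar>cos (N * t)\<bar> \<le> 1" for t
    using abs_cos_le_one[of "N * t"] by (auto simp: abs_square_le_1)
  have C0: "C \<noteq> 0" using C by simp
  have C2: "C\<^sup>2 > 1" using C by (simp add: one_less_power)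
  have pos: "C\<^sup>2 - (cos (N * t))\<^sup>2 > 0" for t using cs(1)[of t] C2 by linarith
  have "\<bar>cos (N * t) / C\<bar> < 1" for t
    using le_less_trans[OF cs(2)[of t] C] C by (simp add: abs_divide divide_less_eq)
  note ab = this
  have in1: "-1 < cos (N * t) / C" "cos (N * t) / C < 1" for t
    using ab[of t] unfolding abs_less_iff by linarith+
  have sq: "sqrt (1 - (cos (N * t) / C)\<^sup>2) = sqrt (C\<^sup>2 - (cos (N * t))\<^sup>2) / C" for t
  proof -
    have "1 - (cos (N * t) / C)\<^sup>2 = (C\<^sup>2 - (cos (N * t))\<^sup>2) / C\<^sup>2" using C by (simp add: field_simps power_divide)
    then show ?thesis using C by (simp add: real_sqrt_divide)
  qed
  have "((\<lambda>t. - (arcsin (cos (N * t) / C)) / N) has_real_derivative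
     - (inverse (sqrt (1 - (cos (N * t) / C)\<^sup>2)) * (- sin (N * t) * N / C)) / N) (at t)"
    using in1[of t] N C0 by (auto intro!: derivative_eq_intros)
  moreover have "- (inverse (sqrt (1 - (cos (N * t) / C)\<^sup>2)) * (- sin (N * t) * N / C)) / N = W' t"
    unfolding sq W'_def using N C0 by (simp add: field_simps)
  ultimately show "(W has_real_derivative W' t) (at t)" unfolding W_def by simp
  show "continuous_on UNIV W'"
    unfolding W'_def using pos by (auto intro!: continuous_intros) (metis less_irrefl)
  have "\<bar>arcsin (cos (N * t) / C)\<bar> \<le> 2"
    using arcsin_bounded[of "cos (N * t) / C"] in1[of t] pi_less_4 by (auto simp: abs_le_iff)
  then show "\<bar>W t\<bar> \<le> 2 / N" using N by (simp add: W_def abs_divide divide_right_mono)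
  have "sqrt (C\<^sup>2 - (cos (N * t))\<^sup>2) \<ge> sqrt ((sin (N * t))\<^sup>2)"
    using C2 by (intro real_sqrt_le_mono) (simp add: sin_squared_eq)
  then have "\<bar>sin (N * t)\<bar> \<le> sqrt (C\<^sup>2 - (cos (N * t))\<^sup>2)" by simp
  then show "\<bar>W' t\<bar> \<le> 1" using pos[of t] by (simp add: W'_def abs_divide divide_le_eq)
qed

lemma null_sin_inner_eq_0:
  fixes n :: "'a::euclidean_space"
  assumes "n \<noteq> 0" "N > 0"
  shows "AE x in lebesgue. sin (N * (x \<bullet> n)) \<noteq> 0"
proof -
  have "negligible (\<Union>k::int. {x. n \<bullet> x = of_int k * pi / N})"
    using assms(1) by (intro negligible_countable_Union[where 'a='a] countable_image) (auto intro!: negligible_hyperplane)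
  moreover have "{x. sin (N * (x \<bullet> n)) = 0} \<subseteq> (\<Union>k::int. {x. n \<bullet> x = of_int k * pi / N})"
    using assms(2) by (auto simp: sin_zero_iff_int2 inner_commute field_simps)
  ultimately have "negligible {x. sin (N * (x \<bullet> n)) = 0}" by (rule negligible_subset)
  then have "{x. sin (N * (x \<bullet> n)) = 0} \<in> null_sets lebesgue" by (simp add: negligible_iff_null_sets)
  from AE_not_in[OF this] show ?thesis by simp
qed

text \<open>As \<open>C\<close> decreases to \<open>1\<close>, the derivative of the rounded triangle wave tends to the square wave except where
\<open>sin (N (x \<bullet> n))\<close> vanishes, which is a countable union of hyperplanes. The factor \<open>\<kappa>\<close> allows
the two kinds of layers to be exchanged.\<close>

lemma laminate_profile_exists:
  fixes f :: "real^3 \<Rightarrow> real^3"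
  assumes N: "N > 0" and n: "norm n = 1" and f: "f \<in> C1c S" and d: "d > (0::real)" and \<kappa>: "\<kappa> \<in> {1, -1}"
  shows "\<exists>W W'. (\<forall>t. (W has_real_derivative W' t) (at t)) \<and> continuous_on UNIV W' \<and> (\<forall>t. \<bar>W t\<bar> \<le> 2 / N) \<and>
     (\<integral>\<^sup>+x. ennreal ((norm ((W' (x \<bullet> n) - \<kappa> * (if sin (N * (x \<bullet> n)) > 0 then 1 else - 1)) *\<^sub>R f x))\<^sup>2) \<partial>lebesgue) < ennreal d"
proof -
  define C where "C k = 1 + 1 / real (Suc k)" for k
  have C: "C k > 1" for k by (simp add: C_def)
  define V where "V k t = - (arcsin (cos (N * t) / C k)) / N" for k t
  define V' where "V' k t = sin (N * t) / sqrt ((C k)\<^sup>2 - (cos (N * t))\<^sup>2)" for k t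
  note prof = smoothed_zigzag[OF N C, folded V_def V'_def]
  define \<theta> :: "real^3 \<Rightarrow> real" where "\<theta> x = (if sin (N * (x \<bullet> n)) > 0 then 1 else - 1)" for x
  have k1: "\<bar>\<kappa>\<bar> = 1" using \<kappa> by auto
  have [measurable]: "f \<in> borel_measurable borel"
    using C1_map_continuous[OF C1c_C1_map[OF f]] by (rule borel_measurable_continuous_onI)
  have [measurable]: "V' k \<in> borel_measurable borel" for k
    using prof(2) by (rule borel_measurable_continuous_onI)
  have [measurable]: "\<theta> \<in> borel_measurable borel" unfolding \<theta>_def by measurable
  have fin: "(\<integral>\<^sup>+x. ennreal (4 * (norm (f x))\<^sup>2) \<partial>lebesgue) < \<infinity>"
  proof -
    have "(\<integral>\<^sup>+x. ennreal ((norm (f x))\<^sup>2) \<partial>lebesgue) < \<infinity>"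
      using C1c_L2_on[OF f, of UNIV] by (simp add: L2_on_iff)
    then show ?thesis by (simp add: ennreal_mult nn_integral_cmult ennreal_mult_less_top nn_integral_completion)
  qed
  let ?q = "\<lambda>k x. (norm ((\<kappa> * V' k (x \<bullet> n) - \<kappa> * \<theta> x) *\<^sub>R f x))\<^sup>2"
  have "(\<lambda>k. \<integral>\<^sup>+x. ennreal (?q k x) \<partial>lebesgue) \<longlonglongrightarrow> (\<integral>\<^sup>+x. ennreal 0 \<partial>(lebesgue :: (real^3) measure))"
  proof (rule nn_integral_dominated_convergence[where w="\<lambda>x. ennreal (4 * (norm (f x))\<^sup>2)"])
    show "(\<lambda>x. ennreal (?q k x)) \<in> borel_measurable lebesgue" for k
      by (rule measurable_completion) simp
    show "(\<lambda>x. ennreal (4 * (norm (f x))\<^sup>2)) \<in> borel_measurable lebesgue"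
      by (rule measurable_completion) simp
    show "AE x in lebesgue. ennreal (?q k x) \<le> ennreal (4 * (norm (f x))\<^sup>2)" for k
    proof (rule AE_I2, rule ennreal_leI)
      fix x
      have "\<bar>\<kappa> * V' k (x \<bullet> n) - \<kappa> * \<theta> x\<bar> = \<bar>V' k (x \<bullet> n) - \<theta> x\<bar>"
        using k1 by (simp add: abs_mult flip: right_diff_distrib)
      also have "\<dots> \<le> 2" using prof(4)[of k "x \<bullet> n"] by (auto simp: \<theta>_def)
      finally have "norm ((\<kappa> * V' k (x \<bullet> n) - \<kappa> * \<theta> x) *\<^sub>R f x) \<le> 2 * norm (f x)"
        by (simp add: mult_right_mono)
      then have "?q k x \<le> (2 * norm (f x))\<^sup>2" by (rule power_mono) simp
      then show "?q k x \<le> 4 * (norm (f x))\<^sup>2" by (simp add: power_mult_distrib)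
    qed
    show "AE x in lebesgue. (\<lambda>k. ennreal (?q k x)) \<longlonglongrightarrow> ennreal 0"
    proof -
      have "n \<noteq> 0" using n by auto
      from null_sin_inner_eq_0[OF this N] show ?thesis
      proof eventually_elim
        case (elim x)
        let ?s = "sin (N * (x \<bullet> n))"
        have "C \<longlonglongrightarrow> 1 + 0" unfolding C_def by (intro tendsto_intros LIMSEQ_Suc[OF lim_const_over_n])
        then have C1: "C \<longlonglongrightarrow> 1" by simp
        have "(\<lambda>k. sqrt ((C k)\<^sup>2 - (cos (N * (x \<bullet> n)))\<^sup>2)) \<longlonglongrightarrow> sqrt (1\<^sup>2 - (cos (N * (x \<bullet> n)))\<^sup>2)"
          by (intro tendsto_intros C1)
        also have "sqrt (1\<^sup>2 - (cos (N * (x \<bullet> n)))\<^sup>2) = \<bar>?s\<bar>" by (simp flip: sin_squared_eq)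
        finally have "(\<lambda>k. V' k (x \<bullet> n)) \<longlonglongrightarrow> ?s / \<bar>?s\<bar>"
          unfolding V'_def using elim by (intro tendsto_intros) auto
        also have "?s / \<bar>?s\<bar> = \<theta> x" using elim by (simp add: \<theta>_def abs_if)
        finally have "(\<lambda>k. ?q k x) \<longlonglongrightarrow> (norm ((\<kappa> * \<theta> x - \<kappa> * \<theta> x) *\<^sub>R f x))\<^sup>2"
          by (intro tendsto_intros)
        then have "(\<lambda>k. ?q k x) \<longlonglongrightarrow> 0" by simp
        then show ?case by (rule tendsto_ennrealI)
      qed
    qed
  qed (use fin in auto)
  then have "(\<lambda>k. \<integral>\<^sup>+x. ennreal (?q k x) \<partial>lebesgue) \<longlonglongrightarrow> 0" by simp
  then have "\<forall>\<^sub>F k in sequentially. (\<integral>\<^sup>+x. ennreal (?q k x) \<partial>lebesgue) < ennreal d"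
    using d by (intro order_tendstoD(2)) auto
  then obtain k where k: "(\<integral>\<^sup>+x. ennreal (?q k x) \<partial>lebesgue) < ennreal d"
    by (auto simp: eventually_sequentially)
  show ?thesis
  proof (intro exI conjI allI)
    show "((\<lambda>t. \<kappa> * V k t) has_real_derivative \<kappa> * V' k t) (at t)" for t
      by (rule DERIV_cmult[OF prof(1)])
    show "continuous_on UNIV (\<lambda>t. \<kappa> * V' k t)" by (intro continuous_intros prof(2))
    show "\<bar>\<kappa> * V k t\<bar> \<le> 2 / N" for t using prof(3)[of k t] k1 by (simp add: abs_mult)
  qed (use k in \<open>simp add: \<theta>_def\<close>)
qed

section \<open>Curl and mass of the laminated slip field\<close>

text \<open>For distinct normals at most one summand differs from zero. The field is defined from the coefficients even at the
exceptional points where (RSC) fails, so that its product with the indicator of a slip region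
agrees with the truncated coefficient at \<^emph>\<open>every\<close> point; slices then need no discussion of null sets.\<close>

definition laminated_slip :: "nat \<Rightarrow> (nat \<Rightarrow> real^3) \<Rightarrow> (nat \<Rightarrow> nat \<Rightarrow> real^3) \<Rightarrow> (nat \<Rightarrow> real set) \<Rightarrow> real \<Rightarrow>
    (real^3 \<Rightarrow> real^3) \<Rightarrow> (real^3 \<Rightarrow> real^3) \<Rightarrow> real^3 \<Rightarrow> real^3" where
  "laminated_slip M nv b L K s m x =
     (\<Sum>j=1..M. if m x = nv j
        then (if x \<bullet> nv j \<in> L j then (2 * soft_cap K (slip_coeff M nv b s m 1 x)) *\<^sub>R b 1 j
              else (2 * soft_cap K (slip_coeff M nv b s m 2 x)) *\<^sub>R b 2 j)
        else 0)"

lemma laminated_slip_eq: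
  assumes "slip_systems M nv b" "j \<in> {1..M}" "m x = nv j"
  shows "laminated_slip M nv b L K s m x =
    (if x \<bullet> nv j \<in> L j then (2 * soft_cap K (slip_coeff M nv b s m 1 x)) *\<^sub>R b 1 j
     else (2 * soft_cap K (slip_coeff M nv b s m 2 x)) *\<^sub>R b 2 j)"
proof -
  let ?v = "if x \<bullet> nv j \<in> L j then (2 * soft_cap K (slip_coeff M nv b s m 1 x)) *\<^sub>R b 1 j
     else (2 * soft_cap K (slip_coeff M nv b s m 2 x)) *\<^sub>R b 2 j"
  have "laminated_slip M nv b L K s m x = (\<Sum>k=1..M. if k = j then ?v else 0)"
    unfolding laminated_slip_def
  proof (rule sum.cong[OF refl])
    fix k assume k: "k \<in> {1..M}"
    have "m x = nv k \<longleftrightarrow> k = j"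
    proof
      assume "m x = nv k"
      then have "nv k = nv j" using assms(3) by simp
      then show "k = j" by (rule slip_normals_inj[OF assms(1) k assms(2)])
    qed (simp add: assms(3))
    then show "(if m x = nv k
        then (if x \<bullet> nv k \<in> L k then (2 * soft_cap K (slip_coeff M nv b s m 1 x)) *\<^sub>R b 1 k
              else (2 * soft_cap K (slip_coeff M nv b s m 2 x)) *\<^sub>R b 2 k)
        else 0) = (if k = j then ?v else 0)" by simp
  qed
  also have "\<dots> = ?v" using assms(2) by simp
  finally show ?thesis .
qed

definition slice_coeff_tv :: "(real^3) set \<Rightarrow> nat \<Rightarrow> (nat \<Rightarrow> real^3) \<Rightarrow> (nat \<Rightarrow> nat \<Rightarrow> real^3) \<Rightarrow>
    (real^3 \<Rightarrow> real^3) \<Rightarrow> (real^3 \<Rightarrow> real^3) \<Rightarrow> nat \<Rightarrow> nat \<Rightarrow> real \<Rightarrow> ennreal" where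
  "slice_coeff_tv \<Omega> M nv b s m j i t = tv_scalar (slice \<Omega> (nv j) t)
     (\<lambda>y. indicator (slip_region \<Omega> m (nv j)) (slice_point (nv j) t y) * slip_coeff M nv b s m i (slice_point (nv j) t y))"

abbreviation layered_tv :: "(real^3) set \<Rightarrow> nat \<Rightarrow> (nat \<Rightarrow> real^3) \<Rightarrow> (nat \<Rightarrow> nat \<Rightarrow> real^3) \<Rightarrow>
    (real^3 \<Rightarrow> real^3) \<Rightarrow> (real^3 \<Rightarrow> real^3) \<Rightarrow> nat \<Rightarrow> real set \<Rightarrow> ennreal" where
  "layered_tv \<Omega> M nv b s m j A \<equiv>
     (\<integral>\<^sup>+t\<in>A. slice_coeff_tv \<Omega> M nv b s m j 1 t \<partial>lebesgue) + (\<integral>\<^sup>+t\<in>- A. slice_coeff_tv \<Omega> M nv b s m j 2 t \<partial>lebesgue)"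

text \<open>On a slice, \<open>x \<bullet> nv j\<close> is constant, so only one slip direction occurs there. The field is then a
scalar times a unit vector, and truncation does not increase the total variation of the scalar.\<close>

lemma planar_curl_laminated_slip_le:
  assumes S: "slip_systems M nv b" and \<Omega>: "open \<Omega>" and K: "K > 0" and j: "j \<in> {1..M}" and L: "L j \<in> sets lebesgue"
  shows "planar_curl \<Omega> (nv j) (laminated_slip M nv b L K s m) m \<le>
     ennreal 2 * layered_tv \<Omega> M nv b s m j (L j)"
proof -
  note D = slip_systemsD[OF S j]
  let ?n = "nv j"
  let ?c = "\<lambda>i t y. indicator (slip_region \<Omega> m ?n) (slice_point ?n t y) * slip_coeff M nv b s m i (slice_point ?n t y)"
  have field: "indicator (slip_region \<Omega> m ?n) (slice_point ?n t y) *\<^sub>R laminated_slip M nv b L K s m (slice_point ?n t y)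
     = (if t \<in> L j then (2 * soft_cap K (?c 1 t y)) *\<^sub>R b 1 j else (2 * soft_cap K (?c 2 t y)) *\<^sub>R b 2 j)" for t y
  proof (cases "slice_point ?n t y \<in> slip_region \<Omega> m ?n")
    case True
    then have "m (slice_point ?n t y) = ?n" by (simp add: slip_region_def)
    from laminated_slip_eq[where m=m and x="slice_point ?n t y", OF S j this] show ?thesis
      using True by (simp add: slice_point_inner[OF D(1)])
  next
    case False
    then show ?thesis by (simp add: soft_cap_0[OF K])
  qed
  have tv: "tv_vector (slice \<Omega> ?n t) (\<lambda>y. (2 * soft_cap K (?c i t y)) *\<^sub>R w) \<le> ennreal 2 * slice_coeff_tv \<Omega> M nv b s m j i t"
    if "norm w = 1" for t i and w :: "real^3"
  proof -
    have "tv_vector (slice \<Omega> ?n t) (\<lambda>y. (2 * soft_cap K (?c i t y)) *\<^sub>R w) \<le> ennreal 2 * tv_scalar (slice \<Omega> ?n t) (\<lambda>y. soft_cap K (?c i t y))"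
      by (rule tv_vector_scaleR_le) (use that in auto)
    also have "\<dots> \<le> ennreal 2 * tv_scalar (slice \<Omega> ?n t) (?c i t)"
      by (intro mult_left_mono tv_scalar_compose_le[OF open_slice[OF \<Omega>] soft_cap_derivative[OF K]
        soft_cap_second_derivative[OF K] soft_cap_second_continuous[OF K] soft_cap_derivative_le[OF K] soft_cap_0[OF K]]) simp
    finally show ?thesis by (simp add: slice_coeff_tv_def)
  qed
  have "planar_curl \<Omega> ?n (laminated_slip M nv b L K s m) m
     \<le> (\<integral>\<^sup>+t. ennreal 2 * (if t \<in> L j then slice_coeff_tv \<Omega> M nv b s m j 1 t else slice_coeff_tv \<Omega> M nv b s m j 2 t) \<partial>lebesgue)"
    unfolding planar_curl_def field
    by (rule nn_integral_mono) (use tv[OF D(2)] tv[OF D(3)] in \<open>simp split: if_split\<close>)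
  also have "\<dots> \<le> ennreal 2 * layered_tv \<Omega> M nv b s m j (L j)"
    by (rule nn_integral_if_le_arbitrary) (use L in auto)
  finally show ?thesis .
qed

lemma nn_integral_sum_add:
  assumes "\<And>j. f j \<in> borel_measurable M" "\<And>j. g j \<in> borel_measurable M"
  shows "(\<Sum>j\<in>J. (\<integral>\<^sup>+x. f j x \<partial>M) + (\<integral>\<^sup>+x. g j x \<partial>M)) = (\<integral>\<^sup>+x. (\<Sum>j\<in>J. f j x + g j x) \<partial>M)"
  using assms by (simp add: nn_integral_sum nn_integral_add)

lemma nn_integral_sum_cmult_add:
  assumes "\<And>j. f j \<in> borel_measurable M" "\<And>j. g j \<in> borel_measurable M"
  shows "(\<Sum>j\<in>J. c * ((\<integral>\<^sup>+x. f j x \<partial>M) + (\<integral>\<^sup>+x. g j x \<partial>M))) = (\<integral>\<^sup>+x. (\<Sum>j\<in>J. c * (f j x + g j x)) \<partial>M)"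
  using assms by (simp add: nn_integral_sum nn_integral_add nn_integral_cmult)

definition layer_mass :: "(real^3) set \<Rightarrow> nat \<Rightarrow> (nat \<Rightarrow> real^3) \<Rightarrow> (nat \<Rightarrow> nat \<Rightarrow> real^3) \<Rightarrow>
    (real^3 \<Rightarrow> real^3) \<Rightarrow> (real^3 \<Rightarrow> real^3) \<Rightarrow> nat \<Rightarrow> nat \<Rightarrow> real set \<Rightarrow> ennreal" where
  "layer_mass \<Omega> M nv b s m j i A =
     (\<integral>\<^sup>+x. ennreal \<bar>slip_coeff M nv b s m i x\<bar> * indicator {x. m x = nv j \<and> x \<bullet> nv j \<in> A} x \<partial>lebesgue_on \<Omega>)"

abbreviation layered_mass :: "(real^3) set \<Rightarrow> nat \<Rightarrow> (nat \<Rightarrow> real^3) \<Rightarrow> (nat \<Rightarrow> nat \<Rightarrow> real^3) \<Rightarrow>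
    (real^3 \<Rightarrow> real^3) \<Rightarrow> (real^3 \<Rightarrow> real^3) \<Rightarrow> nat \<Rightarrow> real set \<Rightarrow> ennreal" where
  "layered_mass \<Omega> M nv b s m j A \<equiv> layer_mass \<Omega> M nv b s m j 1 A + layer_mass \<Omega> M nv b s m j 2 (- A)"

lemma layer_measurable:
  assumes f: "slip_field \<Omega> s m" and A: "A \<in> sets borel"
  shows "{x \<in> space (lebesgue_on \<Omega>). m x = p \<and> x \<bullet> n \<in> A} \<in> sets (lebesgue_on \<Omega>)"
    and "(indicator {x. m x = p \<and> x \<bullet> n \<in> A} :: real^3 \<Rightarrow> ennreal) \<in> borel_measurable (lebesgue_on \<Omega>)"
proof -
  have [measurable]: "m \<in> borel_measurable (lebesgue_on \<Omega>)" using f by (auto simp: slip_field_def)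
  have "(\<lambda>x. x \<bullet> n) \<in> borel_measurable lebesgue" by (rule measurable_completion) simp
  then have [measurable]: "(\<lambda>x. x \<bullet> n) \<in> borel_measurable (lebesgue_on \<Omega>)" by (rule measurable_restrict_space1)
  note A[measurable]
  show 1: "{x \<in> space (lebesgue_on \<Omega>). m x = p \<and> x \<bullet> n \<in> A} \<in> sets (lebesgue_on \<Omega>)" by measurable
  have "{x. m x = p \<and> x \<bullet> n \<in> A} \<inter> space (lebesgue_on \<Omega>) = {x \<in> space (lebesgue_on \<Omega>). m x = p \<and> x \<bullet> n \<in> A}" by auto
  then show "(indicator {x. m x = p \<and> x \<bullet> n \<in> A} :: real^3 \<Rightarrow> ennreal) \<in> borel_measurable (lebesgue_on \<Omega>)"
    using 1 by (simp only: borel_measurable_indicator_iff)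
qed

lemma slip_coeff_ennreal_measurable:
  assumes "slip_systems M nv b" "\<Omega> \<in> sets lebesgue" "slip_field \<Omega> s m" "RSC \<Omega> M nv s m" "i \<in> {1, 2}"
  shows "(\<lambda>x. ennreal \<bar>slip_coeff M nv b s m i x\<bar>) \<in> borel_measurable (lebesgue_on \<Omega>)"
  using slip_coeff_measurable[OF assms] by measurable

lemma sum_layer_mass_le:
  assumes S: "slip_systems M nv b" and \<Omega>: "\<Omega> \<in> sets lebesgue" and f: "slip_field \<Omega> s m" and R: "RSC \<Omega> M nv s m"
    and i: "i \<in> {1, 2}" and A: "A \<in> sets borel"
  shows "(\<Sum>j=1..M. layer_mass \<Omega> M nv b s m j i A + layer_mass \<Omega> M nv b s m j i (- A))
     \<le> (\<integral>\<^sup>+x\<in>\<Omega>. ennreal \<bar>slip_coeff M nv b s m i x\<bar> \<partial>lebesgue)"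
proof -
  let ?c = "\<lambda>x. ennreal \<bar>slip_coeff M nv b s m i x\<bar>"
  let ?I = "\<lambda>j A x. indicator {x. m x = nv j \<and> x \<bullet> nv j \<in> A} x :: ennreal"
  note [measurable] = slip_coeff_ennreal_measurable[OF S \<Omega> f R i]
  have A': "- A \<in> sets borel" using A by auto
  have [measurable]: "?I j A \<in> borel_measurable (lebesgue_on \<Omega>)" "?I j (- A) \<in> borel_measurable (lebesgue_on \<Omega>)" for j
    using layer_measurable(2)[OF f A] layer_measurable(2)[OF f A'] by auto
  have "(\<Sum>j=1..M. layer_mass \<Omega> M nv b s m j i A + layer_mass \<Omega> M nv b s m j i (- A))
     = (\<integral>\<^sup>+x. (\<Sum>j=1..M. ?c x * ?I j A x + ?c x * ?I j (- A) x) \<partial>lebesgue_on \<Omega>)"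
    unfolding layer_mass_def by (rule nn_integral_sum_add) measurable
  also have "\<dots> \<le> (\<integral>\<^sup>+x. ?c x \<partial>lebesgue_on \<Omega>)"
  proof (rule nn_integral_mono_AE)
    show "AE x in lebesgue_on \<Omega>. (\<Sum>j=1..M. ?c x * ?I j A x + ?c x * ?I j (- A) x) \<le> ?c x"
      using R unfolding RSC_def
    proof eventually_elim
      case (elim x)
      then obtain k where k: "k \<in> {1..M}" "m x = nv k" by blast
      have "(\<Sum>j=1..M. ?c x * ?I j A x + ?c x * ?I j (- A) x) = (\<Sum>j=1..M. if j = k then ?c x else 0)"
        using k slip_normals_inj[OF S _ k(1)] by (intro sum.cong) (auto simp: indicator_def)
      then show ?case using k(1) by simp
    qed
  qed
  also have "\<dots> = (\<integral>\<^sup>+x\<in>\<Omega>. ?c x \<partial>lebesgue)"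
    using \<Omega> by (subst nn_integral_restrict_space) auto
  finally show ?thesis .
qed

lemma laminated_slip_measurable:
  assumes S: "slip_systems M nv b" and \<Omega>: "\<Omega> \<in> sets lebesgue" and f: "slip_field \<Omega> s m" and R: "RSC \<Omega> M nv s m"
    and L: "\<And>j. L j \<in> sets borel"
  shows "slip_field \<Omega> (laminated_slip M nv b L K s m) m"
proof -
  have [measurable]: "m \<in> borel_measurable (lebesgue_on \<Omega>)" using f by (auto simp: slip_field_def)
  have "(\<lambda>x. x \<bullet> n) \<in> borel_measurable lebesgue" for n :: "real^3" by (rule measurable_completion) simp
  then have [measurable]: "(\<lambda>x. x \<bullet> n) \<in> borel_measurable (lebesgue_on \<Omega>)" for n :: "real^3" by (rule measurable_restrict_space1)
  note L[measurable]
  have [measurable]: "slip_coeff M nv b s m 1 \<in> borel_measurable (lebesgue_on \<Omega>)" "slip_coeff M nv b s m 2 \<in> borel_measurable (lebesgue_on \<Omega>)"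
    using slip_coeff_measurable[OF S \<Omega> f R] by auto
  have [measurable]: "soft_cap K \<in> borel_measurable borel" unfolding soft_cap_def by measurable
  have "laminated_slip M nv b L K s m \<in> borel_measurable (lebesgue_on \<Omega>)"
    unfolding laminated_slip_def by measurable
  then show ?thesis using f by (simp add: slip_field_def)
qed

lemma mass_laminated_slip_le:
  assumes S: "slip_systems M nv b" and \<Omega>: "\<Omega> \<in> sets lebesgue" and f: "slip_field \<Omega> s m" and R: "RSC \<Omega> M nv s m"
    and L: "\<And>j. L j \<in> sets borel" and K: "K > 0"
  shows "(\<integral>\<^sup>+x\<in>\<Omega>. ennreal (norm (laminated_slip M nv b L K s m x \<otimes> m x)) \<partial>lebesgue)
     \<le> (\<Sum>j=1..M. ennreal 2 * layered_mass \<Omega> M nv b s m j (L j))"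
proof -
  let ?c = "\<lambda>i x. ennreal \<bar>slip_coeff M nv b s m i x\<bar>"
  let ?I = "\<lambda>j A x. indicator {x. m x = nv j \<and> x \<bullet> nv j \<in> A} x :: ennreal"
  have [measurable]: "?c 1 \<in> borel_measurable (lebesgue_on \<Omega>)" "?c 2 \<in> borel_measurable (lebesgue_on \<Omega>)"
    using slip_coeff_ennreal_measurable[OF S \<Omega> f R] by auto
  have L': "- L j \<in> sets borel" for j using L[of j] by auto
  have [measurable]: "?I j (L j) \<in> borel_measurable (lebesgue_on \<Omega>)" "?I j (- L j) \<in> borel_measurable (lebesgue_on \<Omega>)" for j
    using layer_measurable(2)[OF f L] layer_measurable(2)[OF f L'] by auto
  have "(\<integral>\<^sup>+x\<in>\<Omega>. ennreal (norm (laminated_slip M nv b L K s m x \<otimes> m x)) \<partial>lebesgue)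
     = (\<integral>\<^sup>+x. ennreal (norm (laminated_slip M nv b L K s m x \<otimes> m x)) \<partial>lebesgue_on \<Omega>)"
    using \<Omega> by (subst nn_integral_restrict_space) auto
  also have "\<dots> \<le> (\<integral>\<^sup>+x. (\<Sum>j=1..M. ennreal 2 * (?c 1 x * ?I j (L j) x + ?c 2 x * ?I j (- L j) x)) \<partial>lebesgue_on \<Omega>)"
  proof (rule nn_integral_mono_AE)
    show "AE x in lebesgue_on \<Omega>. ennreal (norm (laminated_slip M nv b L K s m x \<otimes> m x))
        \<le> (\<Sum>j=1..M. ennreal 2 * (?c 1 x * ?I j (L j) x + ?c 2 x * ?I j (- L j) x))"
      using R unfolding RSC_def
    proof eventually_elim
      case (elim x)
      then obtain k where k: "k \<in> {1..M}" "m x = nv k" by blast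
      note D = slip_systemsD[OF S k(1)]
      have cap: "ennreal (norm ((2 * soft_cap K t) *\<^sub>R w)) \<le> ennreal 2 * ennreal \<bar>t\<bar>" if "norm w = 1" for t and w :: "real^3"
      proof -
        have "ennreal (norm ((2 * soft_cap K t) *\<^sub>R w)) \<le> ennreal (2 * \<bar>t\<bar>)"
          using soft_cap_abs_le[OF K, of t] that by (intro ennreal_leI) (simp add: abs_mult)
        then show ?thesis by (simp only: ennreal_mult'[of 2] zero_le_numeral)
      qed
      have "ennreal (norm (laminated_slip M nv b L K s m x \<otimes> m x)) \<le> ennreal 2 * (?c 1 x * ?I k (L k) x + ?c 2 x * ?I k (- L k) x)"
        using cap[OF D(2), of "slip_coeff M nv b s m 1 x"] cap[OF D(3), of "slip_coeff M nv b s m 2 x"] k(2) D(1)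
        by (simp add: norm_tensor laminated_slip_eq[where m=m and x=x, OF S k] indicator_def)
      also have "\<dots> \<le> (\<Sum>j=1..M. ennreal 2 * (?c 1 x * ?I j (L j) x + ?c 2 x * ?I j (- L j) x))"
        using k(1) by (intro member_le_sum[where f="\<lambda>j. ennreal 2 * (?c 1 x * ?I j (L j) x + ?c 2 x * ?I j (- L j) x)"]) auto
      finally show ?case .
    qed
  qed
  also have "\<dots> = (\<Sum>j=1..M. ennreal 2 * layered_mass \<Omega> M nv b s m j (L j))"
    unfolding layer_mass_def by (rule nn_integral_sum_cmult_add[symmetric]) measurable
  finally show ?thesis .
qed

text \<open>For each index, the costs of the layers \<open>L0\<close> and of the complementary layers add up to at most twice
the laminated cost, because each coefficient is then counted on all heights once, with the factor
two. So one of the two choices costs no more than the laminated quantities.\<close>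

lemma exists_favourable_phase:
  fixes L0 :: "real set"
  assumes S: "slip_systems M nv b" and \<Omega>: "\<Omega> \<in> sets lebesgue" and f: "slip_field \<Omega> s m" and R: "RSC \<Omega> M nv s m"
    and L0: "L0 \<in> sets borel"
  shows "\<exists>L. (\<forall>j. L j \<in> {L0, - L0}) \<and>
    ennreal \<sigma> * (\<Sum>j=1..M. ennreal 2 * layered_tv \<Omega> M nv b s m j (L j))
    + ennreal \<tau> * (\<Sum>j=1..M. ennreal 2 * layered_mass \<Omega> M nv b s m j (L j))
    \<le> ennreal \<sigma> * total_curl_lam \<Omega> M nv b s m + ennreal \<tau> * L1_lam \<Omega> M nv b s m"
proof -
  define P where "P j i A = (\<integral>\<^sup>+t\<in>A. slice_coeff_tv \<Omega> M nv b s m j i t \<partial>lebesgue)" for j i A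
  define Q where "Q j i A = layer_mass \<Omega> M nv b s m j i A" for j i A
  define F where "F j A = ennreal \<sigma> * (ennreal 2 * (P j 1 A + P j 2 (- A))) + ennreal \<tau> * (ennreal 2 * (Q j 1 A + Q j 2 (- A)))" for j A
  define G where "G j = ennreal \<sigma> * (P j 1 L0 + P j 1 (- L0) + (P j 2 L0 + P j 2 (- L0)))
      + ennreal \<tau> * (Q j 1 L0 + Q j 1 (- L0) + (Q j 2 L0 + Q j 2 (- L0)))" for j
  have FG: "F j L0 + F j (- L0) = G j + G j" for j
  proof -
    have "F j A = ennreal \<sigma> * (P j 1 A + P j 2 (- A)) + ennreal \<sigma> * (P j 1 A + P j 2 (- A))
        + (ennreal \<tau> * (Q j 1 A + Q j 2 (- A)) + ennreal \<tau> * (Q j 1 A + Q j 2 (- A)))" for A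
      by (simp add: F_def mult_2 distrib_left)
    then show ?thesis by (simp add: G_def distrib_left ac_simps)
  qed
  have "\<exists>A\<in>{L0, - L0}. F j A \<le> G j" for j
  proof (rule ccontr)
    assume "\<not> (\<exists>A\<in>{L0, - L0}. F j A \<le> G j)"
    then have "G j < F j L0" "G j < F j (- L0)" by auto
    then have "G j + G j < F j L0 + F j (- L0)" by (rule add_strict_mono)
    then show False by (simp add: FG)
  qed
  then obtain L where L: "\<And>j. L j \<in> {L0, - L0}" "\<And>j. F j (L j) \<le> G j" by metis
  have "ennreal \<sigma> * (\<Sum>j=1..M. ennreal 2 * (P j 1 (L j) + P j 2 (- L j))) + ennreal \<tau> * (\<Sum>j=1..M. ennreal 2 * (Q j 1 (L j) + Q j 2 (- L j)))
      = (\<Sum>j=1..M. F j (L j))"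
    by (simp only: F_def sum.distrib sum_distrib_left)
  also have "\<dots> \<le> (\<Sum>j=1..M. G j)" by (intro sum_mono L)
  also have "\<dots> = ennreal \<sigma> * (\<Sum>j=1..M. P j 1 L0 + P j 1 (- L0) + (P j 2 L0 + P j 2 (- L0)))
      + ennreal \<tau> * ((\<Sum>j=1..M. Q j 1 L0 + Q j 1 (- L0)) + (\<Sum>j=1..M. Q j 2 L0 + Q j 2 (- L0)))"
    by (simp only: G_def sum.distrib sum_distrib_left distrib_left add.assoc)
  also have "\<dots> \<le> ennreal \<sigma> * total_curl_lam \<Omega> M nv b s m + ennreal \<tau> * L1_lam \<Omega> M nv b s m"
  proof (intro add_mono mult_left_mono)
    have two: "{1..2::nat} = {1, 2}" by auto
    show "(\<Sum>j=1..M. P j 1 L0 + P j 1 (- L0) + (P j 2 L0 + P j 2 (- L0))) \<le> total_curl_lam \<Omega> M nv b s m"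
      unfolding total_curl_lam_def planar_curl_lam_def two P_def slice_coeff_tv_def[symmetric]
      by (simp add: sum_mono add_mono nn_integral_split_le_arbitrary)
    show "(\<Sum>j=1..M. Q j 1 L0 + Q j 1 (- L0)) + (\<Sum>j=1..M. Q j 2 L0 + Q j 2 (- L0)) \<le> L1_lam \<Omega> M nv b s m"
      unfolding L1_lam_def two Q_def
      using add_mono[OF sum_layer_mass_le[OF S \<Omega> f R _ L0, of 1] sum_layer_mass_le[OF S \<Omega> f R _ L0, of 2]] by simp
  qed simp_all
  finally show ?thesis using L(1) unfolding P_def Q_def by blast
qed

section \<open>Elastic energy of the laminate\<close>

abbreviation square_integral :: "(real^3) set \<Rightarrow> (real^3 \<Rightarrow> 'b::euclidean_space) \<Rightarrow> ennreal" where
  "square_integral S f \<equiv> \<integral>\<^sup>+x. ennreal ((norm (f x))\<^sup>2) \<partial>lebesgue_on S"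

lemma borel_measurable_tensor:
  assumes "f \<in> borel_measurable N" "g \<in> borel_measurable N"
  shows "(\<lambda>x. f x \<otimes> g x) \<in> borel_measurable N"
proof (rule borel_measurable_continuous_Pair[OF assms])
  show "continuous_on UNIV (\<lambda>x. fst x \<otimes> snd x)"
    unfolding tensor_def
    by (intro continuous_on_vec_lambda continuous_on_mult continuous_on_component continuous_intros)
qed

lemma square_add_le:
  fixes p r t :: real
  assumes "t > 0"
  shows "(p + r)\<^sup>2 \<le> (1 + t) * p\<^sup>2 + (1 + 1 / t) * r\<^sup>2"
proof -
  have "0 \<le> (t * p - r)\<^sup>2 / t" using assms by simp
  also have "\<dots> = t * p\<^sup>2 - 2 * p * r + r\<^sup>2 / t"
    using assms by (simp add: power2_eq_square field_simps)
  finally show ?thesis by (simp add: power2_eq_square algebra_simps)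
qed

text \<open>The elastic energy bounds the symmetric part of \<open>\<nabla>u - s \<otimes> m\<close> and \<open>u \<in> H1\<close> bounds that of \<open>\<nabla>u\<close>, hence
that of \<open>s \<otimes> m\<close>, which has the size of \<open>s\<close>.\<close>

lemma L2_on_slip:
  assumes S: "slip_systems M nv b" and \<Omega>: "open \<Omega>" and u: "u \<in> H1 \<Omega>" and f: "slip_field \<Omega> s m"
    and R: "RSC \<Omega> M nv s m" and E: "elastic_energy \<Omega> u s m < \<infinity>"
  shows "L2_on \<Omega> s"
proof -
  have \<Omega>l: "\<Omega> \<in> sets lebesgue" using \<Omega> by auto
  have ms: "s \<in> borel_measurable (lebesgue_on \<Omega>)" "m \<in> borel_measurable (lebesgue_on \<Omega>)"
    using f by (auto simp: slip_field_def)
  have wg: "L2_on \<Omega> (weak_grad \<Omega> u)" using weak_grad_works[OF u] by (simp add: has_weak_gradient_def)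
  have mt: "(\<lambda>x. s x \<otimes> m x) \<in> borel_measurable (lebesgue_on \<Omega>)" by (rule borel_measurable_tensor[OF ms])
  have mwg: "weak_grad \<Omega> u \<in> borel_measurable (lebesgue_on \<Omega>)" using wg by (simp add: L2_on_def)
  have mP: "(\<lambda>x. sym_part (weak_grad \<Omega> u x - s x \<otimes> m x)) \<in> borel_measurable (lebesgue_on \<Omega>)"
    by (rule measurable_compose[OF borel_measurable_diff[OF mwg mt]
      borel_measurable_continuous_onI[OF linear_continuous_on[OF bounded_linear_sym_part]]])
  have P: "L2_on \<Omega> (\<lambda>x. sym_part (weak_grad \<Omega> u x - s x \<otimes> m x))"
    using E mP \<Omega>l by (simp add: L2_on_iff elastic_energy_def)
  have "L2_on \<Omega> (\<lambda>x. sym_part (weak_grad \<Omega> u x) - sym_part (weak_grad \<Omega> u x - s x \<otimes> m x))"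
    by (intro L2_on_diff P L2_on_bounded_linear[OF wg bounded_linear_sym_part])
  then have "L2_on \<Omega> (\<lambda>x. sym_part (s x \<otimes> m x))"
    by (simp add: linear_diff[OF bounded_linear.linear[OF bounded_linear_sym_part]])
  from L2_on_bounded_linear[OF this bounded_linear_scaleR_right[of "sqrt 2"]]
  show ?thesis
  proof (rule L2_on_bound[OF _ ms(1)])
    show "AE x in lebesgue_on \<Omega>. norm (s x) \<le> norm (sqrt 2 *\<^sub>R sym_part (s x \<otimes> m x))"
      using R unfolding RSC_def
    proof eventually_elim
      case (elim x)
      then obtain k where "k \<in> {1..M}" "m x = nv k" "s x \<bullet> nv k = 0" by blast
      then show ?case using norm_sym_part_tensor[of "nv k" "s x"] slip_systemsD(1)[OF S] by simp
    qed
  qed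
qed

lemma slip_coeff_L2_on:
  assumes S: "slip_systems M nv b" and \<Omega>: "\<Omega> \<in> sets lebesgue" and f: "slip_field \<Omega> s m"
    and R: "RSC \<Omega> M nv s m" and s: "L2_on \<Omega> s" and i: "i \<in> {1, 2}"
  shows "L2_on \<Omega> (slip_coeff M nv b s m i)"
proof -
  obtain C where C: "C > 0"
    "\<And>s m x i j. j \<in> {1..M} \<Longrightarrow> m x = nv j \<Longrightarrow> s x \<bullet> nv j = 0 \<Longrightarrow> i \<in> {1,2} \<Longrightarrow> \<bar>slip_coeff M nv b s m i x\<bar> \<le> C * norm (s x)"
    using slip_coeff_bound[OF S] by blast
  from L2_on_bounded_linear[OF s bounded_linear_scaleR_right[of C]]
  show ?thesis
  proof (rule L2_on_bound[OF _ slip_coeff_measurable[OF S \<Omega> f R i]])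
    show "AE x in lebesgue_on \<Omega>. norm (slip_coeff M nv b s m i x) \<le> norm (C *\<^sub>R s x)"
      using R unfolding RSC_def
    proof eventually_elim
      case (elim x)
      then obtain k where "k \<in> {1..M}" "m x = nv k" "s x \<bullet> nv k = 0" by blast
      then show ?case using C(2)[where m=m and s=s and x=x, OF _ _ _ i] C(1) by simp
    qed
  qed
qed

text \<open>The new strain is the old one plus the symmetric part of the residual \<open>\<nabla>w - (s' - s) \<otimes> m\<close>; Young's inequality separates
the two.\<close>

lemma elastic_energy_perturbation:
  assumes \<Omega>: "open \<Omega>" and u: "u \<in> H1 \<Omega>" and f: "slip_field \<Omega> s m"
    and E: "elastic_energy \<Omega> u s m < \<infinity>" and e: "e > (0::real)"
  shows "\<exists>\<eta>>0. \<forall>w s'. w \<in> C1c \<Omega> \<longrightarrow> slip_field \<Omega> s' m \<longrightarrow>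
    (square_integral \<Omega> (\<lambda>x. jacobian_matrix w x - (s' x - s x) \<otimes> m x)) \<le> ennreal \<eta> \<longrightarrow>
    elastic_energy \<Omega> (\<lambda>x. u x + w x) s' m \<le> elastic_energy \<Omega> u s m + ennreal e"
proof -
  have \<Omega>l: "\<Omega> \<in> sets lebesgue" using \<Omega> by auto
  define E0 where "E0 = enn2real (elastic_energy \<Omega> u s m)"
  have E0: "elastic_energy \<Omega> u s m = ennreal E0" "E0 \<ge> 0" using E by (auto simp: E0_def)
  \<comment> \<open>half of \<open>e\<close> is spent on the factor \<open>1 + t\<close>, the other half on the residual\<close>
  define t where "t = e / (2 * (E0 + 1))"
  have t: "t > 0" using e E0 by (simp add: t_def)
  define \<eta> where "\<eta> = (e / 2) / (1 + 1 / t)"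
  have \<eta>: "\<eta> > 0" using e t by (simp add: \<eta>_def add_pos_pos)
  have eq: "elastic_energy \<Omega> v r m = (square_integral \<Omega> (\<lambda>x. sym_part (weak_grad \<Omega> v x - r x \<otimes> m x)))" for v r
    unfolding elastic_energy_def using \<Omega>l by (subst nn_integral_restrict_space) auto
  have mP: "(\<lambda>x. ennreal ((norm (sym_part (weak_grad \<Omega> u x - s x \<otimes> m x)))\<^sup>2)) \<in> borel_measurable (lebesgue_on \<Omega>)"
  proof -
    have ms: "s \<in> borel_measurable (lebesgue_on \<Omega>)" "m \<in> borel_measurable (lebesgue_on \<Omega>)"
      using f by (auto simp: slip_field_def)
    have mwg: "weak_grad \<Omega> u \<in> borel_measurable (lebesgue_on \<Omega>)"
      using weak_grad_works[OF u] by (simp add: has_weak_gradient_def L2_on_def)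
    have "(\<lambda>x. sym_part (weak_grad \<Omega> u x - s x \<otimes> m x)) \<in> borel_measurable (lebesgue_on \<Omega>)"
      by (rule measurable_compose[OF borel_measurable_diff[OF mwg borel_measurable_tensor[OF ms]]
        borel_measurable_continuous_onI[OF linear_continuous_on[OF bounded_linear_sym_part]]])
    then show ?thesis by measurable
  qed
  have "elastic_energy \<Omega> (\<lambda>x. u x + w x) s' m \<le> elastic_energy \<Omega> u s m + ennreal e"
    if w: "w \<in> C1c \<Omega>" and s': "slip_field \<Omega> s' m"
      and small: "(square_integral \<Omega> (\<lambda>x. jacobian_matrix w x - (s' x - s x) \<otimes> m x)) \<le> ennreal \<eta>" for w s'
  proof -
    let ?P = "\<lambda>x. sym_part (weak_grad \<Omega> u x - s x \<otimes> m x)" and ?R = "\<lambda>x. jacobian_matrix w x - (s' x - s x) \<otimes> m x"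
    have mR: "(\<lambda>x. ennreal ((norm (?R x))\<^sup>2)) \<in> borel_measurable (lebesgue_on \<Omega>)"
    proof -
      have ms: "(\<lambda>x. s' x - s x) \<in> borel_measurable (lebesgue_on \<Omega>)" "m \<in> borel_measurable (lebesgue_on \<Omega>)"
        using f s' by (auto simp: slip_field_def)
      have mj: "jacobian_matrix w \<in> borel_measurable (lebesgue_on \<Omega>)"
        using C1c_has_weak_gradient[OF \<Omega> w] by (simp add: has_weak_gradient_def L2_on_def)
      have "?R \<in> borel_measurable (lebesgue_on \<Omega>)"
        by (rule borel_measurable_diff[OF mj borel_measurable_tensor[OF ms]])
      then show ?thesis by measurable
    qed
    have "elastic_energy \<Omega> (\<lambda>x. u x + w x) s' m \<le>
       (\<integral>\<^sup>+x. ennreal (1 + t) * ennreal ((norm (?P x))\<^sup>2) + ennreal (1 + 1 / t) * ennreal ((norm (?R x))\<^sup>2) \<partial>lebesgue_on \<Omega>)"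
      unfolding eq
    proof (rule nn_integral_mono_AE)
      show "AE x in lebesgue_on \<Omega>. ennreal ((norm (sym_part (weak_grad \<Omega> (\<lambda>x. u x + w x) x - s' x \<otimes> m x)))\<^sup>2)
         \<le> ennreal (1 + t) * ennreal ((norm (?P x))\<^sup>2) + ennreal (1 + 1 / t) * ennreal ((norm (?R x))\<^sup>2)"
        using weak_grad_add_C1c[OF \<Omega> u w]
      proof eventually_elim
        case (elim x)
        have "weak_grad \<Omega> (\<lambda>x. u x + w x) x - s' x \<otimes> m x = (weak_grad \<Omega> u x - s x \<otimes> m x) + ?R x"
          unfolding elim by (simp add: tensor_linear_left)
        then have "sym_part (weak_grad \<Omega> (\<lambda>x. u x + w x) x - s' x \<otimes> m x) = ?P x + sym_part (?R x)"
          by (simp add: linear_add[OF bounded_linear.linear[OF bounded_linear_sym_part]])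
        then have "norm (sym_part (weak_grad \<Omega> (\<lambda>x. u x + w x) x - s' x \<otimes> m x)) \<le> norm (?P x) + norm (?R x)"
          using norm_triangle_ineq[of "?P x" "sym_part (?R x)"] norm_sym_part_le[of "?R x"] by simp
        then have "(norm (sym_part (weak_grad \<Omega> (\<lambda>x. u x + w x) x - s' x \<otimes> m x)))\<^sup>2 \<le> (norm (?P x) + norm (?R x))\<^sup>2"
          by (rule power_mono) simp
        also have "\<dots> \<le> (1 + t) * (norm (?P x))\<^sup>2 + (1 + 1 / t) * (norm (?R x))\<^sup>2"
          by (rule square_add_le[OF t])
        finally have "ennreal ((norm (sym_part (weak_grad \<Omega> (\<lambda>x. u x + w x) x - s' x \<otimes> m x)))\<^sup>2)
           \<le> ennreal ((1 + t) * (norm (?P x))\<^sup>2 + (1 + 1 / t) * (norm (?R x))\<^sup>2)" by (rule ennreal_leI)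
        then show ?case using t by (simp add: ennreal_mult)
      qed
    qed
    also have "\<dots> = ennreal (1 + t) * elastic_energy \<Omega> u s m + ennreal (1 + 1 / t) * (square_integral \<Omega> (\<lambda>x. ?R x))"
      unfolding eq using mP mR by (simp add: nn_integral_add nn_integral_cmult)
    also have "\<dots> \<le> ennreal (1 + t) * ennreal E0 + ennreal (1 + 1 / t) * ennreal \<eta>"
      unfolding E0(1) using small by (intro add_mono mult_left_mono) auto
    also have "\<dots> = ennreal ((1 + t) * E0 + (1 + 1 / t) * \<eta>)"
      using t E0(2) \<eta> by (simp add: ennreal_mult)
    also have "\<dots> \<le> ennreal (E0 + e)"
    proof (rule ennreal_leI)
      have "t * E0 \<le> e / 2"
      proof -
        have "t * E0 = (e / 2) * (E0 / (E0 + 1))" by (simp add: t_def)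
        also have "\<dots> \<le> (e / 2) * 1" using e E0(2) by (intro mult_left_mono) auto
        finally show ?thesis by simp
      qed
      moreover have "(1 + 1 / t) * \<eta> = e / 2"
      proof -
        have "1 + 1 / t \<noteq> 0" using t by (simp add: add_pos_pos less_imp_neq[symmetric])
        moreover have "q * ((e / 2) / q) = e / 2" if "q \<noteq> 0" for q using that by simp
        ultimately show ?thesis unfolding \<eta>_def by blast
      qed
      ultimately show "(1 + t) * E0 + (1 + 1 / t) * \<eta> \<le> E0 + e" by (simp add: distrib_right)
    qed
    also have "\<dots> = elastic_energy \<Omega> u s m + ennreal e" using E0 e by simp
    finally show ?thesis .
  qed
  then show ?thesis using \<eta> by blast
qed

definition phase_sign :: "real \<Rightarrow> real \<Rightarrow> real \<Rightarrow> real" where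
  "phase_sign N \<kappa> t = \<kappa> * (if sin (N * t) > 0 then 1 else - 1)"

abbreviation phase_layers :: "real \<Rightarrow> (nat \<Rightarrow> real) \<Rightarrow> nat \<Rightarrow> real set" where
  "phase_layers N \<kappa> \<equiv> \<lambda>j. {t. phase_sign N (\<kappa> j) t = 1}"

lemma phase_sign_cases: "\<kappa> \<in> {1, - 1} \<Longrightarrow> phase_sign N \<kappa> t = 1 \<or> phase_sign N \<kappa> t = - 1"
  by (auto simp: phase_sign_def)

text \<open>The leading term of the gradient has the rank-one form \<open>_ \<otimes> n\<close>, as does the oscillation of the slip
field; the second term is small with \<open>W\<close>.\<close>

lemma profile_times_C1c:
  fixes W W' :: "real \<Rightarrow> real" and n :: "real^3" and f :: "real^3 \<Rightarrow> real^3"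
  assumes W: "\<And>t. (W has_real_derivative W' t) (at t)" "continuous_on UNIV W'" and f: "f \<in> C1c U"
  shows "(\<lambda>x. W (x \<bullet> n) *\<^sub>R f x) \<in> C1c U"
    and "jacobian_matrix (\<lambda>x. W (x \<bullet> n) *\<^sub>R f x) x = W' (x \<bullet> n) *\<^sub>R (f x \<otimes> n) + W (x \<bullet> n) *\<^sub>R jacobian_matrix f x"
proof -
  have "C1_map (\<lambda>x::real^3. x)" by (rule C1_mapI[where f'="\<lambda>x v. v"]) auto
  from C1_map_linear[OF bounded_linear_inner_left this]
  have c1: "C1_map (\<lambda>x. x \<bullet> n)" .
  have c: "C1_map (\<lambda>x. W (x \<bullet> n))" by (rule C1_map_compose_real[OF c1 W])
  show "(\<lambda>x. W (x \<bullet> n) *\<^sub>R f x) \<in> C1c U" by (rule C1c_scaleR_C1_map[OF c f])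
  have "((\<lambda>x. x \<bullet> n) has_derivative (\<lambda>v. v \<bullet> n)) (at x)"
    by (auto intro!: derivative_eq_intros)
  from has_derivative_compose[OF this W(1)[of "x \<bullet> n", unfolded has_field_derivative_def]]
  have "((\<lambda>x. W (x \<bullet> n)) has_derivative (\<lambda>v. W' (x \<bullet> n) * (v \<bullet> n))) (at x)" by simp
  from frechet_derivative_at[OF this, symmetric]
  have d: "frechet_derivative (\<lambda>x. W (x \<bullet> n)) (at x) = (\<lambda>v. W' (x \<bullet> n) * (v \<bullet> n))" .
  show "jacobian_matrix (\<lambda>x. W (x \<bullet> n) *\<^sub>R f x) x = W' (x \<bullet> n) *\<^sub>R (f x \<otimes> n) + W (x \<bullet> n) *\<^sub>R jacobian_matrix f x"
    unfolding jacobian_matrix_def frechet_derivative_scaleR_C1[OF c C1c_C1_map[OF f]] d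
    by (simp add: vec_eq_iff tensor_def inner_axis' ac_simps)
qed

lemma jacobian_matrix_sum:
  assumes "\<And>j. j \<in> J \<Longrightarrow> C1_map (w j)"
  shows "jacobian_matrix (\<lambda>x. \<Sum>j\<in>J. w j x) x = (\<Sum>j\<in>J. jacobian_matrix (w j) x)"
proof -
  have "((\<lambda>x. \<Sum>j\<in>J. w j x) has_derivative (\<lambda>v. \<Sum>j\<in>J. frechet_derivative (w j) (at x) v)) (at x)"
    by (intro has_derivative_sum C1_map_has_derivative assms)
  from frechet_derivative_at[OF this, symmetric] show ?thesis
    by (simp add: jacobian_matrix_def vec_eq_iff sum_component)
qed

lemma nn_integral_lebesgue_on_le:
  fixes h :: "'a::euclidean_space \<Rightarrow> ennreal"
  assumes "S \<in> sets lebesgue"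
  shows "(\<integral>\<^sup>+x. h x \<partial>lebesgue_on S) \<le> (\<integral>\<^sup>+x. h x \<partial>lebesgue)"
  using assms by (subst nn_integral_restrict_space) (auto intro!: nn_integral_mono simp: indicator_def)

lemma borel_measurable_lebesgue_onI:
  fixes h :: "'a::euclidean_space \<Rightarrow> 'b::topological_space"
  shows "h \<in> borel_measurable borel \<Longrightarrow> h \<in> borel_measurable (lebesgue_on S)"
  by (intro measurable_restrict_space1 measurable_completion) simp

text \<open>The residual has four parts: the error of the test fields \<open>h\<close> in approximating the oscillation \<open>F\<close>, the
term \<open>W \<nabla>h\<close>, the rounding of the square wave, and the truncation error. Accordingly \<open>h\<close> is chosen
first, then the frequency \<open>N\<close> depending on \<open>h\<close>, and last the profile depending on \<open>N\<close> and \<open>\<kappa>\<close>. The signs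
\<open>\<kappa>\<close> are quantified after \<open>K\<close> and \<open>N\<close>, because the favourable phase is only known once the layers are.\<close>

lemma laminate_corrector_exists:
  assumes S: "slip_systems M nv b" and \<Omega>: "open \<Omega>" and f: "slip_field \<Omega> s m" and R: "RSC \<Omega> M nv s m"
    and s: "L2_on \<Omega> s" and \<eta>: "\<eta> > (0::real)"
  shows "\<exists>K>0. \<exists>N>0. \<forall>\<kappa>. (\<forall>j. \<kappa> j \<in> {1, - 1}) \<longrightarrow> (\<exists>w\<in>C1c \<Omega>.
    (square_integral \<Omega> (\<lambda>x. jacobian_matrix w x -
       (laminated_slip M nv b (phase_layers N \<kappa>) K s m x - s x) \<otimes> m x)) \<le> ennreal \<eta>)"
proof -
  have \<Omega>l: "\<Omega> \<in> sets lebesgue" using \<Omega> by auto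
  define c where "c i = slip_coeff M nv b s m i" for i
  have cL2: "L2_on \<Omega> (c 1)" "L2_on \<Omega> (c 2)"
    unfolding c_def using slip_coeff_L2_on[OF S \<Omega>l f R s] by auto
  have cm: "c 1 \<in> borel_measurable (lebesgue_on \<Omega>)" "c 2 \<in> borel_measurable (lebesgue_on \<Omega>)"
    using cL2 by (auto simp: L2_on_def)
  have mm[measurable]: "m \<in> borel_measurable (lebesgue_on \<Omega>)" using f by (auto simp: slip_field_def)
  \<comment> \<open>with \<open>\<delta>\<close> bounding each of the \<open>3 M + 2\<close> error integrals, the final sum is \<open>64 M\<^sup>2 * 3 M \<delta> + 64 * 2 \<delta>\<close>\<close>
  define \<delta> where "\<delta> = \<eta> / (192 * real M ^ 3 + 128)"
  have dpos: "192 * real M ^ 3 + 128 > 0" by (intro add_nonneg_pos) auto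
  have \<delta>: "\<delta> > 0" using \<eta> dpos by (simp add: \<delta>_def)
  define g where "g j x = c 1 x *\<^sub>R b 1 j - c 2 x *\<^sub>R b 2 j" for j x
  define F where "F j x = (if x \<in> \<Omega> \<and> m x = nv j then g j x else 0)" for j x
  have "\<exists>h\<in>C1c \<Omega>. (\<integral>\<^sup>+x. ennreal ((norm (F j x - h x))\<^sup>2) \<partial>lebesgue) < ennreal \<delta>" for j
  proof -
    have gL2: "L2_on \<Omega> (g j)"
      unfolding g_def by (intro L2_on_diff L2_on_bounded_linear[OF _ bounded_linear_scaleR_left] cL2)
    have gm[measurable]: "g j \<in> borel_measurable (lebesgue_on \<Omega>)" using gL2 by (simp add: L2_on_def)
    have L2: "L2_on \<Omega> (\<lambda>x. if m x = nv j then g j x else 0)"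
    proof (rule L2_on_bound[OF gL2])
      show "(\<lambda>x. if m x = nv j then g j x else 0) \<in> borel_measurable (lebesgue_on \<Omega>)" by measurable
    qed auto
    have F: "F j x = indicator \<Omega> x *\<^sub>R (if m x = nv j then g j x else 0)" for x by (simp add: F_def)
    have Fm: "F j \<in> borel_measurable lebesgue"
      unfolding F using L2 \<Omega>l by (simp add: L2_on_def borel_measurable_restrict_space_iff)
    have "(\<integral>\<^sup>+x. ennreal (norm (F j x) ^ 2) \<partial>lebesgue) = (\<integral>\<^sup>+x\<in>\<Omega>. ennreal ((norm (if m x = nv j then g j x else 0))\<^sup>2) \<partial>lebesgue)"
      by (intro nn_integral_cong) (auto simp: F_def indicator_def)
    also have "\<dots> < \<infinity>" using L2 \<Omega>l by (simp add: L2_on_iff)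
    finally show ?thesis using C1c_dense_Lp[OF Fm _ _ \<delta> \<Omega>, of 2] by (simp add: F_def)
  qed
  then have "\<forall>j. \<exists>h. h \<in> C1c \<Omega> \<and> (\<integral>\<^sup>+x. ennreal ((norm (F j x - h x))\<^sup>2) \<partial>lebesgue) < ennreal \<delta>"
    by blast
  from choice[OF this] obtain h where h: "\<And>j. h j \<in> C1c \<Omega>" "\<And>j. (\<integral>\<^sup>+x. ennreal ((norm (F j x - h j x))\<^sup>2) \<partial>lebesgue) < ennreal \<delta>"
    by blast
  have Jfin: "(square_integral \<Omega> (\<lambda>x. jacobian_matrix (h j) x)) < \<infinity>" for j
  proof -
    have "L2_on \<Omega> (jacobian_matrix (h j))"
      using C1c_has_weak_gradient[OF \<Omega> h(1)] by (simp add: has_weak_gradient_def)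
    then show ?thesis by (simp add: L2_on_def integrable_iff_bounded)
  qed
  define D where "D j = enn2real (square_integral \<Omega> (\<lambda>x. jacobian_matrix (h j) x))" for j
  have D: "(square_integral \<Omega> (\<lambda>x. jacobian_matrix (h j) x)) = ennreal (D j)" "D j \<ge> 0" for j
    using Jfin[of j] by (auto simp: D_def)
  define D0 where "D0 = (\<Sum>j=1..M. D j)"
  have D0: "D0 \<ge> 0" "\<And>j. j \<in> {1..M} \<Longrightarrow> D j \<le> D0"
    unfolding D0_def using D(2) by (auto intro: sum_nonneg member_le_sum)
  \<comment> \<open>\<open>|W| \<le> 2 / N\<close> gives \<open>\<integral> |W \<nabla>h|\<^sup>2 \<le> (2 / N)\<^sup>2 D0\<close>, and \<open>N \<ge> 1\<close> gives \<open>N \<le> N\<^sup>2\<close>\<close>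
  define N where "N = 4 * D0 / \<delta> + 1"
  have N: "N \<ge> 1" using D0(1) \<delta> by (simp add: N_def)
  have ND: "(2 / N)\<^sup>2 * D0 \<le> \<delta>"
  proof -
    have "4 * D0 \<le> \<delta> * N" using \<delta> by (simp add: N_def distrib_left)
    also have "\<dots> \<le> \<delta> * N\<^sup>2"
      using N \<delta> by (intro mult_left_mono) (auto simp: power2_eq_square)
    finally show ?thesis using N by (simp add: power_divide divide_le_eq)
  qed
  define T where "T k i x = ennreal ((norm (soft_cap (real (Suc k)) (c i x) - c i x))\<^sup>2)" for k i x
  have "\<forall>\<^sub>F k in sequentially. (\<integral>\<^sup>+x. T k 1 x \<partial>lebesgue_on \<Omega>) < ennreal \<delta> \<and> (\<integral>\<^sup>+x. T k 2 x \<partial>lebesgue_on \<Omega>) < ennreal \<delta>"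
    unfolding T_def using \<delta> 
    by (intro eventually_conj order_tendstoD(2)[OF soft_cap_L2_close[OF cL2(1) \<Omega>l]] order_tendstoD(2)[OF soft_cap_L2_close[OF cL2(2) \<Omega>l]]) auto
  then obtain k where k: "(\<integral>\<^sup>+x. T k 1 x \<partial>lebesgue_on \<Omega>) < ennreal \<delta>" "(\<integral>\<^sup>+x. T k 2 x \<partial>lebesgue_on \<Omega>) < ennreal \<delta>"
    by (auto simp: eventually_sequentially)
  define K where "K = real (Suc k)"
  have K: "K > 0" by (simp add: K_def)
  have "\<exists>w\<in>C1c \<Omega>. (square_integral \<Omega> (\<lambda>x. jacobian_matrix w x -
       (laminated_slip M nv b (phase_layers N \<kappa>) K s m x - s x) \<otimes> m x)) \<le> ennreal \<eta>"
    if \<kappa>: "\<forall>j. \<kappa> j \<in> {1, - 1}" for \<kappa> :: "nat \<Rightarrow> real"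
  proof -
    define \<theta> where "\<theta> j x = phase_sign N (\<kappa> j) (x \<bullet> nv j)" for j and x :: "real^3"
    have "\<forall>j\<in>{1..M}. \<exists>V. (\<forall>t. (fst V has_real_derivative snd V t) (at t)) \<and> continuous_on UNIV (snd V) \<and> (\<forall>t. \<bar>fst V t\<bar> \<le> 2 / N) \<and>
       (\<integral>\<^sup>+x. ennreal ((norm ((snd V (x \<bullet> nv j) - \<theta> j x) *\<^sub>R h j x))\<^sup>2) \<partial>lebesgue) < ennreal \<delta>"
    proof
      fix j assume j: "j \<in> {1..M}"
      have "N > 0" using N by simp
      from laminate_profile_exists[OF this slip_systemsD(1)[OF S j] h(1) \<delta>, of "\<kappa> j"] \<kappa>
      show "\<exists>V. (\<forall>t. (fst V has_real_derivative snd V t) (at t)) \<and> continuous_on UNIV (snd V) \<and> (\<forall>t. \<bar>fst V t\<bar> \<le> 2 / N) \<and>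
       (\<integral>\<^sup>+x. ennreal ((norm ((snd V (x \<bullet> nv j) - \<theta> j x) *\<^sub>R h j x))\<^sup>2) \<partial>lebesgue) < ennreal \<delta>"
        by (simp add: \<theta>_def phase_sign_def)
    qed
    from bchoice[OF this] obtain V where V: "\<And>j t. j \<in> {1..M} \<Longrightarrow> (fst (V j) has_real_derivative snd (V j) t) (at t)"
      "\<And>j. j \<in> {1..M} \<Longrightarrow> continuous_on UNIV (snd (V j))" "\<And>j t. j \<in> {1..M} \<Longrightarrow> \<bar>fst (V j) t\<bar> \<le> 2 / N"
      "\<And>j. j \<in> {1..M} \<Longrightarrow> (\<integral>\<^sup>+x. ennreal ((norm ((snd (V j) (x \<bullet> nv j) - \<theta> j x) *\<^sub>R h j x))\<^sup>2) \<partial>lebesgue) < ennreal \<delta>"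
      by blast
    define w where "w x = (\<Sum>j=1..M. fst (V j) (x \<bullet> nv j) *\<^sub>R h j x)" for x
    have wj: "(\<lambda>x. fst (V j) (x \<bullet> nv j) *\<^sub>R h j x) \<in> C1c \<Omega>" if "j \<in> {1..M}" for j
      by (rule profile_times_C1c(1)[OF V(1,2)[OF that] h(1)])
    have w: "w \<in> C1c \<Omega>" unfolding w_def by (rule C1c_sum[OF wj])
    have jac: "jacobian_matrix w x = (\<Sum>j=1..M. snd (V j) (x \<bullet> nv j) *\<^sub>R (h j x \<otimes> nv j) + fst (V j) (x \<bullet> nv j) *\<^sub>R jacobian_matrix (h j) x)" for x
      unfolding w_def by (subst jacobian_matrix_sum) 
        (auto intro!: sum.cong profile_times_C1c(2)[OF V(1,2) h(1)] C1c_C1_map[OF wj])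
    define A where "A j x = (norm ((snd (V j) (x \<bullet> nv j) - \<theta> j x) *\<^sub>R h j x))\<^sup>2" for j x
    define B where "B j x = (norm (F j x - h j x))\<^sup>2" for j x
    define J where "J j x = (2 / N)\<^sup>2 * (norm (jacobian_matrix (h j) x))\<^sup>2" for j x
    define e where "e i x = (norm (soft_cap K (c i x) - c i x))\<^sup>2" for i x
    let ?r = "\<lambda>x. jacobian_matrix w x - (laminated_slip M nv b (phase_layers N \<kappa>) K s m x - s x) \<otimes> m x"
    have pw: "AE x in lebesgue_on \<Omega>. (norm (?r x))\<^sup>2 \<le> 64 * (real M)\<^sup>2 * (\<Sum>j=1..M. A j x + B j x + J j x) + 64 * (e 1 x + e 2 x)"
      using R[unfolded RSC_def] AE_space[of "lebesgue_on \<Omega>"]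
    proof eventually_elim
      case (elim x)
      then obtain p where p: "p \<in> {1..M}" "m x = nv p" "s x \<bullet> nv p = 0" and x: "x \<in> \<Omega>" by auto
      note sp = slip_systemsD[OF S p(1)]
      \<comment> \<open>only the truncation error is left of the new slip minus \<open>s\<close> after subtraction of the oscillation\<close>
      define Y where "Y = laminated_slip M nv b (phase_layers N \<kappa>) K s m x - s x - \<theta> p x *\<^sub>R g p x"
      have sx: "s x = c 1 x *\<^sub>R b 1 p + c 2 x *\<^sub>R b 2 p"
        unfolding c_def by (rule slip_coeff_properties(3)[where s=s and m=m and x=x, OF S p])
      have lam: "laminated_slip M nv b (phase_layers N \<kappa>) K s m x =
         (if \<theta> p x = 1 then (2 * soft_cap K (c 1 x)) *\<^sub>R b 1 p else (2 * soft_cap K (c 2 x)) *\<^sub>R b 2 p)"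
        unfolding laminated_slip_eq[where m=m and x=x, OF S p(1,2)] c_def \<theta>_def by simp
      have sq: "(norm ((2 * d) *\<^sub>R v))\<^sup>2 = 4 * (norm d)\<^sup>2" if "norm v = 1" for d and v :: "real^3"
        using that by (simp add: power_mult_distrib)
      have "(norm Y)\<^sup>2 \<le> 4 * (e 1 x + e 2 x)"
      proof (cases "\<theta> p x = 1")
        case True
        have "Y = (2 * (soft_cap K (c 1 x) - c 1 x)) *\<^sub>R b 1 p"
          unfolding Y_def lam using True by (subst sx) (simp add: g_def algebra_simps flip: scaleR_2)
        then have "(norm Y)\<^sup>2 = 4 * e 1 x" by (simp only: sq[OF sp(2)] e_def)
        then show ?thesis by (simp add: e_def)
      next
        case False
        then have "\<theta> p x = - 1" using phase_sign_cases[of "\<kappa> p"] \<kappa> by (auto simp: \<theta>_def)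
        then have "Y = (2 * (soft_cap K (c 2 x) - c 2 x)) *\<^sub>R b 2 p"
          unfolding Y_def lam using False by (subst sx) (simp add: g_def algebra_simps flip: scaleR_2)
        then have "(norm Y)\<^sup>2 = 4 * e 2 x" by (simp only: sq[OF sp(3)] e_def)
        then show ?thesis by (simp add: e_def)
      qed
      then have Y: "(norm (Y \<otimes> m x))\<^sup>2 \<le> 4 * (e 1 x + e 2 x)"
        using sp(1) p(2) by (simp add: norm_tensor)
      have sum\<theta>: "(\<Sum>j=1..M. \<theta> j x *\<^sub>R (F j x \<otimes> nv j)) = (\<theta> p x *\<^sub>R g p x) \<otimes> m x"
      proof -
        have "(\<Sum>j=1..M. \<theta> j x *\<^sub>R (F j x \<otimes> nv j)) = (\<Sum>j=1..M. if j = p then (\<theta> p x *\<^sub>R g p x) \<otimes> m x else 0)"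
        proof (rule sum.cong[OF refl])
          fix j assume j: "j \<in> {1..M}"
          show "\<theta> j x *\<^sub>R (F j x \<otimes> nv j) = (if j = p then (\<theta> p x *\<^sub>R g p x) \<otimes> m x else 0)"
          proof (cases "j = p")
            case True
            then show ?thesis using x p(2) by (simp add: F_def tensor_linear_left)
          next
            case False
            then have "nv p \<noteq> nv j" using slip_normals_inj[OF S p(1) j] by blast
            then show ?thesis using False p(2) by (simp add: F_def tensor_linear_left)
          qed
        qed
        also have "\<dots> = (\<theta> p x *\<^sub>R g p x) \<otimes> m x" using p(1) by simp
        finally show ?thesis .
      qed
      define X where "X j = ((snd (V j) (x \<bullet> nv j) - \<theta> j x) *\<^sub>R h j x) \<otimes> nv j + (- \<theta> j x *\<^sub>R ((F j x - h j x) \<otimes> nv j)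
          + fst (V j) (x \<bullet> nv j) *\<^sub>R jacobian_matrix (h j) x)" for j
      have "?r x = jacobian_matrix w x - (\<Sum>j=1..M. \<theta> j x *\<^sub>R (F j x \<otimes> nv j)) - Y \<otimes> m x"
        unfolding sum\<theta> Y_def by (simp add: tensor_linear_left)
      also have "jacobian_matrix w x - (\<Sum>j=1..M. \<theta> j x *\<^sub>R (F j x \<otimes> nv j)) = (\<Sum>j=1..M. X j)"
        unfolding jac sum_subtractf[symmetric] X_def by (intro sum.cong) (simp_all add: tensor_linear_left algebra_simps)
      finally have r: "?r x = (\<Sum>j=1..M. X j) + - (Y \<otimes> m x)" by simp
      have Xj: "(norm (X j))\<^sup>2 \<le> 16 * (A j x + B j x + J j x)" if j: "j \<in> {1..M}" for j
      proof -
        have n1: "norm (nv j) = 1" by (rule slip_systemsD(1)[OF S j])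
        have t1: "\<bar>\<theta> j x\<bar> = 1" using phase_sign_cases[of "\<kappa> j" N "x \<bullet> nv j"] \<kappa> by (auto simp: \<theta>_def)
        have 1: "(norm (((snd (V j) (x \<bullet> nv j) - \<theta> j x) *\<^sub>R h j x) \<otimes> nv j))\<^sup>2 = A j x"
          by (simp only: A_def norm_tensor n1 mult_1_right)
        have 2: "(norm (- \<theta> j x *\<^sub>R ((F j x - h j x) \<otimes> nv j)))\<^sup>2 = B j x"
          by (simp add: B_def norm_tensor n1 t1)
        have 3: "(norm (fst (V j) (x \<bullet> nv j) *\<^sub>R jacobian_matrix (h j) x))\<^sup>2 \<le> J j x"
          unfolding J_def norm_scaleR power_mult_distrib using V(3)[OF j, of "x \<bullet> nv j"]
          by (intro mult_right_mono power_mono) auto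
        have "(norm (X j))\<^sup>2 \<le> 2\<^sup>2 * (A j x + 2\<^sup>2 * (B j x + J j x))"
          unfolding X_def
          by (intro order_trans[OF norm_add_power_le] mult_left_mono add_mono order_trans[OF norm_add_power_le]) (use 1 2 3 in auto)
        moreover have "A j x \<ge> 0" by (simp add: A_def)
        ultimately show ?thesis by (simp add: algebra_simps)
      qed
      have "(norm (?r x))\<^sup>2 \<le> 2\<^sup>2 * ((norm (\<Sum>j=1..M. X j))\<^sup>2 + (norm (- (Y \<otimes> m x)))\<^sup>2)"
        unfolding r by (rule norm_add_power_le)
      also have "\<dots> \<le> 2\<^sup>2 * ((real M)\<^sup>2 * (\<Sum>j=1..M. 16 * (A j x + B j x + J j x)) + 4 * (e 1 x + e 2 x))"
      proof (intro mult_left_mono add_mono)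
        have "(norm (\<Sum>j=1..M. X j))\<^sup>2 \<le> real (card {1..M}) ^ 2 * (\<Sum>j=1..M. norm (X j) ^ 2)"
          by (rule norm_sum_power_le) auto
        also have "\<dots> \<le> (real M)\<^sup>2 * (\<Sum>j=1..M. 16 * (A j x + B j x + J j x))"
          unfolding card_atLeastAtMost diff_Suc_1 by (intro mult_left_mono sum_mono Xj) auto
        finally show "(norm (\<Sum>j=1..M. X j))\<^sup>2 \<le> (real M)\<^sup>2 * (\<Sum>j=1..M. 16 * (A j x + B j x + J j x))" .
      qed (use Y in auto)
      also have "\<dots> \<le> 64 * (real M)\<^sup>2 * (\<Sum>j=1..M. A j x + B j x + J j x) + 64 * (e 1 x + e 2 x)"
      proof -
        have "2\<^sup>2 * (a * (16 * q) + 4 * r) \<le> 64 * a * q + 64 * r" if "r \<ge> 0" for a q r :: real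
          using that by simp
        moreover have "e 1 x + e 2 x \<ge> 0" by (simp add: e_def)
        ultimately show ?thesis unfolding sum_distrib_left[symmetric] by blast
      qed
      finally show ?case .
    qed
    have [measurable]: "h j \<in> borel_measurable borel" for j
      using C1_map_continuous[OF C1c_C1_map[OF h(1)]] by (rule borel_measurable_continuous_onI)
    have [measurable]: "phase_sign N a \<in> borel_measurable borel" for a unfolding phase_sign_def by measurable
    have Am: "(\<lambda>x. ennreal (A j x)) \<in> borel_measurable (lebesgue_on \<Omega>)" if "j \<in> {1..M}" for j
    proof (rule borel_measurable_lebesgue_onI)
      have [measurable]: "snd (V j) \<in> borel_measurable borel" using V(2)[OF that] by (rule borel_measurable_continuous_onI)
      show "(\<lambda>x. ennreal (A j x)) \<in> borel_measurable borel" unfolding A_def \<theta>_def by measurable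
    qed
    have Bm: "(\<lambda>x. ennreal (B j x)) \<in> borel_measurable (lebesgue_on \<Omega>)" for j
    proof -
      have [measurable]: "g j \<in> borel_measurable (lebesgue_on \<Omega>)" unfolding g_def using cm by measurable
      have [measurable]: "h j \<in> borel_measurable (lebesgue_on \<Omega>)" by (rule borel_measurable_lebesgue_onI) measurable
      have 1: "(\<lambda>x. if m x = nv j then g j x else 0) \<in> borel_measurable (lebesgue_on \<Omega>)" by measurable
      have "F j \<in> borel_measurable (lebesgue_on \<Omega>)"
        by (rule measurable_cong[THEN iffD1, OF _ 1]) (simp add: F_def)
      then show ?thesis unfolding B_def by measurable
    qed
    have Jm: "(\<lambda>x. ennreal (J j x)) \<in> borel_measurable (lebesgue_on \<Omega>)" for j
    proof (rule borel_measurable_lebesgue_onI)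
      have [measurable]: "jacobian_matrix (h j) \<in> borel_measurable borel"
        using continuous_on_jacobian_matrix[OF C1c_C1_map[OF h(1)]] by (rule borel_measurable_continuous_onI)
      show "(\<lambda>x. ennreal (J j x)) \<in> borel_measurable borel" unfolding J_def by measurable
    qed
    have [measurable]: "soft_cap K \<in> borel_measurable borel" unfolding soft_cap_def by measurable
    have em: "(\<lambda>x. ennreal (e 1 x)) \<in> borel_measurable (lebesgue_on \<Omega>)" "(\<lambda>x. ennreal (e 2 x)) \<in> borel_measurable (lebesgue_on \<Omega>)"
      unfolding e_def using cm by measurable
    have Ai: "(\<integral>\<^sup>+x. ennreal (A j x) \<partial>lebesgue_on \<Omega>) \<le> ennreal \<delta>" if "j \<in> {1..M}" for j
      using order_trans[OF nn_integral_lebesgue_on_le[OF \<Omega>l] less_imp_le[OF V(4)[OF that]]] by (simp add: A_def)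
    have Bi: "(\<integral>\<^sup>+x. ennreal (B j x) \<partial>lebesgue_on \<Omega>) \<le> ennreal \<delta>" for j
      using order_trans[OF nn_integral_lebesgue_on_le[OF \<Omega>l] less_imp_le[OF h(2)]] by (simp add: B_def)
    have Ji: "(\<integral>\<^sup>+x. ennreal (J j x) \<partial>lebesgue_on \<Omega>) \<le> ennreal \<delta>" if "j \<in> {1..M}" for j
    proof -
      have [measurable]: "jacobian_matrix (h j) \<in> borel_measurable (lebesgue_on \<Omega>)"
        using continuous_on_jacobian_matrix[OF C1c_C1_map[OF h(1)]]
        by (intro borel_measurable_lebesgue_onI) (rule borel_measurable_continuous_onI)
      have "(\<integral>\<^sup>+x. ennreal (J j x) \<partial>lebesgue_on \<Omega>) = ennreal ((2 / N)\<^sup>2) * ennreal (D j)"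
        unfolding J_def D(1)[symmetric] by (subst nn_integral_cmult[symmetric]) (simp_all add: ennreal_mult)
      also have "\<dots> = ennreal ((2 / N)\<^sup>2 * D j)" using D(2) by (simp add: ennreal_mult)
      also have "\<dots> \<le> ennreal \<delta>"
        using order_trans[OF mult_left_mono[OF D0(2)[OF that]] ND] by (intro ennreal_leI) simp
      finally show ?thesis .
    qed
    have ei: "(\<integral>\<^sup>+x. ennreal (e 1 x) \<partial>lebesgue_on \<Omega>) \<le> ennreal \<delta>" "(\<integral>\<^sup>+x. ennreal (e 2 x) \<partial>lebesgue_on \<Omega>) \<le> ennreal \<delta>"
      using k unfolding T_def e_def K_def by auto
    have nn: "A j x \<ge> 0" "B j x \<ge> 0" "J j x \<ge> 0" "e i x \<ge> 0" for i j x
      by (simp_all add: A_def B_def J_def e_def)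
    have "(square_integral \<Omega> (\<lambda>x. ?r x))
       \<le> (\<integral>\<^sup>+x. ennreal (64 * (real M)\<^sup>2) * (\<Sum>j=1..M. ennreal (A j x) + ennreal (B j x) + ennreal (J j x)) + ennreal 64 * (ennreal (e 1 x) + ennreal (e 2 x)) \<partial>lebesgue_on \<Omega>)"
    proof (rule nn_integral_mono_AE)
      show "AE x in lebesgue_on \<Omega>. ennreal ((norm (?r x))\<^sup>2) \<le>
        ennreal (64 * (real M)\<^sup>2) * (\<Sum>j=1..M. ennreal (A j x) + ennreal (B j x) + ennreal (J j x)) + ennreal 64 * (ennreal (e 1 x) + ennreal (e 2 x))"
        using pw
      proof eventually_elim
        case (elim x)
        have gen: "ennreal (a * p + b * q) = ennreal a * ennreal p + ennreal b * ennreal q"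
          if "0 \<le> a" "0 \<le> p" "0 \<le> b" "0 \<le> q" for a b p q
          using that by (simp add: ennreal_mult)
        have s1: "(\<Sum>j=1..M. ennreal (A j x) + ennreal (B j x) + ennreal (J j x)) = ennreal (\<Sum>j=1..M. A j x + B j x + J j x)"
          using nn by (subst sum_ennreal[symmetric]) (auto intro!: sum.cong)
        have s2: "(\<Sum>j=1..M. A j x + B j x + J j x) \<ge> 0" using nn by (intro sum_nonneg add_nonneg_nonneg) auto
        have "ennreal ((norm (?r x))\<^sup>2) \<le> ennreal (64 * (real M)\<^sup>2 * (\<Sum>j=1..M. A j x + B j x + J j x) + 64 * (e 1 x + e 2 x))"
          using elim by (rule ennreal_leI)
        also have "\<dots> = ennreal (64 * (real M)\<^sup>2) * ennreal (\<Sum>j=1..M. A j x + B j x + J j x) + ennreal 64 * ennreal (e 1 x + e 2 x)"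
          using s2 nn(4)[of 1 x] nn(4)[of 2 x] by (intro gen) auto
        also have "ennreal (e 1 x + e 2 x) = ennreal (e 1 x) + ennreal (e 2 x)" using nn by simp
        finally show ?case unfolding s1 .
      qed
    qed
    also have "\<dots> = ennreal (64 * (real M)\<^sup>2) * (\<Sum>j=1..M. (\<integral>\<^sup>+x. ennreal (A j x) \<partial>lebesgue_on \<Omega>) + (\<integral>\<^sup>+x. ennreal (B j x) \<partial>lebesgue_on \<Omega>) + (\<integral>\<^sup>+x. ennreal (J j x) \<partial>lebesgue_on \<Omega>))
        + ennreal 64 * ((\<integral>\<^sup>+x. ennreal (e 1 x) \<partial>lebesgue_on \<Omega>) + (\<integral>\<^sup>+x. ennreal (e 2 x) \<partial>lebesgue_on \<Omega>))"
    proof -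
      have m1: "(\<lambda>x. ennreal (A j x) + ennreal (B j x) + ennreal (J j x)) \<in> borel_measurable (lebesgue_on \<Omega>)" if "j \<in> {1..M}" for j
        by (intro borel_measurable_add Am[OF that] Bm Jm)
      have m2: "(\<lambda>x. \<Sum>j=1..M. ennreal (A j x) + ennreal (B j x) + ennreal (J j x)) \<in> borel_measurable (lebesgue_on \<Omega>)"
        by (rule borel_measurable_sum[OF m1])
      have 1: "(\<integral>\<^sup>+x. (\<Sum>j=1..M. ennreal (A j x) + ennreal (B j x) + ennreal (J j x)) \<partial>lebesgue_on \<Omega>)
        = (\<Sum>j=1..M. (\<integral>\<^sup>+x. ennreal (A j x) \<partial>lebesgue_on \<Omega>) + (\<integral>\<^sup>+x. ennreal (B j x) \<partial>lebesgue_on \<Omega>) + (\<integral>\<^sup>+x. ennreal (J j x) \<partial>lebesgue_on \<Omega>))"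
        using m1 Am Bm Jm by (subst nn_integral_sum) (auto intro!: sum.cong simp: nn_integral_add)
      show ?thesis
        unfolding 1[symmetric] using m2 em by (simp add: nn_integral_add nn_integral_cmult)
    qed
    also have "\<dots> \<le> ennreal (64 * (real M)\<^sup>2) * (\<Sum>j=1..M. ennreal \<delta> + ennreal \<delta> + ennreal \<delta>) + ennreal 64 * (ennreal \<delta> + ennreal \<delta>)"
      by (intro add_mono mult_left_mono sum_mono Ai Bi Ji ei) auto
    also have "\<dots> = ennreal (64 * (real M)\<^sup>2 * (real M * (\<delta> + \<delta> + \<delta>)) + 64 * (\<delta> + \<delta>))"
    proof -
      have sA: "(\<Sum>j=1..M. ennreal \<delta> + ennreal \<delta> + ennreal \<delta>) = ennreal (real M * (\<delta> + \<delta> + \<delta>))"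
      proof -
        have 3: "ennreal \<delta> + ennreal \<delta> + ennreal \<delta> = ennreal (\<delta> + \<delta> + \<delta>)"
          using \<delta> by (simp add: ennreal_plus[symmetric] del: ennreal_plus)
        show ?thesis
          unfolding 3 sum_constant card_atLeastAtMost diff_Suc_1 ennreal_of_nat_eq_real_of_nat
          using \<delta> by (intro ennreal_mult[symmetric]) auto
      qed
      have sB: "ennreal \<delta> + ennreal \<delta> = ennreal (\<delta> + \<delta>)"
        using \<delta> by (simp add: ennreal_plus[symmetric] del: ennreal_plus)
      have gen: "ennreal (a * p + b * q) = ennreal a * ennreal p + ennreal b * ennreal q"
        if "0 \<le> a" "0 \<le> p" "0 \<le> b" "0 \<le> q" for a b p q
        using that by (simp add: ennreal_mult)
      show ?thesis
        by (subst sA, subst sB, rule gen[symmetric]) (use \<delta> in auto)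
    qed
    also have "64 * (real M)\<^sup>2 * (real M * (\<delta> + \<delta> + \<delta>)) + 64 * (\<delta> + \<delta>) = \<delta> * (192 * real M ^ 3 + 128)"
      by (simp add: algebra_simps power2_eq_square power3_eq_cube)
    also have "\<dots> = \<eta>"
    proof -
      have "\<eta> / q * q = \<eta>" if "q > 0" for q using that by simp
      then show ?thesis unfolding \<delta>_def using dpos .
    qed
    finally show ?thesis using w by blast
  qed
  moreover have "N > 0" using N by simp
  ultimately show ?thesis using K by blast
qed

text \<open>The corrector is available for each choice of signs, in particular for the favourable phase.\<close>

theorem single_slip_recovery:
  fixes \<Omega> :: "(real^3) set"
  assumes S: "slip_systems M nv b" and \<Omega>: "open \<Omega>" and u: "u \<in> H1 \<Omega>" and dir: "dirichlet_on \<Omega> \<Gamma> g u"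
    and f: "slip_field \<Omega> s m" and R: "RSC \<Omega> M nv s m" and E: "elastic_energy \<Omega> u s m < \<infinity>" and \<epsilon>: "\<epsilon> > 0"
  shows "\<exists>u' s'. u' \<in> H1 \<Omega> \<and> dirichlet_on \<Omega> \<Gamma> g u' \<and> slip_field \<Omega> s' m \<and> Linf_on \<Omega> (\<lambda>x. s' x \<otimes> m x) \<and>
    SSC \<Omega> M nv b s' m \<and> energy \<Omega> M nv b \<sigma> \<tau> u' s' m \<le> energy_rel \<Omega> M nv b \<sigma> \<tau> u s m + ennreal \<epsilon>"
proof -
  have \<Omega>l: "\<Omega> \<in> sets lebesgue" using \<Omega> by auto
  have L2s: "L2_on \<Omega> s" by (rule L2_on_slip[OF S \<Omega> u f R E])
  obtain \<eta> where \<eta>: "\<eta> > 0" and pert: "\<And>w s'. w \<in> C1c \<Omega> \<Longrightarrow> slip_field \<Omega> s' m \<Longrightarrow>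
    (square_integral \<Omega> (\<lambda>x. jacobian_matrix w x - (s' x - s x) \<otimes> m x)) \<le> ennreal \<eta> \<Longrightarrow>
    elastic_energy \<Omega> (\<lambda>x. u x + w x) s' m \<le> elastic_energy \<Omega> u s m + ennreal \<epsilon>"
    using elastic_energy_perturbation[OF \<Omega> u f E \<epsilon>] by blast
  obtain K N where K: "K > 0" and N: "N > 0" and corr: "\<And>\<kappa>. (\<forall>j. \<kappa> j \<in> {1, - 1}) \<Longrightarrow> (\<exists>w\<in>C1c \<Omega>.
    (square_integral \<Omega> (\<lambda>x. jacobian_matrix w x -
       (laminated_slip M nv b (phase_layers N \<kappa>) K s m x - s x) \<otimes> m x)) \<le> ennreal \<eta>)"
    using laminate_corrector_exists[OF S \<Omega> f R L2s \<eta>] by blast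
  define L0 where "L0 = {t. phase_sign N 1 t = 1}"
  have [measurable]: "phase_sign N a \<in> borel_measurable borel" for a unfolding phase_sign_def by measurable
  have L0: "L0 \<in> sets borel" unfolding L0_def by measurable
  have L0': "- L0 = {t. phase_sign N (- 1) t = 1}" by (auto simp: L0_def phase_sign_def split: if_splits)
  obtain L where L: "\<And>j. L j \<in> {L0, - L0}" and Lle:
    "ennreal \<sigma> * (\<Sum>j=1..M. ennreal 2 * layered_tv \<Omega> M nv b s m j (L j))
    + ennreal \<tau> * (\<Sum>j=1..M. ennreal 2 * layered_mass \<Omega> M nv b s m j (L j))
    \<le> ennreal \<sigma> * total_curl_lam \<Omega> M nv b s m + ennreal \<tau> * L1_lam \<Omega> M nv b s m"
    using exists_favourable_phase[OF S \<Omega>l f R L0, of \<sigma> \<tau>] by blast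
  have Lb: "L j \<in> sets borel" for j using L[of j] L0 by auto
  have Ll: "L j \<in> sets lebesgue" for j by (rule sets_completionI_sets) (simp add: Lb)
  define \<kappa> :: "nat \<Rightarrow> real" where "\<kappa> j = (if L j = L0 then 1 else - 1)" for j
  have \<kappa>: "\<forall>j. \<kappa> j \<in> {1, - 1}" by (simp add: \<kappa>_def)
  have L\<kappa>: "L = phase_layers N \<kappa>"
  proof
    fix j show "L j = {t. phase_sign N (\<kappa> j) t = 1}"
      using L[of j] by (cases "L j = L0") (simp_all add: \<kappa>_def L0_def[symmetric] L0')
  qed
  define s' where "s' = laminated_slip M nv b L K s m"
  have sf: "slip_field \<Omega> s' m" unfolding s'_def by (rule laminated_slip_measurable[OF S \<Omega>l f R Lb])
  obtain w where w: "w \<in> C1c \<Omega>" and wle: "(square_integral \<Omega> (\<lambda>x. jacobian_matrix w x - (s' x - s x) \<otimes> m x)) \<le> ennreal \<eta>"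
    using corr[OF \<kappa>] unfolding s'_def L\<kappa> by blast
  have s'eq: "s' x = (if x \<bullet> nv j \<in> L j then (2 * soft_cap K (slip_coeff M nv b s m 1 x)) *\<^sub>R b 1 j
     else (2 * soft_cap K (slip_coeff M nv b s m 2 x)) *\<^sub>R b 2 j)" if "j \<in> {1..M}" "m x = nv j" for j x
    unfolding s'_def by (rule laminated_slip_eq[where m=m and x=x, OF S that])
  have ssc: "SSC \<Omega> M nv b s' m"
    using R unfolding RSC_def SSC_def
  proof eventually_elim
    case (elim x)
    then obtain j where j: "j \<in> {1..M}" "m x = nv j" by blast
    then show ?case using s'eq[OF j] by (intro bexI[of _ j]) auto
  qed
  have linf: "Linf_on \<Omega> (\<lambda>x. s' x \<otimes> m x)"
    unfolding Linf_on_def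
  proof (intro conjI exI)
    show "(\<lambda>x. s' x \<otimes> m x) \<in> borel_measurable (lebesgue_on \<Omega>)"
      using sf by (intro borel_measurable_tensor) (auto simp: slip_field_def)
    show "AE x in lebesgue_on \<Omega>. norm (s' x \<otimes> m x) \<le> 4 * K"
      using R unfolding RSC_def
    proof eventually_elim
      case (elim x)
      then obtain j where j: "j \<in> {1..M}" "m x = nv j" by blast
      then show ?case
        using s'eq[OF j] slip_systemsD[OF S j(1)] soft_cap_bounded[OF K, of "slip_coeff M nv b s m 1 x"]
          soft_cap_bounded[OF K, of "slip_coeff M nv b s m 2 x"] by (simp add: norm_tensor abs_mult)
    qed
  qed
  have curl: "total_curl \<Omega> M nv s' m \<le> (\<Sum>j=1..M. ennreal 2 * layered_tv \<Omega> M nv b s m j (L j))"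
    unfolding total_curl_def s'_def by (intro sum_mono planar_curl_laminated_slip_le[OF S \<Omega> K _ Ll])
  have mass: "(\<integral>\<^sup>+x\<in>\<Omega>. ennreal (norm (s' x \<otimes> m x)) \<partial>lebesgue) \<le> (\<Sum>j=1..M. ennreal 2 * layered_mass \<Omega> M nv b s m j (L j))"
    unfolding s'_def by (rule mass_laminated_slip_le[OF S \<Omega>l f R Lb K])
  have "energy \<Omega> M nv b \<sigma> \<tau> (\<lambda>x. u x + w x) s' m
     = elastic_energy \<Omega> (\<lambda>x. u x + w x) s' m + (ennreal \<sigma> * total_curl \<Omega> M nv s' m + ennreal \<tau> * (\<integral>\<^sup>+x\<in>\<Omega>. ennreal (norm (s' x \<otimes> m x)) \<partial>lebesgue))"
    using ssc by (simp add: energy_def add.assoc)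
  also have "\<dots> \<le> (elastic_energy \<Omega> u s m + ennreal \<epsilon>) + (ennreal \<sigma> * total_curl_lam \<Omega> M nv b s m + ennreal \<tau> * L1_lam \<Omega> M nv b s m)"
    by (intro add_mono pert[OF w sf wle] order_trans[OF _ Lle] mult_left_mono curl mass) auto
  also have "\<dots> = energy_rel \<Omega> M nv b \<sigma> \<tau> u s m + ennreal \<epsilon>"
    using R by (simp add: energy_rel_def ac_simps)
  finally have en: "energy \<Omega> M nv b \<sigma> \<tau> (\<lambda>x. u x + w x) s' m \<le> energy_rel \<Omega> M nv b \<sigma> \<tau> u s m + ennreal \<epsilon>" .
  show ?thesis
    using H1_add_C1c[OF \<Omega> u w] dirichlet_on_add_C1c[OF \<Omega> dir w] sf linf ssc en by blast
qed

theorem theorem4p1: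
  fixes \<Omega> \<Gamma>\<^sub>D :: "(real^3) set" and \<Omega>s :: "nat \<Rightarrow> (real^3) set"
    and M :: nat and nv :: "nat \<Rightarrow> real^3" and b :: "nat \<Rightarrow> nat \<Rightarrow> real^3"
    and \<sigma> \<tau> :: real and u g s m :: "real^3 \<Rightarrow> real^3"
  assumes "slip_systems M nv b"
    and "\<sigma> \<ge> 0" and "\<tau> \<ge> 0"
    and "lipschitz_domain \<Omega>"
    and "closure \<Omega> = (\<Union>i. closure (\<Omega>s i))"
    and "\<And>i. is_domain (\<Omega>s i)"
    and "disjoint_family \<Omega>s"
    and "\<And>i. finite_perimeter (\<Omega>s i)"
    and "\<And>i. hausdorff_outer 2 (frontier (\<Omega>s i) - reduced_boundary (\<Omega>s i)) = 0"
    and "lipschitz_boundary_part \<Omega> \<Gamma>\<^sub>D"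
    and "u \<in> H1 \<Omega>"
    and "dirichlet_on \<Omega> \<Gamma>\<^sub>D g u"
    and "slip_field \<Omega> s m"
    and "RSC \<Omega> M nv s m"
    and "\<And>i. \<exists>j\<in>{1..M}. AE x in lebesgue_on (\<Omega>s i). m x = nv j"
    and "energy_rel \<Omega> M nv b \<sigma> \<tau> u s m < \<infinity>"
  shows "\<forall>\<epsilon>>0. \<exists>u' s' m'.
           u' \<in> H1 \<Omega> \<and> dirichlet_on \<Omega> \<Gamma>\<^sub>D g u' \<and>
           slip_field \<Omega> s' m' \<and> Linf_on \<Omega> (\<lambda>x. s' x \<otimes> m' x) \<and> SSC \<Omega> M nv b s' m' \<and>
           energy \<Omega> M nv b \<sigma> \<tau> u' s' m' \<le> energy_rel \<Omega> M nv b \<sigma> \<tau> u s m + ennreal \<epsilon>"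
proof (intro allI impI)
  fix \<epsilon> :: real assume "\<epsilon> > 0"
  have "open \<Omega>"
    using assms(4) by (simp add: lipschitz_domain_def is_domain_def)
  moreover have "elastic_energy \<Omega> u s m < \<infinity>"
    using assms(14,16) by (simp add: energy_rel_def)
  ultimately show "\<exists>u' s' m'.
           u' \<in> H1 \<Omega> \<and> dirichlet_on \<Omega> \<Gamma>\<^sub>D g u' \<and>
           slip_field \<Omega> s' m' \<and> Linf_on \<Omega> (\<lambda>x. s' x \<otimes> m' x) \<and> SSC \<Omega> M nv b s' m' \<and>
           energy \<Omega> M nv b \<sigma> \<tau> u' s' m' \<le> energy_rel \<Omega> M nv b \<sigma> \<tau> u s m + ennreal \<epsilon>"
    using single_slip_recovery[OF assms(1) _ assms(11,12,13,14) _ \<open>\<epsilon> > 0\<close>] by blast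
qed

end
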